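(* Let $m \in \mathbb{N} \setminus \{1\}$ be given. Assume that $f \in L^2(\mathbb{R}) \cap C(\mathbb{R})$ is bandlimited with bandwidth $\delta \in \big(0, \frac{m-1}{m}\pi\big]$. Further let $\varphi_{\mathrm{cKB}}$ be the continuous Kaiser--Bessel window function $$\varphi_{\mathrm{cKB}}(t) := \begin{cases} \frac{1}{I_0(\beta) - 1} \Big( I_0\big(\beta \sqrt{1 - t^2/m^2}\big) - 1 \Big) & t \in [-m,m], \\ 0 & t \in \mathbb{R} \setminus [-m,m], \end{cases}$$ with shape parameter $\beta = m(\pi - \delta)$. Then the continuous Kaiser--Bessel regularized Shannon sampling formula $R_{\mathrm{cKB},m} f := R_{\varphi_{\mathrm{cKB}},m} f$ satisfies the error estimate $$\big\| f - R_{\mathrm{cKB},m} f \big\|_{C_0(\mathbb{R})} \le \bigg( \frac{7}{8}\, m(\pi-\delta) + \frac{7}{\pi}\, m^2 (\pi-\delta)^2 \bigg)\, \mathrm{e}^{-m(\pi-\delta)}\, \| f \|_{L^2(\mathbb{R})}.$$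
   Context: $\mathbb{N} = \{1,2,3,\ldots\}$. $I_0$ denotes the modified Bessel function of the first kind of order zero. The Fourier transform is $\hat{g}(\omega) := \frac{1}{\sqrt{2\pi}} \int_{\mathbb{R}} g(t)\, \mathrm{e}^{-\mathrm{i} t\omega}\, \mathrm{d}t$, $\omega \in \mathbb{R}$ (extended to $L^2(\mathbb{R})$ in the usual way). A function $f \in L^2(\mathbb{R}) \cap C(\mathbb{R})$ is called bandlimited with bandwidth $\delta > 0$ if $\hat{f}(\omega) = 0$ for all $|\omega| \ge \delta$. The cardinal sine function is $\mathrm{sinc}(t) := \frac{\sin(\pi t)}{\pi t}$ for $t \ne 0$ and $\mathrm{sinc}(0) := 1$. Let $\mathbf{1}_{[-m,m]}$ denote the characteristic function of $[-m,m]$. For a window function $\varphi : \mathbb{R} \to [0,1]$, the $\varphi$-regularized Shannon sampling formula with truncation parameter $m \in \mathbb{N} \setminus \{1\}$ is $$(R_{\varphi,m} f)(t) := \sum_{k \in \mathbb{Z}} f(k)\, \mathrm{sinc}(t-k)\, \varphi(t-k)\, \mathbf{1}_{[-m,m]}(t-k), \quad t \in \mathbb{R}.$$ $C_0(\mathbb{R})$ is the Banach space of continuous functions $g : \mathbb{R} \to \mathbb{C}$ vanishing as $|t| \to \infty$, with norm $\|g\|_{C_0(\mathbb{R})} := \max_{t \in \mathbb{R}} |g(t)|$. *)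

theory Defs
  imports "HOL-Analysis.Analysis"
begin

definition L1_space :: "(real \<Rightarrow> complex) set" where
  "L1_space = {f. integrable lborel f}"

definition L2_space :: "(real \<Rightarrow> complex) set" where
  "L2_space = {f. f \<in> borel_measurable lborel \<and> integrable lborel (\<lambda>t. (cmod (f t))\<^sup>2)}"

definition L2_norm :: "(real \<Rightarrow> complex) \<Rightarrow> real" where
  "L2_norm f = sqrt (LINT t|lborel. (cmod (f t))\<^sup>2)"

definition fourier_integral :: "(real \<Rightarrow> complex) \<Rightarrow> real \<Rightarrow> complex" where
  "fourier_integral g \<omega> =
     complex_of_real (1 / sqrt (2 * pi)) *
     (LINT t|lborel. g t * exp (- (\<i> * complex_of_real (t * \<omega>))))"

text \<open>
  The extension of the Fourier transform from \<open>L\<^sup>1 \<inter> L\<^sup>2\<close> to \<open>L\<^sup>2\<close> by density: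
  \<open>g\<close> is a representative of the Fourier transform of \<open>f\<close>, which is determined
  only up to a null set. By Plancherel's theorem the transforms of the \<open>u n\<close> are in
  \<open>L\<^sup>2\<close> automatically and the limit does not depend on the sequence; the membership
  is stated so that every \<open>L2_norm\<close> below is applied to an \<open>L\<^sup>2\<close> function.
\<close>
definition has_L2_fourier :: "(real \<Rightarrow> complex) \<Rightarrow> (real \<Rightarrow> complex) \<Rightarrow> bool" where
  "has_L2_fourier f g \<longleftrightarrow>
     f \<in> L2_space \<and> g \<in> L2_space \<and>
     (\<exists>u :: nat \<Rightarrow> real \<Rightarrow> complex.
        (\<forall>n. u n \<in> L1_space \<inter> L2_space \<and> fourier_integral (u n) \<in> L2_space) \<and>
        (\<lambda>n. L2_norm (\<lambda>t. u n t - f t)) \<longlonglongrightarrow> 0 \<and>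
        (\<lambda>n. L2_norm (\<lambda>\<omega>. fourier_integral (u n) \<omega> - g \<omega>)) \<longlonglongrightarrow> 0)"

definition bandlimited :: "real \<Rightarrow> (real \<Rightarrow> complex) \<Rightarrow> bool" where
  "bandlimited \<delta> f \<longleftrightarrow>
     \<delta> > 0 \<and> f \<in> L2_space \<and> continuous_on UNIV f \<and>
     (\<exists>g. has_L2_fourier f g \<and> (AE \<omega> in lborel. \<bar>\<omega>\<bar> \<ge> \<delta> \<longrightarrow> g \<omega> = 0))"

definition cardinal_sine :: "real \<Rightarrow> real" where
  "cardinal_sine t = (if t = 0 then 1 else sin (pi * t) / (pi * t))"

text \<open>The modified Bessel function of the first kind of order zero, by its power series.\<close>
definition bessel_I0 :: "real \<Rightarrow> real" where
  "bessel_I0 x = (\<Sum>k. (x / 2) ^ (2 * k) / (fact k)\<^sup>2)"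

definition cKB_window :: "nat \<Rightarrow> real \<Rightarrow> real \<Rightarrow> real" where
  "cKB_window m \<beta> t =
     (if t \<in> {- real m..real m}
      then 1 / (bessel_I0 \<beta> - 1) * (bessel_I0 (\<beta> * sqrt (1 - t\<^sup>2 / (real m)\<^sup>2)) - 1)
      else 0)"

definition regularized_shannon ::
  "(real \<Rightarrow> real) \<Rightarrow> nat \<Rightarrow> (real \<Rightarrow> complex) \<Rightarrow> real \<Rightarrow> complex" where
  "regularized_shannon \<phi> m f t =
     (\<Sum>\<^sub>\<infinity>k::int. f (of_int k) *
        complex_of_real (cardinal_sine (t - of_int k) * \<phi> (t - of_int k) *
                         indicator {- real m..real m} (t - of_int k)))"

definition C0_space :: "(real \<Rightarrow> complex) set" where
  "C0_space = {g. continuous_on UNIV g \<and> (g \<longlongrightarrow> 0) at_infinity}"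

text \<open>On \<^const>\<open>C0_space\<close> the supremum is attained, so it is the maximum.\<close>
definition C0_norm :: "(real \<Rightarrow> complex) \<Rightarrow> real" where
  "C0_norm g = (SUP t. cmod (g t))"

end

theory Submission
  imports Defs "HOL-Probability.Probability" "HOL-Real_Asymp.Real_Asymp"
begin

text \<open>
  A bandlimited \<open>f\<close> is a superposition of exponentials \<open>exp (\<i> t \<omega>)\<close> with \<open>\<bar>\<omega>\<bar> < \<delta>\<close>, and the regularized
  formula is linear, so the error is governed by the error for a single exponential. Write the
  window as \<open>\<phi>(x) = \<integral> \<Phi>(\<tau>) exp (\<i> x \<tau>) d\<tau>\<close>. For a pure frequency \<open>\<nu>\<close> with \<open>\<bar>\<nu>\<bar> < pi\<close> the cardinal series
  \<open>\<Sum>k. exp (\<i> \<nu> (t - k)) sinc (t - k)\<close> has sum one, and its Cesaro means are bounded by one for every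
  \<open>\<nu>\<close> because the Fejer kernel is positive. Hence the frequencies \<open>\<tau>\<close> with \<open>\<bar>\<tau> - \<omega>\<bar> < pi\<close> contribute
  exactly what they should, and the error for the exponential of frequency \<open>\<omega>\<close> is at most
  \<open>2 \<integral> \<bar>\<Phi>(\<tau>)\<bar> d\<tau>\<close> over \<open>\<bar>\<tau> - \<omega>\<bar> \<ge> pi\<close> (lemma \<open>regularized_sampling_defect\<close>). In this
  form of Poisson summation all aliases are handled at once.

  The Kaiser--Bessel window is made for this. Expanding Bessel function and exponential into power
  series gives \<open>\<Phi>\<close> in closed form (\<open>kaiser_bessel_cosine_transform\<close>, \<open>cKB_window_fourier\<close>): it is
  \<open>m / (pi (I\<^sub>0(\<beta>) - 1))\<close> times the difference of \<open>sinh(sqrt(\<beta>\<^sup>2 - m\<^sup>2\<tau>\<^sup>2))/sqrt(\<beta>\<^sup>2 - m\<^sup>2\<tau>\<^sup>2)\<close> and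
  \<open>sin(m\<tau>)/(m\<tau>)\<close>. Beyond \<open>\<bar>\<tau>\<bar> = \<beta>/m = pi - \<delta>\<close> the hyperbolic sine becomes a sine, and the
  difference is of order \<open>\<beta>\<^sup>2/(m\<tau>)\<^sup>2\<close> (\<open>kaiser_bessel_hat_decay\<close>). For \<open>\<bar>\<omega>\<bar> < \<delta>\<close> all frequencies at distance
  at least \<open>pi\<close> from \<open>\<omega>\<close> lie there, so the tail integral is of order \<open>\<beta>/(I\<^sub>0(\<beta>) - 1)\<close>. Together
  with the Cauchy--Schwarz inequality on the band this gives the error bound
  \<open>8 \<beta> / (3 pi (I\<^sub>0(\<beta>) - 1))\<close> times the norm of \<open>f\<close> (\<open>shannon_error_pointwise\<close>), and the exponential rate
  comes from \<open>I\<^sub>0(\<beta>) \<ge> sinh(\<beta>)/\<beta>\<close> and \<open>\<beta> \<ge> pi\<close> (\<open>bessel_I0_lower_bound\<close>).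

  The Fourier theory needed is inversion at every point and the inequality \<open>\<parallel>g\<parallel> \<le> \<parallel>f\<parallel>\<close> for a transform
  \<open>g\<close> of \<open>f\<close>. Both follow by damping with Gaussians, whose transforms are known from
  probability theory (\<open>L2_fourier_inversion\<close>, \<open>L2_fourier_norm_le\<close>); inversion serves \<open>f\<close> and the
  window alike.
\<close>

section \<open>Square-integrable functions\<close>

lemma cnj_measurable [measurable]: "cnj \<in> borel_measurable borel"
  by (intro borel_measurable_continuous_onI continuous_intros)

lemma L2_product_integrable:
  assumes "f \<in> L2_space" "g \<in> L2_space"
  shows "integrable lborel (\<lambda>t. f t * g t)"
proof -
  have [measurable]: "f \<in> borel_measurable lborel" "g \<in> borel_measurable lborel"
    using assms by (auto simp: L2_space_def)
  have "integrable lborel (\<lambda>t. (cmod (f t))\<^sup>2 + (cmod (g t))\<^sup>2)"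
    using assms by (auto simp: L2_space_def)
  then show ?thesis
  proof (rule Bochner_Integration.integrable_bound)
    show "AE t in lborel. norm (f t * g t) \<le> norm ((cmod (f t))\<^sup>2 + (cmod (g t))\<^sup>2)"
    proof (rule AE_I2)
      fix t
      have "2 * (cmod (f t) * cmod (g t)) \<le> (cmod (f t))\<^sup>2 + (cmod (g t))\<^sup>2"
        using sum_squares_bound[of "cmod (f t)" "cmod (g t)"] by (simp add: mult.assoc)
      moreover have "0 \<le> cmod (f t) * cmod (g t)" by simp
      ultimately have "cmod (f t) * cmod (g t) \<le> (cmod (f t))\<^sup>2 + (cmod (g t))\<^sup>2" by linarith
      then show "norm (f t * g t) \<le> norm ((cmod (f t))\<^sup>2 + (cmod (g t))\<^sup>2)"
        by (simp add: norm_mult)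
    qed
  qed measurable
qed

lemma L2_norm_nonneg [simp]: "0 \<le> L2_norm f"
  by (simp add: L2_norm_def)

lemma L2_norm_square: "(L2_norm f)\<^sup>2 = (LINT t|lborel. (cmod (f t))\<^sup>2)"
  by (simp add: L2_norm_def)

lemma L2_Cauchy_Schwarz:
  assumes "f \<in> L2_space" "g \<in> L2_space"
  shows "(LINT t|lborel. cmod (f t) * cmod (g t)) \<le> L2_norm f * L2_norm g"
proof -
  have [measurable]: "f \<in> borel_measurable lborel" "g \<in> borel_measurable lborel"
    using assms by (auto simp: L2_space_def)
  have int: "integrable lborel (\<lambda>t. cmod (f t) * cmod (g t))"
    using integrable_norm[OF L2_product_integrable[OF assms]] by (simp add: norm_mult)
  have "(\<integral>\<^sup>+ t. ennreal (cmod (f t)) * ennreal (cmod (g t)) \<partial>lborel)\<^sup>2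
      \<le> (\<integral>\<^sup>+ t. (ennreal (cmod (f t)))^2 \<partial>lborel) * (\<integral>\<^sup>+ t. (ennreal (cmod (g t)))^2 \<partial>lborel)"
    by (rule Cauchy_Schwarz_nn_integral) measurable
  also have "(\<integral>\<^sup>+ t. ennreal (cmod (f t)) * ennreal (cmod (g t)) \<partial>lborel)
      = ennreal (LINT t|lborel. cmod (f t) * cmod (g t))"
    using int by (simp add: ennreal_mult[symmetric] nn_integral_eq_integral)
  also have "(\<integral>\<^sup>+ t. (ennreal (cmod (f t)))^2 \<partial>lborel) = ennreal ((L2_norm f)\<^sup>2)"
    using assms by (simp add: L2_norm_square ennreal_power nn_integral_eq_integral L2_space_def)
  also have "(\<integral>\<^sup>+ t. (ennreal (cmod (g t)))^2 \<partial>lborel) = ennreal ((L2_norm g)\<^sup>2)"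
    using assms by (simp add: L2_norm_square ennreal_power nn_integral_eq_integral L2_space_def)
  finally have "(LINT t|lborel. cmod (f t) * cmod (g t))\<^sup>2 \<le> (L2_norm f * L2_norm g)\<^sup>2"
    by (simp add: ennreal_power ennreal_mult[symmetric] power_mult_distrib)
  then show ?thesis
    by (rule power2_le_imp_le) simp
qed

lemma L2_add:
  assumes "f \<in> L2_space" "g \<in> L2_space"
  shows "(\<lambda>t. f t + g t) \<in> L2_space"
    and "L2_norm (\<lambda>t. f t + g t) \<le> L2_norm f + L2_norm g"
proof -
  have [measurable]: "f \<in> borel_measurable lborel" "g \<in> borel_measurable lborel"
    and f: "integrable lborel (\<lambda>t. (cmod (f t))\<^sup>2)" and g: "integrable lborel (\<lambda>t. (cmod (g t))\<^sup>2)"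
    using assms by (auto simp: L2_space_def)
  have fg: "integrable lborel (\<lambda>t. cmod (f t) * cmod (g t))"
    using integrable_norm[OF L2_product_integrable[OF assms]] by (simp add: norm_mult)
  have int: "integrable lborel (\<lambda>t. (cmod (f t))\<^sup>2 + 2 * (cmod (f t) * cmod (g t)) + (cmod (g t))\<^sup>2)"
    using f g fg by auto
  have le: "(cmod (f t + g t))\<^sup>2 \<le> (cmod (f t))\<^sup>2 + 2 * (cmod (f t) * cmod (g t)) + (cmod (g t))\<^sup>2" for t
  proof -
    have "(cmod (f t + g t))\<^sup>2 \<le> (cmod (f t) + cmod (g t))\<^sup>2"
      by (intro power_mono norm_triangle_ineq) simp
    then show ?thesis by (simp add: power2_sum algebra_simps)
  qed
  have int2: "integrable lborel (\<lambda>t. (cmod (f t + g t))\<^sup>2)"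
    by (rule Bochner_Integration.integrable_bound[OF int]) (use le in \<open>auto intro!: AE_I2 order_trans[OF le] \<close>)
  then show "(\<lambda>t. f t + g t) \<in> L2_space" by (simp add: L2_space_def)
  have "(L2_norm (\<lambda>t. f t + g t))\<^sup>2
      \<le> (LINT t|lborel. (cmod (f t))\<^sup>2 + 2 * (cmod (f t) * cmod (g t)) + (cmod (g t))\<^sup>2)"
    unfolding L2_norm_square by (rule integral_mono[OF int2 int le])
  also have "\<dots> = (L2_norm f)\<^sup>2 + 2 * (LINT t|lborel. cmod (f t) * cmod (g t)) + (L2_norm g)\<^sup>2"
    using f g fg by (simp add: L2_norm_square)
  also have "\<dots> \<le> (L2_norm f + L2_norm g)\<^sup>2"
    using L2_Cauchy_Schwarz[OF assms] by (simp add: power2_sum)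
  finally show "L2_norm (\<lambda>t. f t + g t) \<le> L2_norm f + L2_norm g"
    by (rule power2_le_imp_le) simp
qed

lemma L2_uminus:
  assumes "f \<in> L2_space"
  shows "(\<lambda>t. - f t) \<in> L2_space"
  using assms by (simp add: L2_space_def)

lemma L2_diff:
  assumes "f \<in> L2_space" "g \<in> L2_space"
  shows "(\<lambda>t. f t - g t) \<in> L2_space"
  using L2_add(1)[OF assms(1) L2_uminus[OF assms(2)]] by simp

lemma L2_norm_diff_swap: "L2_norm (\<lambda>t. f t - g t) = L2_norm (\<lambda>t. g t - f t)"
  by (simp add: L2_norm_def norm_minus_commute)

lemma L2_norm_le_norm_add_dist:
  assumes "f \<in> L2_space" "g \<in> L2_space"
  shows "L2_norm f \<le> L2_norm g + L2_norm (\<lambda>t. f t - g t)"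
  using L2_add(2)[OF assms(2) L2_diff[OF assms]] by simp

lemma L2_bounded_integrable:
  assumes "integrable lborel q" "\<And>t. cmod (q t) \<le> C"
  shows "q \<in> L2_space"
proof -
  have [measurable]: "q \<in> borel_measurable borel" using assms(1) by auto
  have "integrable lborel (\<lambda>t. C * cmod (q t))" using assms(1) by auto
  then have "integrable lborel (\<lambda>t. (cmod (q t))\<^sup>2)"
  proof (rule Bochner_Integration.integrable_bound)
    show "AE t in lborel. norm ((cmod (q t))\<^sup>2) \<le> norm (C * cmod (q t))"
    proof (rule AE_I2)
      fix t
      have "0 \<le> C" using assms(2)[of t] norm_ge_zero order_trans by blast
      then show "norm ((cmod (q t))\<^sup>2) \<le> norm (C * cmod (q t))"
        using assms(2)[of t] by (simp add: power2_eq_square mult_right_mono)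
    qed
  qed measurable
  then show ?thesis by (simp add: L2_space_def)
qed

text \<open>
  Pairing with a fixed \<open>L\<^sup>2\<close> function is continuous. This carries identities for
  \<open>L\<^sup>1 \<inter> L\<^sup>2\<close> over to the Fourier transform on \<open>L\<^sup>2\<close>, which is only given as a limit.
\<close>
lemma L2_functional_tendsto:
  assumes u: "\<And>n. u n \<in> L2_space" and f: "f \<in> L2_space" and q: "q \<in> L2_space"
    and lim: "(\<lambda>n. L2_norm (\<lambda>t. u n t - f t)) \<longlonglongrightarrow> 0"
  shows "(\<lambda>n. LINT t|lborel. u n t * q t) \<longlonglongrightarrow> (LINT t|lborel. f t * q t)"
proof -
  have "(\<lambda>n. (LINT t|lborel. u n t * q t) - (LINT t|lborel. f t * q t)) \<longlonglongrightarrow> 0"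
  proof (rule Lim_null_comparison)
    show "(\<lambda>n. L2_norm (\<lambda>t. u n t - f t) * L2_norm q) \<longlonglongrightarrow> 0"
      using tendsto_mult_right[OF lim, of "L2_norm q"] by simp
    show "\<forall>\<^sub>F n in sequentially. norm ((LINT t|lborel. u n t * q t) - (LINT t|lborel. f t * q t))
        \<le> L2_norm (\<lambda>t. u n t - f t) * L2_norm q"
    proof (rule always_eventually, rule allI)
      fix n
      have "(LINT t|lborel. u n t * q t) - (LINT t|lborel. f t * q t) = (LINT t|lborel. (u n t - f t) * q t)"
        using L2_product_integrable[OF u q] L2_product_integrable[OF f q]
        by (simp add: left_diff_distrib Bochner_Integration.integral_diff)
      also have "norm \<dots> \<le> (LINT t|lborel. norm ((u n t - f t) * q t))"
        by (rule integral_norm_bound)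
      also have "\<dots> \<le> L2_norm (\<lambda>t. u n t - f t) * L2_norm q"
        using L2_Cauchy_Schwarz[OF L2_diff[OF u f] q] by (simp add: norm_mult)
      finally show "norm ((LINT t|lborel. u n t * q t) - (LINT t|lborel. f t * q t))
        \<le> L2_norm (\<lambda>t. u n t - f t) * L2_norm q" .
    qed
  qed
  then show ?thesis by (simp add: LIM_zero_iff)
qed

section \<open>Gaussian summability of the Fourier transform\<close>

text \<open>
  Rescaling of the characteristic function of the standard normal distribution.
\<close>
lemma gaussian_fourier:
  assumes "0 < \<epsilon>"
  shows "(LINT \<omega>|lborel. iexp (\<omega> * x) * of_real (exp (- (\<epsilon> * \<omega>)\<^sup>2 / 2)))
     = of_real (2 * pi * normal_density 0 \<epsilon> x)"
proof -
  define t where "t = x / \<epsilon>"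
  have "complex_of_real (exp (- (t^2) / 2)) = (CLINT y|std_normal_distribution. iexp (t * y))"
    using char_std_normal_distribution by (simp add: char_def fun_eq_iff)
  also have "\<dots> = (CLINT y|lborel. std_normal_density y *\<^sub>R iexp (t * y))"
    by (rule integral_density) auto
  also have "\<dots> = \<bar>\<epsilon>\<bar> *\<^sub>R (CLINT \<omega>|lborel. std_normal_density (0 + \<epsilon> * \<omega>) *\<^sub>R iexp (t * (0 + \<epsilon> * \<omega>)))"
    by (rule lborel_integral_real_affine) (use assms in simp)
  also have "(\<lambda>\<omega>. std_normal_density (0 + \<epsilon> * \<omega>) *\<^sub>R iexp (t * (0 + \<epsilon> * \<omega>)))
      = (\<lambda>\<omega>. (1 / sqrt (2 * pi)) *\<^sub>R (iexp (\<omega> * x) * of_real (exp (- (\<epsilon> * \<omega>)\<^sup>2 / 2))))"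
    using assms by (auto simp: fun_eq_iff std_normal_density_def t_def scaleR_conv_of_real mult_ac)
  also have "\<bar>\<epsilon>\<bar> *\<^sub>R (CLINT \<omega>|lborel. \<dots> \<omega>)
     = (\<epsilon> / sqrt (2 * pi)) *\<^sub>R (CLINT \<omega>|lborel. iexp (\<omega> * x) * of_real (exp (- (\<epsilon> * \<omega>)\<^sup>2 / 2)))"
    using assms by simp
  finally have *: "complex_of_real (exp (- (t^2) / 2))
     = (\<epsilon> / sqrt (2 * pi)) *\<^sub>R (CLINT \<omega>|lborel. iexp (\<omega> * x) * of_real (exp (- (\<epsilon> * \<omega>)\<^sup>2 / 2)))" .
  have "(CLINT \<omega>|lborel. iexp (\<omega> * x) * of_real (exp (- (\<epsilon> * \<omega>)\<^sup>2 / 2)))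
     = (sqrt (2 * pi) / \<epsilon>) *\<^sub>R complex_of_real (exp (- (t^2) / 2))"
    unfolding * using assms by simp
  also have "(sqrt (2 * pi) / \<epsilon>) = 2 * pi * (1 / sqrt (2 * pi * \<epsilon>\<^sup>2))"
  proof -
    have "2 * pi = sqrt (2 * pi) * sqrt (2 * pi)" by simp
    moreover have "sqrt (2 * pi * \<epsilon>\<^sup>2) = sqrt (2 * pi) * \<epsilon>"
      using assms by (simp add: real_sqrt_mult)
    moreover have "sqrt (2 * pi) \<noteq> 0" by simp
    ultimately show ?thesis
      using assms by (metis nonzero_mult_divide_mult_cancel_left mult.right_neutral times_divide_eq_right)
  qed
  finally show ?thesis
    using assms by (simp add: normal_density_def t_def scaleR_conv_of_real power_divide mult_ac)
qed

lemma gaussian_weight_integrable: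
  assumes "0 < \<epsilon>"
  shows "integrable lborel (\<lambda>\<omega>::real. exp (- (\<epsilon> * \<omega>)\<^sup>2 / 2))"
proof -
  have "(\<lambda>\<omega>. exp (- (\<epsilon> * \<omega>)\<^sup>2 / 2)) = (\<lambda>\<omega>. sqrt (2 * pi * (1/\<epsilon>)\<^sup>2) * normal_density 0 (1 / \<epsilon>) \<omega>)"
    using assms by (auto simp: normal_density_def fun_eq_iff power_mult_distrib power_divide field_simps)
  then show ?thesis using assms by simp
qed

lemma normal_density_bound:
  assumes "0 < \<epsilon>"
  shows "normal_density \<mu> \<epsilon> x \<le> 1 / sqrt (2 * pi * \<epsilon>\<^sup>2)"
  using assms by (simp add: normal_density_def divide_right_mono)

lemma normal_density_swap: "normal_density 0 \<epsilon> (t - s) = normal_density t \<epsilon> s"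
  by (simp add: normal_density_def power2_commute)

lemma normal_density_L2:
  assumes "0 < \<epsilon>"
  shows "(\<lambda>s. complex_of_real (normal_density 0 \<epsilon> (t - s))) \<in> L2_space"
proof (rule L2_bounded_integrable)
  show "integrable lborel (\<lambda>s. complex_of_real (normal_density 0 \<epsilon> (t - s)))"
    unfolding normal_density_swap using integrable_normal_density[OF assms, of t] by (intro integrable_of_real)
  show "cmod (complex_of_real (normal_density 0 \<epsilon> (t - s))) \<le> 1 / sqrt (2 * pi * \<epsilon>\<^sup>2)" for s
    using normal_density_bound[OF assms, of 0 "t-s"] by simp
qed

lemma fourier_integral_iexp:
  "fourier_integral u \<omega> = complex_of_real (1 / sqrt (2 * pi)) * (LINT s|lborel. u s * iexp (- (s * \<omega>)))"
  by (simp add: fourier_integral_def)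

lemma fourier_integral_measurable [measurable]:
  assumes [measurable]: "u \<in> borel_measurable borel"
  shows "fourier_integral u \<in> borel_measurable borel"
  unfolding fourier_integral_iexp[abs_def] by measurable

lemma fourier_integral_bound:
  assumes "integrable lborel u"
  shows "cmod (fourier_integral u \<omega>) \<le> (LINT s|lborel. cmod (u s))"
proof -
  have "cmod (LINT s|lborel. u s * iexp (- (s * \<omega>))) \<le> (LINT s|lborel. cmod (u s * iexp (- (s * \<omega>))))"
    by (rule integral_norm_bound)
  then have *: "cmod (LINT s|lborel. u s * iexp (- (s * \<omega>))) \<le> (LINT s|lborel. cmod (u s))"
    by (simp only: norm_mult norm_exp_i_times mult_1_right)
  have "1 \<le> sqrt (2 * pi)" using pi_ge_two by (auto intro: real_le_rsqrt)
  then have "1 / sqrt (2 * pi) * cmod (LINT s|lborel. u s * iexp (- (s * \<omega>))) \<le> 1 * (LINT s|lborel. cmod (u s))"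
    using * by (intro mult_mono) auto
  then show ?thesis unfolding fourier_integral_iexp norm_mult norm_of_real by simp
qed

text \<open>
  Fubini: up to \<open>1 / sqrt (2 * pi)\<close>, both sides are the double integral of
  \<open>u s * q \<omega> * exp (- \<i> s \<omega>)\<close>.
\<close>
lemma fourier_multiplication:
  assumes u: "integrable lborel u" and q: "integrable lborel q"
  shows "(LINT \<omega>|lborel. fourier_integral u \<omega> * q \<omega>)
       = (LINT s|lborel. u s * fourier_integral q s)"
proof -
  have [measurable]: "u \<in> borel_measurable borel" "q \<in> borel_measurable borel" using u q by auto
  have int: "integrable (lborel \<Otimes>\<^sub>M lborel) (\<lambda>(s, \<omega>). u s * iexp (- (s * \<omega>)) * q \<omega>)"
  proof (rule lborel_pair.Fubini_integrable)
    show "integrable lborel (\<lambda>s. LINT \<omega>|lborel. norm (case (s, \<omega>) of (s, \<omega>) \<Rightarrow> u s * iexp (- (s * \<omega>)) * q \<omega>))"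
      using u q by (simp add: norm_mult del: of_real_minus of_real_mult)
    show "AE s in lborel. integrable lborel (\<lambda>\<omega>. case (s, \<omega>) of (s, \<omega>) \<Rightarrow> u s * iexp (- (s * \<omega>)) * q \<omega>)"
    proof (rule AE_I2, simp only: prod.case)
      fix s :: real
      have "integrable lborel (\<lambda>\<omega>. u s * q \<omega>)" using q by simp
      then show "integrable lborel (\<lambda>\<omega>. u s * iexp (- (s * \<omega>)) * q \<omega>)"
        by (rule Bochner_Integration.integrable_bound) (auto simp: norm_mult simp del: of_real_minus of_real_mult)
    qed
  qed measurable
  have "(LINT \<omega>|lborel. fourier_integral u \<omega> * q \<omega>)
     = complex_of_real (1 / sqrt (2 * pi)) * (LINT \<omega>|lborel. LINT s|lborel. u s * iexp (- (s * \<omega>)) * q \<omega>)"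
    unfolding fourier_integral_iexp by (simp add: mult.assoc flip: integral_mult_left_zero integral_mult_right_zero)
  also have "\<dots> = complex_of_real (1 / sqrt (2 * pi)) * (LINT s|lborel. LINT \<omega>|lborel. u s * iexp (- (s * \<omega>)) * q \<omega>)"
    using lborel_pair.Fubini_integral[OF int] by simp
  also have "\<dots> = (LINT s|lborel. u s * fourier_integral q s)"
    unfolding fourier_integral_iexp by (simp add: mult_ac flip: integral_mult_left_zero integral_mult_right_zero)
  finally show ?thesis .
qed

lemma fourier_integral_modulated_gaussian:
  assumes "0 < \<epsilon>"
  shows "fourier_integral (\<lambda>\<omega>. iexp (t * \<omega>) * of_real (exp (- (\<epsilon> * \<omega>)\<^sup>2 / 2))) s
     = of_real (sqrt (2 * pi) * normal_density 0 \<epsilon> (t - s))"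
proof -
  have "(LINT \<omega>|lborel. iexp (t * \<omega>) * of_real (exp (- (\<epsilon> * \<omega>)\<^sup>2 / 2)) * iexp (- (\<omega> * s)))
      = (LINT \<omega>|lborel. iexp (\<omega> * (t - s)) * of_real (exp (- (\<epsilon> * \<omega>)\<^sup>2 / 2)))"
    by (rule Bochner_Integration.integral_cong) (auto simp: algebra_simps simp flip: exp_add)
  also have "\<dots> = of_real (2 * pi * normal_density 0 \<epsilon> (t - s))"
    by (rule gaussian_fourier[OF assms])
  finally show ?thesis
    unfolding fourier_integral_iexp
    by (simp add: field_simps flip: of_real_mult real_sqrt_mult)
qed

lemma modulated_gaussian_L2:
  assumes "0 < \<epsilon>"
  shows "integrable lborel (\<lambda>\<omega>. iexp (t * \<omega>) * of_real (exp (- (\<epsilon> * \<omega>)\<^sup>2 / 2)))" (is ?int)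
    and "(\<lambda>\<omega>. iexp (t * \<omega>) * of_real (exp (- (\<epsilon> * \<omega>)\<^sup>2 / 2))) \<in> L2_space"
proof -
  show ?int
    by (rule Bochner_Integration.integrable_bound[OF gaussian_weight_integrable[OF assms]])
       (auto simp: norm_mult)
  then show "(\<lambda>\<omega>. iexp (t * \<omega>) * of_real (exp (- (\<epsilon> * \<omega>)\<^sup>2 / 2))) \<in> L2_space"
    by (rule L2_bounded_integrable[where C=1]) (simp add: norm_mult)
qed

text \<open>
  The multiplication formula against a modulated Gaussian, whose transform is again a Gaussian:
  damping the inversion integral by a Gaussian replaces \<open>u\<close> by its Gaussian average around \<open>t\<close>.
\<close>
lemma gaussian_summability_L1:
  assumes u: "integrable lborel u" and "0 < \<epsilon>"
  shows "(LINT \<omega>|lborel. fourier_integral u \<omega> * (iexp (t * \<omega>) * of_real (exp (- (\<epsilon> * \<omega>)\<^sup>2 / 2))))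
     = of_real (sqrt (2 * pi)) * (LINT s|lborel. u s * of_real (normal_density 0 \<epsilon> (t - s)))"
  unfolding fourier_multiplication[OF u modulated_gaussian_L2(1)[OF assms(2)]]
    fourier_integral_modulated_gaussian[OF assms(2)]
  by (simp add: mult_ac flip: integral_mult_left_zero integral_mult_right_zero)

lemma gaussian_summability_L2:
  assumes fg: "has_L2_fourier f g" and "0 < \<epsilon>"
  shows "(LINT \<omega>|lborel. g \<omega> * (iexp (t * \<omega>) * of_real (exp (- (\<epsilon> * \<omega>)\<^sup>2 / 2))))
     = of_real (sqrt (2 * pi)) * (LINT s|lborel. f s * of_real (normal_density 0 \<epsilon> (t - s)))"
proof -
  obtain u where u: "\<And>n. u n \<in> L1_space \<inter> L2_space" "\<And>n. fourier_integral (u n) \<in> L2_space"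
    and lim: "(\<lambda>n. L2_norm (\<lambda>t. u n t - f t)) \<longlonglongrightarrow> 0"
      "(\<lambda>n. L2_norm (\<lambda>\<omega>. fourier_integral (u n) \<omega> - g \<omega>)) \<longlonglongrightarrow> 0"
    and f: "f \<in> L2_space" and g: "g \<in> L2_space"
    using fg unfolding has_L2_fourier_def by blast
  have "(\<lambda>n. LINT \<omega>|lborel. fourier_integral (u n) \<omega> * (iexp (t * \<omega>) * of_real (exp (- (\<epsilon> * \<omega>)\<^sup>2 / 2))))
      \<longlonglongrightarrow> (LINT \<omega>|lborel. g \<omega> * (iexp (t * \<omega>) * of_real (exp (- (\<epsilon> * \<omega>)\<^sup>2 / 2))))"
    by (rule L2_functional_tendsto[OF u(2) g modulated_gaussian_L2(2)[OF assms(2)] lim(2)])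
  moreover have "(\<lambda>n. LINT s|lborel. u n s * of_real (normal_density 0 \<epsilon> (t - s)))
      \<longlonglongrightarrow> (LINT s|lborel. f s * of_real (normal_density 0 \<epsilon> (t - s)))"
    using u(1) by (intro L2_functional_tendsto[OF _ f normal_density_L2[OF assms(2)] lim(1)]) auto
  then have "(\<lambda>n. of_real (sqrt (2 * pi)) * (LINT s|lborel. u n s * of_real (normal_density 0 \<epsilon> (t - s))))
      \<longlonglongrightarrow> of_real (sqrt (2 * pi)) * (LINT s|lborel. f s * of_real (normal_density 0 \<epsilon> (t - s)))"
    by (intro tendsto_mult_left)
  moreover have "(LINT \<omega>|lborel. fourier_integral (u n) \<omega> * (iexp (t * \<omega>) * of_real (exp (- (\<epsilon> * \<omega>)\<^sup>2 / 2))))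
     = of_real (sqrt (2 * pi)) * (LINT s|lborel. u n s * of_real (normal_density 0 \<epsilon> (t - s)))" for n
    using u(1)[of n] by (intro gaussian_summability_L1[OF _ assms(2)]) (auto simp: L1_space_def)
  ultimately show ?thesis
    by (simp only: LIMSEQ_unique)
qed

text \<open>
  As the variance shrinks, the Gaussian average around \<open>t\<close> tends to the value at \<open>t\<close>. No bound
  on \<open>f\<close> at infinity is available, only \<open>f \<in> L\<^sup>2\<close>. Instead, outside a fixed neighbourhood of \<open>t\<close> the
  narrow density is at most \<open>\<rho> n\<close> times the standard normal density, with \<open>\<rho> n\<close> tending to zero.
\<close>
lemma gaussian_approximate_identity:
  assumes f: "f \<in> L2_space" and cont: "isCont f t"
  shows "(\<lambda>n. LINT s|lborel. f s * of_real (normal_density 0 (1 / real (Suc n)) (t - s))) \<longlonglongrightarrow> f t"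
proof (rule LIMSEQ_I)
  fix r :: real assume r: "0 < r"
  define e where "e n = 1 / real (Suc n)" for n
  have e: "0 < e n" for n by (simp add: e_def)
  have [measurable]: "f \<in> borel_measurable borel" using f by (auto simp: L2_space_def)
  \<comment> \<open>On \<open>\<bar>s - t\<bar> < \<eta>\<close> continuity gives an error below \<open>r / 2\<close>; the rest is controlled by \<open>\<rho> n * C\<close>.\<close>
  obtain \<eta> where \<eta>: "0 < \<eta>" "\<And>s. \<bar>s - t\<bar> < \<eta> \<Longrightarrow> cmod (f s - f t) < r / 2"
    using cont r unfolding continuous_at_eps_delta by (metis dist_norm half_gt_zero_iff dist_real_def)
  have int: "integrable lborel (\<lambda>s. (f s - f t) * of_real (normal_density 0 a (t - s)))" if "0 < a" for a
  proof -
    have "integrable lborel (\<lambda>s. f t * complex_of_real (normal_density 0 a (t - s)))"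
      unfolding normal_density_swap using integrable_normal_density[OF that] by (intro integrable_mult_right integrable_of_real)
    then show ?thesis
      using L2_product_integrable[OF f normal_density_L2[OF that]] by (simp add: left_diff_distrib)
  qed
  have one: "(LINT s|lborel. normal_density 0 a (t - s)) = 1" if "0 < a" for a
    unfolding normal_density_swap using that by simp
  define C where "C = (LINT s|lborel. cmod (f s - f t) * normal_density 0 1 (t - s))"
  define \<rho> where "\<rho> n = real (Suc n) * exp (- (\<eta>\<^sup>2 / 2) * ((real (Suc n))\<^sup>2 - 1))" for n
  have "\<rho> \<longlonglongrightarrow> 0" unfolding \<rho>_def using \<eta>(1) by real_asymp
  then have "(\<lambda>n. \<rho> n * C) \<longlonglongrightarrow> 0" using tendsto_mult_right[of \<rho> 0 sequentially C] by simp
  then obtain N where N: "\<And>n. n \<ge> N \<Longrightarrow> norm (\<rho> n * C) < r / 2"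
    using r LIMSEQ_D[of _ 0 "r/2"] by (metis diff_zero half_gt_zero_iff)
  have far: "normal_density 0 (e n) x \<le> \<rho> n * normal_density 0 1 x" if "\<eta> \<le> \<bar>x\<bar>" for n x
  proof -
    have "\<eta>\<^sup>2 \<le> x\<^sup>2" using that \<eta>(1) by (metis abs_ge_zero abs_le_square_iff abs_of_pos)
    moreover have "1 \<le> (real (Suc n))\<^sup>2" by simp
    ultimately have "\<eta>\<^sup>2 * ((real (Suc n))\<^sup>2 - 1) \<le> x\<^sup>2 * ((real (Suc n))\<^sup>2 - 1)"
      by (intro mult_right_mono) auto
    then have "- (x\<^sup>2 * (real (Suc n))\<^sup>2 / 2) \<le> - (\<eta>\<^sup>2 / 2) * ((real (Suc n))\<^sup>2 - 1) + - x\<^sup>2 / 2"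
      by (simp add: algebra_simps)
    then have "exp (- (x\<^sup>2 * (real (Suc n))\<^sup>2 / 2)) \<le> exp (- (\<eta>\<^sup>2 / 2) * ((real (Suc n))\<^sup>2 - 1)) * exp (- x\<^sup>2 / 2)"
      unfolding exp_add[symmetric] by simp
    then have "real (Suc n) / sqrt (2 * pi) * exp (- (x\<^sup>2 * (real (Suc n))\<^sup>2 / 2))
        \<le> real (Suc n) / sqrt (2 * pi) * (exp (- (\<eta>\<^sup>2 / 2) * ((real (Suc n))\<^sup>2 - 1)) * exp (- x\<^sup>2 / 2))"
      by (intro mult_left_mono) auto
    moreover have "normal_density 0 (e n) x = real (Suc n) / sqrt (2 * pi) * exp (- (x\<^sup>2 * (real (Suc n))\<^sup>2 / 2))"
      unfolding normal_density_def e_def by (simp add: real_sqrt_mult real_sqrt_divide power_divide del: of_nat_Suc)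
    ultimately show ?thesis
      by (simp add: \<rho>_def normal_density_def mult_ac del: of_nat_Suc)
  qed
  show "\<exists>no. \<forall>n\<ge>no. norm ((LINT s|lborel. f s * of_real (normal_density 0 (1 / real (Suc n)) (t - s))) - f t) < r"
  proof (intro exI allI impI)
    fix n assume n: "N \<le> n"
    have "(LINT s|lborel. f t * complex_of_real (normal_density 0 (e n) (t - s))) = f t"
      using one[OF e, of n] by simp
    then have "(LINT s|lborel. f s * of_real (normal_density 0 (e n) (t - s))) - f t
       = (LINT s|lborel. f s * of_real (normal_density 0 (e n) (t - s)))
         - (LINT s|lborel. f t * of_real (normal_density 0 (e n) (t - s)))" by simp
    also have "\<dots> = (LINT s|lborel. (f s - f t) * of_real (normal_density 0 (e n) (t - s)))"
      unfolding left_diff_distrib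
      using L2_product_integrable[OF f normal_density_L2[OF e]]
        integrable_normal_density[OF e] 
      by (subst Bochner_Integration.integral_diff) (auto simp: normal_density_swap intro!: integrable_of_real)
    finally have eq: "(LINT s|lborel. f s * of_real (normal_density 0 (e n) (t - s))) - f t
       = (LINT s|lborel. (f s - f t) * of_real (normal_density 0 (e n) (t - s)))" .
    have "norm (LINT s|lborel. (f s - f t) * of_real (normal_density 0 (e n) (t - s)))
       \<le> (LINT s|lborel. norm ((f s - f t) * of_real (normal_density 0 (e n) (t - s))))"
      by (rule integral_norm_bound)
    also have "\<dots> \<le> (LINT s|lborel. r / 2 * normal_density 0 (e n) (t - s)
         + \<rho> n * (cmod (f s - f t) * normal_density 0 1 (t - s)))"
    proof (rule integral_mono)
      show "integrable lborel (\<lambda>s. norm ((f s - f t) * of_real (normal_density 0 (e n) (t - s))))"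
        by (rule integrable_norm[OF int[OF e]])
      show "integrable lborel (\<lambda>s. r / 2 * normal_density 0 (e n) (t - s)
         + \<rho> n * (cmod (f s - f t) * normal_density 0 1 (t - s)))"
        using integrable_norm[OF int[OF zero_less_one]] e[of n] integrable_normal_density[of "e n" t]
        by (intro Bochner_Integration.integrable_add integrable_mult_right)
           (auto simp: norm_mult normal_density_swap)
      fix s
      show "norm ((f s - f t) * of_real (normal_density 0 (e n) (t - s)))
         \<le> r / 2 * normal_density 0 (e n) (t - s) + \<rho> n * (cmod (f s - f t) * normal_density 0 1 (t - s))"
      proof (cases "\<bar>s - t\<bar> < \<eta>")
        case True
        have "0 \<le> \<rho> n" by (simp add: \<rho>_def)
        then have "0 \<le> \<rho> n * (cmod (f s - f t) * normal_density 0 1 (t - s))" by simp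
        moreover have "cmod (f s - f t) * normal_density 0 (e n) (t - s) \<le> r / 2 * normal_density 0 (e n) (t - s)"
          using \<eta>(2)[OF True] by (intro mult_right_mono) auto
        ultimately show ?thesis by (simp add: norm_mult)
      next
        case False
        then have "cmod (f s - f t) * normal_density 0 (e n) (t - s)
            \<le> cmod (f s - f t) * (\<rho> n * normal_density 0 1 (t - s))"
          by (intro mult_left_mono far) auto
        moreover have "0 \<le> r / 2 * normal_density 0 (e n) (t - s)" using r by simp
        ultimately show ?thesis by (simp add: norm_mult mult_ac)
      qed
    qed
    also have "\<dots> = r / 2 + \<rho> n * C"
      using integrable_norm[OF int[OF zero_less_one]] e[of n] integrable_normal_density[of "e n" t] one[OF e, of n]
      unfolding C_def
      by (subst Bochner_Integration.integral_add)
         (auto simp: norm_mult normal_density_swap)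
    also have "\<dots> < r" using N[OF n] by auto
    finally show "norm ((LINT s|lborel. f s * of_real (normal_density 0 (1 / real (Suc n)) (t - s))) - f t) < r"
      using eq by (simp add: e_def)
  qed
qed

section \<open>The norm bound and the inversion formula\<close>

text \<open>
  By the multiplication formula the weighted integral equals the pairing of \<open>u\<close> with its own
  Gaussian average, and averaging does not increase the \<open>L\<^sup>2\<close> pairing.
\<close>
lemma gaussian_weighted_plancherel_le:
  assumes u1: "u \<in> L1_space" and u2: "u \<in> L2_space" and "0 < \<epsilon>"
  shows "(LINT \<omega>|lborel. (cmod (fourier_integral u \<omega>))\<^sup>2 * exp (- (\<epsilon> * \<omega>)\<^sup>2 / 2)) \<le> (L2_norm u)\<^sup>2"
proof -
  have u: "integrable lborel u" and usq: "integrable lborel (\<lambda>t. (cmod (u t))\<^sup>2)"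
    using u1 u2 by (auto simp: L1_space_def L2_space_def)
  then have [measurable]: "u \<in> borel_measurable borel" by auto
  define q where "q \<omega> = cnj (fourier_integral u \<omega>) * of_real (exp (- (\<epsilon> * \<omega>)\<^sup>2 / 2))" for \<omega>
  define v where "v s = (LINT x|lborel. u x * of_real (normal_density 0 \<epsilon> (s - x)))" for s
  have [measurable]: "v \<in> borel_measurable borel" unfolding v_def[abs_def] by measurable
  have q: "integrable lborel q"
  proof (rule Bochner_Integration.integrable_bound)
    show "integrable lborel (\<lambda>\<omega>. (LINT s|lborel. cmod (u s)) * exp (- (\<epsilon> * \<omega>)\<^sup>2 / 2))"
      using gaussian_weight_integrable[OF assms(3)] by (rule integrable_mult_right)
    show "q \<in> borel_measurable lborel" unfolding q_def[abs_def] by measurable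
    show "AE \<omega> in lborel. norm (q \<omega>) \<le> norm ((LINT s|lborel. cmod (u s)) * exp (- (\<epsilon> * \<omega>)\<^sup>2 / 2))"
      using fourier_integral_bound[OF u]
      by (intro AE_I2) (auto simp: q_def norm_mult intro!: mult_right_mono order_trans[OF fourier_integral_bound[OF u]])
  qed
  have qhat: "fourier_integral q s = cnj (v s)" for s
  proof -
    have "(LINT \<omega>|lborel. q \<omega> * iexp (- (\<omega> * s)))
       = (LINT \<omega>|lborel. cnj (fourier_integral u \<omega> * (iexp (s * \<omega>) * of_real (exp (- (\<epsilon> * \<omega>)\<^sup>2 / 2)))))"
      by (intro Bochner_Integration.integral_cong) (auto simp: q_def mult_ac exp_cnj)
    also have "\<dots> = cnj (of_real (sqrt (2 * pi)) * v s)"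
      unfolding Bochner_Integration.integral_cnj v_def gaussian_summability_L1[OF u assms(3)] ..
    finally show ?thesis
      unfolding fourier_integral_iexp by (simp del: of_real_minus of_real_mult)
  qed
  have vle: "ennreal (cmod (v s)) \<le> (\<integral>\<^sup>+ x. ennreal (cmod (u x) * normal_density 0 \<epsilon> (s - x)) \<partial>lborel)" for s
  proof -
    have "integrable lborel (\<lambda>x. u x * of_real (normal_density 0 \<epsilon> (s - x)))"
      by (rule L2_product_integrable[OF u2 normal_density_L2[OF assms(3)]])
    from integral_norm_bound_ennreal[OF this] show ?thesis
      by (simp add: v_def norm_mult)
  qed
  have int: "integrable lborel (\<lambda>s. u s * cnj (v s))"
  proof (rule Bochner_Integration.integrable_bound)
    show "integrable lborel (\<lambda>s. u s * of_real (1 / sqrt (2 * pi * \<epsilon>\<^sup>2) * (LINT x|lborel. cmod (u x))))"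
      using u by simp
    show "AE s in lborel. norm (u s * cnj (v s))
      \<le> norm (u s * of_real (1 / sqrt (2 * pi * \<epsilon>\<^sup>2) * (LINT x|lborel. cmod (u x))))"
    proof (rule AE_I2)
      fix s
      have "cmod (v s) \<le> (LINT x|lborel. cmod (u x * of_real (normal_density 0 \<epsilon> (s - x))))"
        unfolding v_def by (rule integral_norm_bound)
      also have "\<dots> \<le> (LINT x|lborel. 1 / sqrt (2 * pi * \<epsilon>\<^sup>2) * cmod (u x))"
      proof (rule integral_mono)
        show "integrable lborel (\<lambda>x. cmod (u x * of_real (normal_density 0 \<epsilon> (s - x))))"
          by (rule integrable_norm[OF L2_product_integrable[OF u2 normal_density_L2[OF assms(3)]]])
        show "integrable lborel (\<lambda>x. 1 / sqrt (2 * pi * \<epsilon>\<^sup>2) * cmod (u x))"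
          using u by (intro integrable_mult_right integrable_norm)
        show "cmod (u x * of_real (normal_density 0 \<epsilon> (s - x))) \<le> 1 / sqrt (2 * pi * \<epsilon>\<^sup>2) * cmod (u x)" for x
          using mult_right_mono[OF normal_density_bound[OF assms(3), of 0 "s - x"], of "cmod (u x)"]
          by (simp add: norm_mult mult.commute)
      qed
      finally have "cmod (v s) \<le> 1 / sqrt (2 * pi * \<epsilon>\<^sup>2) * (LINT x|lborel. cmod (u x))" by simp
      then show "norm (u s * cnj (v s))
        \<le> norm (u s * of_real (1 / sqrt (2 * pi * \<epsilon>\<^sup>2) * (LINT x|lborel. cmod (u x))))"
        unfolding norm_mult complex_mod_cnj norm_of_real by (intro mult_left_mono) auto
    qed
  qed measurable
  have nd: "(\<integral>\<^sup>+ x. ennreal (normal_density 0 \<epsilon> (s - x)) \<partial>lborel) = 1" for s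
    unfolding normal_density_swap using assms(3) by (subst nn_integral_eq_integral) auto
  have nd': "(\<integral>\<^sup>+ s. ennreal (normal_density 0 \<epsilon> (s - x)) \<partial>lborel) = 1" for x
    using nd[of x] by (simp add: normal_density_def power2_commute)
  have half: "(\<integral>\<^sup>+ s. ennreal ((cmod (u s))\<^sup>2 / 2) \<partial>lborel) = ennreal ((L2_norm u)\<^sup>2 / 2)"
    using usq by (subst nn_integral_eq_integral) (auto simp: L2_norm_square)
  have "(LINT \<omega>|lborel. (cmod (fourier_integral u \<omega>))\<^sup>2 * exp (- (\<epsilon> * \<omega>)\<^sup>2 / 2))
      = Re (LINT \<omega>|lborel. fourier_integral u \<omega> * q \<omega>)"
  proof -
    have "fourier_integral u \<omega> * q \<omega> = of_real ((cmod (fourier_integral u \<omega>))\<^sup>2 * exp (- (\<epsilon> * \<omega>)\<^sup>2 / 2))" for \<omega>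
      unfolding q_def mult.assoc[symmetric] complex_norm_square[symmetric] by simp
    then show ?thesis by (simp only: integral_complex_of_real Re_complex_of_real)
  qed
  also have "\<dots> = Re (LINT s|lborel. u s * cnj (v s))"
    unfolding fourier_multiplication[OF u q] qhat ..
  also have "\<dots> \<le> cmod (LINT s|lborel. u s * cnj (v s))" by (rule complex_Re_le_cmod)
  finally have le1: "(LINT \<omega>|lborel. (cmod (fourier_integral u \<omega>))\<^sup>2 * exp (- (\<epsilon> * \<omega>)\<^sup>2 / 2))
      \<le> cmod (LINT s|lborel. u s * cnj (v s))" .
  \<comment> \<open>Schur's test: the Gaussian kernel has mass one in either variable.\<close>
  have "ennreal (cmod (LINT s|lborel. u s * cnj (v s))) \<le> (\<integral>\<^sup>+ s. ennreal (cmod (u s)) * ennreal (cmod (v s)) \<partial>lborel)"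
    using integral_norm_bound_ennreal[OF int] by (simp add: norm_mult ennreal_mult)
  also have "\<dots> \<le> (\<integral>\<^sup>+ s. ennreal (cmod (u s)) * (\<integral>\<^sup>+ x. ennreal (cmod (u x) * normal_density 0 \<epsilon> (s - x)) \<partial>lborel) \<partial>lborel)"
    by (intro nn_integral_mono mult_left_mono vle) simp
  also have "\<dots> = (\<integral>\<^sup>+ s. \<integral>\<^sup>+ x. ennreal (cmod (u s)) * ennreal (cmod (u x) * normal_density 0 \<epsilon> (s - x)) \<partial>lborel \<partial>lborel)"
    by (subst nn_integral_cmult) auto
  also have "\<dots> \<le> (\<integral>\<^sup>+ s. \<integral>\<^sup>+ x. ennreal ((cmod (u s))\<^sup>2 / 2) * ennreal (normal_density 0 \<epsilon> (s - x))
        + ennreal ((cmod (u x))\<^sup>2 / 2) * ennreal (normal_density 0 \<epsilon> (s - x)) \<partial>lborel \<partial>lborel)"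
  proof (intro nn_integral_mono)
    fix s x
    have "cmod (u s) * cmod (u x) \<le> (cmod (u s))\<^sup>2 / 2 + (cmod (u x))\<^sup>2 / 2"
      using sum_squares_bound[of "cmod (u s)" "cmod (u x)"] by simp
    then have "cmod (u s) * cmod (u x) * normal_density 0 \<epsilon> (s - x)
       \<le> ((cmod (u s))\<^sup>2 / 2 + (cmod (u x))\<^sup>2 / 2) * normal_density 0 \<epsilon> (s - x)"
      by (intro mult_right_mono) auto
    then show "ennreal (cmod (u s)) * ennreal (cmod (u x) * normal_density 0 \<epsilon> (s - x))
       \<le> ennreal ((cmod (u s))\<^sup>2 / 2) * ennreal (normal_density 0 \<epsilon> (s - x))
        + ennreal ((cmod (u x))\<^sup>2 / 2) * ennreal (normal_density 0 \<epsilon> (s - x))"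
      by (simp add: ennreal_mult[symmetric] ennreal_plus[symmetric] ennreal_leI algebra_simps del: ennreal_plus)
  qed
  also have "\<dots> = (\<integral>\<^sup>+ s. \<integral>\<^sup>+ x. ennreal ((cmod (u s))\<^sup>2 / 2) * ennreal (normal_density 0 \<epsilon> (s - x)) \<partial>lborel \<partial>lborel)
     + (\<integral>\<^sup>+ s. \<integral>\<^sup>+ x. ennreal ((cmod (u x))\<^sup>2 / 2) * ennreal (normal_density 0 \<epsilon> (s - x)) \<partial>lborel \<partial>lborel)"
    by (subst nn_integral_add[symmetric]) (auto simp: nn_integral_add)
  also have "(\<integral>\<^sup>+ s. \<integral>\<^sup>+ x. ennreal ((cmod (u s))\<^sup>2 / 2) * ennreal (normal_density 0 \<epsilon> (s - x)) \<partial>lborel \<partial>lborel)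
     = ennreal ((L2_norm u)\<^sup>2 / 2)"
    by (simp add: nn_integral_cmult nd half)
  also have "(\<integral>\<^sup>+ s. \<integral>\<^sup>+ x. ennreal ((cmod (u x))\<^sup>2 / 2) * ennreal (normal_density 0 \<epsilon> (s - x)) \<partial>lborel \<partial>lborel)
     = (\<integral>\<^sup>+ x. \<integral>\<^sup>+ s. ennreal ((cmod (u x))\<^sup>2 / 2) * ennreal (normal_density 0 \<epsilon> (s - x)) \<partial>lborel \<partial>lborel)"
    by (rule lborel_pair.Fubini') measurable
  also have "\<dots> = ennreal ((L2_norm u)\<^sup>2 / 2)"
    by (simp add: nn_integral_cmult nd' half)
  also have "ennreal ((L2_norm u)\<^sup>2 / 2) + ennreal ((L2_norm u)\<^sup>2 / 2) = ennreal ((L2_norm u)\<^sup>2)"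
    by (simp add: ennreal_plus[symmetric] del: ennreal_plus)
  finally have "cmod (LINT s|lborel. u s * cnj (v s)) \<le> (L2_norm u)\<^sup>2" by simp
  with le1 show ?thesis by simp
qed

lemma gaussian_weight_tendsto:
  "(\<lambda>n. exp (- (1 / real (Suc n) * \<omega>)\<^sup>2 / 2)) \<longlonglongrightarrow> 1"
proof -
  have "(\<lambda>n. 1 / real (Suc n)) \<longlonglongrightarrow> 0"
    using LIMSEQ_inverse_real_of_nat by (simp add: inverse_eq_divide)
  then have "(\<lambda>n. exp (- (1 / real (Suc n) * \<omega>)\<^sup>2 / 2)) \<longlonglongrightarrow> exp (- (0 * \<omega>)\<^sup>2 / 2)"
    by (intro tendsto_intros) auto
  then show ?thesis by simp
qed

text \<open>
  Since the transform is assumed to be in \<open>L\<^sup>2\<close>, the Gaussian weight can be removed by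
  dominated convergence.
\<close>
lemma plancherel_le:
  assumes u1: "u \<in> L1_space" and u2: "u \<in> L2_space" and uh: "fourier_integral u \<in> L2_space"
  shows "L2_norm (fourier_integral u) \<le> L2_norm u"
proof -
  have uh': "integrable lborel (\<lambda>\<omega>. (cmod (fourier_integral u \<omega>))\<^sup>2)" 
    and [measurable]: "fourier_integral u \<in> borel_measurable borel" using uh by (auto simp: L2_space_def)
  have "(\<lambda>n. LINT \<omega>|lborel. (cmod (fourier_integral u \<omega>))\<^sup>2 * exp (- (1 / real (Suc n) * \<omega>)\<^sup>2 / 2))
     \<longlonglongrightarrow> (LINT \<omega>|lborel. (cmod (fourier_integral u \<omega>))\<^sup>2)"
  proof (rule integral_dominated_convergence[OF _ _ uh'])
    show "AE \<omega> in lborel. (\<lambda>n. (cmod (fourier_integral u \<omega>))\<^sup>2 * exp (- (1 / real (Suc n) * \<omega>)\<^sup>2 / 2))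
        \<longlonglongrightarrow> (cmod (fourier_integral u \<omega>))\<^sup>2"
      using tendsto_mult_left[OF gaussian_weight_tendsto] by (intro AE_I2) fastforce
    show "AE \<omega> in lborel. norm ((cmod (fourier_integral u \<omega>))\<^sup>2 * exp (- (1 / real (Suc n) * \<omega>)\<^sup>2 / 2))
        \<le> (cmod (fourier_integral u \<omega>))\<^sup>2" for n
      by (intro AE_I2) (auto simp: mult_left_le)
  qed measurable
  then have "(LINT \<omega>|lborel. (cmod (fourier_integral u \<omega>))\<^sup>2) \<le> (L2_norm u)\<^sup>2"
    by (rule LIMSEQ_le_const2) (intro exI allI impI gaussian_weighted_plancherel_le[OF u1 u2], simp)
  then have "(L2_norm (fourier_integral u))\<^sup>2 \<le> (L2_norm u)\<^sup>2"
    by (simp add: L2_norm_square)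
  then show ?thesis by (rule power2_le_imp_le) simp
qed

lemma L2_fourier_norm_le:
  assumes fg: "has_L2_fourier f g"
  shows "L2_norm g \<le> L2_norm f"
proof -
  obtain u where u: "\<And>n. u n \<in> L1_space \<inter> L2_space" "\<And>n. fourier_integral (u n) \<in> L2_space"
    and lim: "(\<lambda>n. L2_norm (\<lambda>t. u n t - f t)) \<longlonglongrightarrow> 0"
      "(\<lambda>n. L2_norm (\<lambda>\<omega>. fourier_integral (u n) \<omega> - g \<omega>)) \<longlonglongrightarrow> 0"
    and f: "f \<in> L2_space" and g: "g \<in> L2_space"
    using fg unfolding has_L2_fourier_def by blast
  have "L2_norm g \<le> L2_norm f + L2_norm (\<lambda>t. u n t - f t) + L2_norm (\<lambda>\<omega>. fourier_integral (u n) \<omega> - g \<omega>)" for n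
    using L2_norm_le_norm_add_dist[OF g u(2)[of n]] plancherel_le[of "u n"] u[of n]
      L2_norm_le_norm_add_dist[of "u n" f] f
    by (auto simp: L2_norm_diff_swap[of g])
  moreover have "(\<lambda>n. L2_norm f + L2_norm (\<lambda>t. u n t - f t) + L2_norm (\<lambda>\<omega>. fourier_integral (u n) \<omega> - g \<omega>))
      \<longlonglongrightarrow> L2_norm f + 0 + 0"
    by (intro tendsto_add tendsto_const lim)
  ultimately show ?thesis
    using LIMSEQ_le_const[of _ "L2_norm f + 0 + 0" "L2_norm g"] by auto
qed

text \<open>
  Both sides of \<open>gaussian_summability_L2\<close> converge when the Gaussian is removed: one to the value
  of \<open>f\<close> by continuity, the other to the inversion integral by integrability of \<open>g\<close>. No exceptional
  null set remains.
\<close>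
theorem L2_fourier_inversion:
  assumes fg: "has_L2_fourier f g" and g: "integrable lborel g" and cont: "isCont f t"
  shows "f t = complex_of_real (1 / sqrt (2 * pi)) * (LINT \<omega>|lborel. g \<omega> * iexp (t * \<omega>))"
proof -
  have [measurable]: "g \<in> borel_measurable borel" using g by auto
  have f: "f \<in> L2_space" using fg by (simp add: has_L2_fourier_def)
  have "(\<lambda>n. LINT \<omega>|lborel. g \<omega> * (iexp (t * \<omega>) * of_real (exp (- (1 / real (Suc n) * \<omega>)\<^sup>2 / 2))))
     \<longlonglongrightarrow> (LINT \<omega>|lborel. g \<omega> * iexp (t * \<omega>))"
  proof (rule integral_dominated_convergence[OF _ _ integrable_norm[OF g]])
    show "AE \<omega> in lborel. (\<lambda>n. g \<omega> * (iexp (t * \<omega>) * of_real (exp (- (1 / real (Suc n) * \<omega>)\<^sup>2 / 2))))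
        \<longlonglongrightarrow> g \<omega> * iexp (t * \<omega>)"
    proof (rule AE_I2)
      fix \<omega>
      have "(\<lambda>n. g \<omega> * (iexp (t * \<omega>) * of_real (exp (- (1 / real (Suc n) * \<omega>)\<^sup>2 / 2))))
        \<longlonglongrightarrow> g \<omega> * (iexp (t * \<omega>) * of_real 1)"
        by (intro tendsto_intros tendsto_of_real gaussian_weight_tendsto)
      then show "(\<lambda>n. g \<omega> * (iexp (t * \<omega>) * of_real (exp (- (1 / real (Suc n) * \<omega>)\<^sup>2 / 2))))
        \<longlonglongrightarrow> g \<omega> * iexp (t * \<omega>)" by simp
    qed
    show "AE \<omega> in lborel. norm (g \<omega> * (iexp (t * \<omega>) * of_real (exp (- (1 / real (Suc n) * \<omega>)\<^sup>2 / 2)))) \<le> norm (g \<omega>)" for n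
      unfolding norm_mult norm_exp_i_times by (intro AE_I2) (auto simp: mult_left_le)
  qed measurable
  moreover have "(\<lambda>n. LINT \<omega>|lborel. g \<omega> * (iexp (t * \<omega>) * of_real (exp (- (1 / real (Suc n) * \<omega>)\<^sup>2 / 2))))
     = (\<lambda>n. of_real (sqrt (2 * pi)) * (LINT s|lborel. f s * of_real (normal_density 0 (1 / real (Suc n)) (t - s))))"
    by (rule ext) (rule gaussian_summability_L2[OF fg], simp)
  moreover have "(\<lambda>n. of_real (sqrt (2 * pi)) * (LINT s|lborel. f s * of_real (normal_density 0 (1 / real (Suc n)) (t - s))))
      \<longlonglongrightarrow> of_real (sqrt (2 * pi)) * f t"
    by (intro tendsto_mult_left gaussian_approximate_identity f cont)
  ultimately have "of_real (sqrt (2 * pi)) * f t = (LINT \<omega>|lborel. g \<omega> * iexp (t * \<omega>))"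
    by (simp only: LIMSEQ_unique)
  then have "(LINT \<omega>|lborel. g \<omega> * iexp (t * \<omega>)) = of_real (sqrt (2 * pi)) * f t" ..
  then show ?thesis by (simp only:) simp
qed

section \<open>The Bessel function and an entire form of sinh s / s\<close>

text \<open>
  The entire function with \<open>shc (s\<^sup>2) = sinh s / s\<close> and \<open>shc (- s\<^sup>2) = sin s / s\<close>. It expresses the
  transformed window by a single formula on both sides of the frequency where the square root
  in its argument changes from real to imaginary.
\<close>
definition shc :: "real \<Rightarrow> real" where
  "shc z = (\<Sum>n. z ^ n / fact (2 * n + 1))"

lemma fact_le_fact_double: "(fact n :: real) \<le> fact (2 * n)"
  by (rule fact_mono) simp

lemma summable_shc: "summable (\<lambda>n. 1 / fact (2 * n + 1) * (z::real) ^ n)"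
proof (rule summable_comparison_test'[OF summable_exp[of "\<bar>z\<bar>"], of 0])
  fix n :: nat
  have "(fact n :: real) \<le> fact (2 * n + 1)" by (rule fact_mono) simp
  then have "\<bar>z\<bar> ^ n / fact (2 * n + 1) \<le> \<bar>z\<bar> ^ n / fact n"
    by (intro divide_left_mono) auto
  then show "norm (1 / fact (2 * n + 1) * z ^ n) \<le> inverse (fact n) * \<bar>z\<bar> ^ n"
    by (simp add: power_abs inverse_eq_divide)
qed

lemma isCont_shc: "isCont shc z"
proof -
  have "shc = (\<lambda>z. \<Sum>n. 1 / fact (2 * n + 1) * z ^ n)" by (simp add: shc_def fun_eq_iff)
  then show ?thesis using isCont_powser_converges_everywhere[OF summable_shc, of z] by simp
qed

lemma continuous_on_shc [continuous_intros]:
  "continuous_on S f \<Longrightarrow> continuous_on S (\<lambda>x. shc (f x))"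
  using continuous_on_compose2[of UNIV shc S f] isCont_shc by (simp add: continuous_at_imp_continuous_on)

lemma shc_zero [simp]: "shc 0 = 1"
  using powser_zero[of "\<lambda>n. 1 / fact (2 * n + 1) :: real"] by (simp add: shc_def)

lemma shc_neg_square:
  assumes "s \<noteq> 0"
  shows "shc (- s\<^sup>2) = sin s / s"
proof -
  have "(\<lambda>n. (- 1) ^ n / fact (2 * n + 1) * s ^ (2 * n + 1) / s) sums (sin s / s)"
    by (rule sums_divide[OF sin_paired])
  moreover have "(- 1) ^ n / fact (2 * n + 1) * s ^ (2 * n + 1) / s = (- s\<^sup>2) ^ n / fact (2 * n + 1)" for n
  proof -
    have "(- s\<^sup>2) ^ n = (- 1) ^ n * s ^ (2 * n)"
      by (metis mult_minus1 power_mult power_mult_distrib)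
    then show ?thesis using assms by simp
  qed
  ultimately show ?thesis by (simp add: shc_def sums_iff)
qed

lemma shc_square:
  assumes "s \<noteq> 0"
  shows "shc (s\<^sup>2) = sinh s / s"
proof -
  have "(\<lambda>n. if even n then 0 else s ^ n /\<^sub>R fact n) sums sinh s" by (rule sinh_converges)
  then have "(\<lambda>n. s ^ (2 * n + 1) /\<^sub>R fact (2 * n + 1)) sums sinh s"
    by (subst (asm) sums_mono_reindex[of "\<lambda>n. 2 * n + 1", symmetric])
       (auto simp: strict_mono_def elim!: oddE)
  then have "(\<lambda>n. s ^ (2 * n + 1) /\<^sub>R fact (2 * n + 1) / s) sums (sinh s / s)" by (rule sums_divide)
  moreover have "s ^ (2 * n + 1) /\<^sub>R fact (2 * n + 1) / s = (s\<^sup>2) ^ n / fact (2 * n + 1)" for n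
    using assms by (simp add: power_mult inverse_eq_divide)
  ultimately show ?thesis by (simp add: shc_def sums_iff)
qed

lemma summable_bessel_I0: "summable (\<lambda>k. 1 / (4 ^ k * (fact k)\<^sup>2) * (z::real) ^ k)"
proof (rule summable_comparison_test'[OF summable_exp[of "\<bar>z\<bar>"], of 0])
  fix k :: nat
  have "1 * (1 * fact k) \<le> 4 ^ k * (fact k * (fact k :: real))"
    by (intro mult_mono) (auto simp: fact_ge_1)
  then have "\<bar>z\<bar> ^ k / (4 ^ k * (fact k)\<^sup>2) \<le> \<bar>z\<bar> ^ k / fact k"
    by (intro divide_left_mono) (auto simp: power2_eq_square)
  then show "norm (1 / (4 ^ k * (fact k)\<^sup>2) * z ^ k) \<le> inverse (fact k) * \<bar>z\<bar> ^ k"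
    by (simp add: power_abs inverse_eq_divide)
qed

lemma bessel_I0_powser: "bessel_I0 x = (\<Sum>k. 1 / (4 ^ k * (fact k)\<^sup>2) * (x\<^sup>2) ^ k)"
proof -
  have "(x / 2) ^ (2 * k) / (fact k)\<^sup>2 = 1 / (4 ^ k * (fact k)\<^sup>2) * (x\<^sup>2) ^ k" for k
    by (simp add: power_mult power_divide)
  then show ?thesis by (simp add: bessel_I0_def)
qed

lemma isCont_bessel_I0: "isCont bessel_I0 x"
proof -
  have "isCont (\<lambda>x. (\<lambda>z. \<Sum>k. 1 / (4 ^ k * (fact k)\<^sup>2) * z ^ k) (x\<^sup>2)) x"
    by (rule isCont_o2[OF _ isCont_powser_converges_everywhere[OF summable_bessel_I0]]) simp
  then show ?thesis by (simp add: bessel_I0_powser[abs_def])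
qed

lemma continuous_on_bessel_I0 [continuous_intros]:
  "continuous_on S f \<Longrightarrow> continuous_on S (\<lambda>x. bessel_I0 (f x))"
  using continuous_on_compose2[of UNIV bessel_I0 S f] isCont_bessel_I0
  by (simp add: continuous_at_imp_continuous_on)

lemma bessel_I0_zero [simp]: "bessel_I0 0 = 1"
  using powser_zero[of "\<lambda>k. 1 / (4 ^ k * (fact k)\<^sup>2) :: real"] by (simp add: bessel_I0_powser)

text \<open>
  Comparison of coefficients: \<open>4 ^ n * (fact n)\<^sup>2\<close> is at most \<open>fact (2 * n + 1)\<close>, that is,
  the central binomial coefficient is at least \<open>4 ^ n / (2 * n + 1)\<close>.
\<close>
lemma bessel_I0_ge_shc: "shc (x\<^sup>2) \<le> bessel_I0 x"
  unfolding shc_def bessel_I0_powser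
proof (rule suminf_le)
  show "summable (\<lambda>n. (x\<^sup>2) ^ n / fact (2 * n + 1))" using summable_shc[of "x\<^sup>2"] by simp
  show "summable (\<lambda>k. 1 / (4 ^ k * (fact k)\<^sup>2) * (x\<^sup>2) ^ k)" by (rule summable_bessel_I0)
  fix n
  have "4 ^ n * (fact n)\<^sup>2 \<le> (fact (2 * n + 1) :: real)"
  proof (induction n)
    case (Suc n)
    have "(4::real) ^ Suc n * (fact (Suc n))\<^sup>2 = (4 * (real n + 1)\<^sup>2) * (4 ^ n * (fact n)\<^sup>2)"
      by (simp add: power2_eq_square algebra_simps)
    also have "\<dots> \<le> ((2 * real n + 2) * (2 * real n + 3)) * fact (2 * n + 1)"
    proof (rule mult_mono[OF _ Suc.IH])
      show "4 * (real n + 1)\<^sup>2 \<le> (2 * real n + 2) * (2 * real n + 3)"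
        by (simp add: power2_eq_square algebra_simps)
    qed auto
    also have "\<dots> = fact (2 * Suc n + 1)" by (simp add: algebra_simps)
    finally show ?case .
  qed simp
  then show "(x\<^sup>2) ^ n / fact (2 * n + 1) \<le> 1 / (4 ^ n * (fact n)\<^sup>2) * (x\<^sup>2) ^ n"
    by (simp add: divide_left_mono)
qed

section \<open>The transform of the Bessel kernel\<close>

text \<open>
  The value at \<open>(j + 1/2, k + 1)\<close> of Euler's beta function.
\<close>
definition beta_moment :: "nat \<Rightarrow> nat \<Rightarrow> real" where
  "beta_moment k j = (LINT y|lborel. (1 - y\<^sup>2) ^ k * y ^ (2 * j) * indicator {-1..1} y)"

lemma integrable_on_interval:
  fixes f :: "real \<Rightarrow> 'a::{banach, second_countable_topology}"
  assumes "continuous_on {a..b} f"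
  shows "integrable lborel (\<lambda>x. indicator {a..b} x *\<^sub>R f x)"
  using borel_integrable_atLeastAtMost'[OF assms] by (simp add: set_integrable_def)

lemma integrable_on_interval':
  fixes f :: "real \<Rightarrow> real"
  assumes "continuous_on {a..b} f"
  shows "integrable lborel (\<lambda>x. f x * indicator {a..b} x)"
  using integrable_on_interval[OF assms] by (simp add: mult.commute)

lemma beta_moment_rec: "beta_moment (Suc k) j = beta_moment k j - beta_moment k (Suc j)"
proof -
  have "(1 - y\<^sup>2) ^ Suc k * y ^ (2 * j) * indicator {-1..1} y
     = (1 - y\<^sup>2) ^ k * y ^ (2 * j) * indicator {-1..1} y - (1 - y\<^sup>2) ^ k * y ^ (2 * Suc j) * indicator {-1..1} y" for y :: real
    by (simp add: algebra_simps power2_eq_square)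
  then show ?thesis
    unfolding beta_moment_def
    by (simp only:) (subst Bochner_Integration.integral_diff;
        auto intro!: integrable_on_interval' continuous_intros)
qed

lemma beta_moment_eq:
  "beta_moment k j = 2 * 4 ^ k * fact k * fact (2 * j) * fact (j + k) / (fact j * fact (2 * (j + k) + 1))"
proof (induction k arbitrary: j)
  case 0
  have "beta_moment 0 j = 2 / (2 * real j + 1)"
    unfolding beta_moment_def using integral_power[of "-1" 1 "2 * j"] by simp
  moreover have "fact (2 * (j + 0) + 1) = (2 * real j + 1) * fact (2 * j)" by simp
  ultimately show ?case by (simp del: fact_Suc)
next
  case (Suc k)
  define F where "F = 2 * 4 ^ k * fact k * fact (2 * j) * fact (j + k) / (fact j * fact (2 * (j + k) + 1) :: real)"
  have 1: "beta_moment k j = F" by (simp add: F_def Suc.IH)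
  have "beta_moment k (Suc j) = F * ((2 * real j + 2) * (2 * real j + 1) * (real j + real k + 1)
      / ((real j + 1) * ((2 * (real j + real k) + 2) * (2 * (real j + real k) + 3))))"
    unfolding Suc.IH F_def by (simp add: algebra_simps)
  also have "\<dots> = F * ((2 * ((real j + 1) * (real j + real k + 1)) * (2 * real j + 1))
      / (2 * ((real j + 1) * (real j + real k + 1)) * (2 * (real j + real k) + 3)))"
    by (simp add: algebra_simps)
  also have "\<dots> = F * ((2 * real j + 1) / (2 * (real j + real k) + 3))"
    by (subst nonzero_mult_divide_mult_cancel_left) auto
  finally have 2: "beta_moment k (Suc j) = F * ((2 * real j + 1) / (2 * (real j + real k) + 3))" .
  have "2 * 4 ^ Suc k * fact (Suc k) * fact (2 * j) * fact (j + Suc k) / (fact j * fact (2 * (j + Suc k) + 1))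
      = F * (4 * (real k + 1) * (real j + real k + 1) / ((2 * (real j + real k) + 2) * (2 * (real j + real k) + 3)))"
    unfolding F_def by (simp add: algebra_simps)
  also have "\<dots> = F * ((2 * (real j + real k + 1) * (2 * (real k + 1)))
      / (2 * (real j + real k + 1) * (2 * (real j + real k) + 3)))"
    by (simp add: algebra_simps)
  also have "\<dots> = F * (2 * (real k + 1) / (2 * (real j + real k) + 3))"
    by (subst nonzero_mult_divide_mult_cancel_left) auto
  also have "\<dots> = F - F * ((2 * real j + 1) / (2 * (real j + real k) + 3))"
    by (simp add: field_simps)
  finally show ?case
    unfolding beta_moment_rec 1 2 by simp
qed

text \<open>
  Multiply the power series of the Bessel function and of the cosine and collect the terms of
  total degree \<open>2 * n\<close>. After integration the beta moments turn the coefficients into binomial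
  ones, so that the \<open>n\<close>-th group is a multiple of \<open>(\<beta>\<^sup>2 - a\<^sup>2) ^ n\<close>.
\<close>
lemma kaiser_bessel_cosine_transform:
  "(LINT y|lborel. bessel_I0 (\<beta> * sqrt (1 - y\<^sup>2)) * cos (a * y) * indicator {-1..1} y) = 2 * shc (\<beta>\<^sup>2 - a\<^sup>2)"
proof -
  define b where "b i y = (\<beta> / 2) ^ (2 * i) / (fact i)\<^sup>2 * (1 - y\<^sup>2) ^ i" for i and y :: real
  define c where "c j y = (- 1) ^ j * (a * y) ^ (2 * j) / fact (2 * j)" for j and y :: real
  \<comment> \<open>Majorants on the unit interval; they justify both the Cauchy product and the termwise integration.\<close>
  define B where "B i = (\<beta> / 2) ^ (2 * i) / (fact i)\<^sup>2" for i
  define C where "C j = a ^ (2 * j) / fact (2 * j)" for j :: nat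
  define F where "F n y = (\<Sum>i\<le>n. b i y * c (n - i) y) * indicator {-1..1} y" for n y
  have B0: "0 \<le> B i" for i by (simp add: B_def power_mult)
  have C0: "0 \<le> C j" for j by (simp add: C_def power_mult)
  have sumB: "summable B"
  proof -
    have "B = (\<lambda>k. 1 / (4 ^ k * (fact k)\<^sup>2) * (\<beta>\<^sup>2) ^ k)"
      by (auto simp: B_def fun_eq_iff power_mult power_divide)
    then show ?thesis using summable_bessel_I0[of "\<beta>\<^sup>2"] by simp
  qed
  have sumC: "summable C"
  proof (rule summable_comparison_test'[OF summable_exp[of "a\<^sup>2"], of 0])
    fix j :: nat
    have "(a\<^sup>2) ^ j / fact (2 * j) \<le> (a\<^sup>2) ^ j / fact j"
      using fact_le_fact_double[of j] by (intro divide_left_mono) auto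
    then show "norm (C j) \<le> inverse (fact j) * (a\<^sup>2) ^ j"
      using C0[of j] by (simp add: C_def power_mult inverse_eq_divide)
  qed
  have bB: "\<bar>b i y\<bar> \<le> B i" if "y \<in> {-1..1}" for i y
  proof -
    have "y\<^sup>2 \<le> 1" using that by (simp add: abs_square_le_1 abs_le_iff)
    then have "\<bar>(1 - y\<^sup>2) ^ i\<bar> \<le> 1" by (simp add: power_abs power_le_one)
    then show ?thesis using B0[of i] unfolding b_def B_def abs_mult
      by (metis abs_of_nonneg mult.right_neutral mult_left_mono)
  qed
  have cC: "\<bar>c j y\<bar> \<le> C j" if "y \<in> {-1..1}" for j y
  proof -
    have "y\<^sup>2 \<le> 1" using that by (simp add: abs_square_le_1 abs_le_iff)
    then have "\<bar>y ^ (2 * j)\<bar> \<le> 1" by (simp add: power_mult power_le_one)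
    then have "C j * \<bar>y ^ (2 * j)\<bar> \<le> C j" using C0[of j] by (rule mult_left_le)
    moreover have "\<bar>c j y\<bar> = C j * \<bar>y ^ (2 * j)\<bar>"
      by (simp add: c_def C_def power_mult_distrib abs_mult power_abs power_mult)
    ultimately show ?thesis by simp
  qed
  have Fle: "\<bar>F n y\<bar> \<le> (\<Sum>i\<le>n. B i * C (n - i)) * indicator {-1..1} y" for n y
  proof (cases "y \<in> {-1..1}")
    case True
    have "\<bar>\<Sum>i\<le>n. b i y * c (n - i) y\<bar> \<le> (\<Sum>i\<le>n. \<bar>b i y * c (n - i) y\<bar>)" by (rule sum_abs)
    also have "\<dots> \<le> (\<Sum>i\<le>n. B i * C (n - i))"
      unfolding abs_mult by (intro sum_mono mult_mono bB[OF True] cC[OF True] B0) auto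
    finally show ?thesis using True by (simp add: F_def)
  qed (simp add: F_def)
  have intF: "integrable lborel (F n)" for n
    unfolding F_def[abs_def] b_def c_def by (intro integrable_on_interval' continuous_intros) auto
  have ind: "integrable lborel (\<lambda>y::real. indicator {-1..1} y :: real)" by simp
  have sumBC: "summable (\<lambda>n. \<Sum>i\<le>n. B i * C (n - i))"
    by (rule summable_Cauchy_product) (use sumB sumC B0 C0 in auto)
  have sumF: "summable (\<lambda>n. norm (F n y))" for y
  proof (rule summable_comparison_test'[OF sumBC, of 0])
    fix n
    have "0 \<le> (\<Sum>i\<le>n. B i * C (n - i))" by (intro sum_nonneg mult_nonneg_nonneg B0 C0)
    then show "norm (norm (F n y)) \<le> (\<Sum>i\<le>n. B i * C (n - i))"
      using Fle[of n y] by (cases "y \<in> {-1..1}") (auto simp del: sum_nonneg_eq_0_iff)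
  qed
  have sumint: "summable (\<lambda>n. LINT y|lborel. norm (F n y))"
  proof (rule summable_comparison_test'[OF summable_mult[OF sumBC, of 2], of 0])
    fix n
    have "(LINT y|lborel. norm (F n y)) \<le> (LINT y::real|lborel. (\<Sum>i\<le>n. B i * C (n - i)) * indicator {-1..1} y)"
    proof (rule integral_mono)
      show "integrable lborel (\<lambda>y. norm (F n y))" by (rule integrable_norm[OF intF])
      show "integrable lborel (\<lambda>y::real. (\<Sum>i\<le>n. B i * C (n - i)) * indicator {-1..1} y)"
        by (rule integrable_mult_right[OF ind])
    qed (use Fle in simp)
    also have "\<dots> = 2 * (\<Sum>i\<le>n. B i * C (n - i))" by simp
    finally show "norm (LINT y|lborel. norm (F n y)) \<le> 2 * (\<Sum>i\<le>n. B i * C (n - i))" by simp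
  qed
  have prod: "bessel_I0 (\<beta> * sqrt (1 - y\<^sup>2)) * cos (a * y) * indicator {-1..1} y = (\<Sum>n. F n y)" for y
  proof (cases "y \<in> {-1..1}")
    case True
    then have y: "y\<^sup>2 \<le> 1" by (simp add: abs_square_le_1 abs_le_iff)
    have "bessel_I0 (\<beta> * sqrt (1 - y\<^sup>2)) = (\<Sum>i. b i y)"
      unfolding bessel_I0_def b_def using y
      by (simp add: power_mult power_mult_distrib power_divide)
    moreover have "cos (a * y) = (\<Sum>j. c j y)"
      using cos_paired[of "a * y"] by (simp add: sums_iff c_def)
    moreover have "(\<lambda>n. \<Sum>i\<le>n. b i y * c (n - i) y) sums ((\<Sum>i. b i y) * (\<Sum>j. c j y))"
    proof (rule Cauchy_product_sums)
      show "summable (\<lambda>i. norm (b i y))"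
        by (rule summable_comparison_test'[OF sumB, of 0]) (use bB[OF True] in auto)
      show "summable (\<lambda>j. norm (c j y))"
        by (rule summable_comparison_test'[OF sumC, of 0]) (use cC[OF True] in auto)
    qed
    ultimately show ?thesis using True by (simp add: F_def sums_iff)
  qed (simp add: F_def)
  have term_integral: "(LINT y|lborel. F n y) = 2 * ((\<beta>\<^sup>2 - a\<^sup>2) ^ n / fact (2 * n + 1))" for n
  proof -
    have "(LINT y|lborel. F n y) = (LINT y|lborel. (\<Sum>i\<le>n. ((\<beta> / 2) ^ (2 * i) / (fact i)\<^sup>2 * ((- 1) ^ (n - i) * a ^ (2 * (n - i)) / fact (2 * (n - i))))
        * ((1 - y\<^sup>2) ^ i * y ^ (2 * (n - i)) * indicator {-1..1} y)))"
      unfolding F_def b_def c_def sum_distrib_right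
      by (intro Bochner_Integration.integral_cong sum.cong refl) (simp add: power_mult_distrib)
    also have "\<dots> = (\<Sum>i\<le>n. ((\<beta> / 2) ^ (2 * i) / (fact i)\<^sup>2 * ((- 1) ^ (n - i) * a ^ (2 * (n - i)) / fact (2 * (n - i)))) * beta_moment i (n - i))"
      unfolding beta_moment_def
      by (subst Bochner_Integration.integral_sum) (auto intro!: integrable_mult_right integrable_on_interval' continuous_intros)
    also have "\<dots> = (\<Sum>i\<le>n. 2 / fact (2 * n + 1) * (of_nat (n choose i) * (\<beta>\<^sup>2) ^ i * (- a\<^sup>2) ^ (n - i)))"
    proof (rule sum.cong[OF refl])
      fix i assume "i \<in> {..n}"
      then have i: "i \<le> n" by simp
      have e1: "(- a\<^sup>2) ^ (n - i) = (- 1) ^ (n - i) * a ^ (2 * (n - i))"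
        by (metis mult_minus1 power_mult power_mult_distrib)
      have e2: "(\<beta> / 2) ^ (2 * i) = (\<beta>\<^sup>2) ^ i / 4 ^ i" by (simp add: power_mult power_divide)
      show "((\<beta> / 2) ^ (2 * i) / (fact i)\<^sup>2 * ((- 1) ^ (n - i) * a ^ (2 * (n - i)) / fact (2 * (n - i)))) * beta_moment i (n - i)
         = 2 / fact (2 * n + 1) * (of_nat (n choose i) * (\<beta>\<^sup>2) ^ i * (- a\<^sup>2) ^ (n - i))"
        unfolding beta_moment_eq binomial_fact[OF i] e1 e2 using i
        by (simp add: power2_eq_square[of "fact i"] mult_ac del: fact_Suc)
    qed
    also have "\<dots> = 2 / fact (2 * n + 1) * (\<beta>\<^sup>2 + (- a\<^sup>2)) ^ n"
      unfolding binomial_ring sum_distrib_left by simp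
    finally show ?thesis by simp
  qed
  have "(LINT y|lborel. bessel_I0 (\<beta> * sqrt (1 - y\<^sup>2)) * cos (a * y) * indicator {-1..1} y) = (LINT y|lborel. (\<Sum>n. F n y))"
    by (simp only: prod)
  also have "\<dots> = (\<Sum>n. LINT y|lborel. F n y)"
    using sumF by (intro integral_suminf intF sumint) auto
  also have "\<dots> = 2 * shc (\<beta>\<^sup>2 - a\<^sup>2)"
    unfolding term_integral shc_def using summable_shc[of "\<beta>\<^sup>2 - a\<^sup>2"] by (subst suminf_mult) auto
  finally show ?thesis .
qed

lemma integral_odd_zero:
  fixes h :: "real \<Rightarrow> real"
  assumes "\<And>y. h (- y) = - h y"
  shows "(LINT y|lborel. h y) = 0"
  using lborel_integral_real_affine[of "-1" h 0] assms by simp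

lemma kaiser_bessel_transform:
  "(LINT y|lborel. of_real (bessel_I0 (\<beta> * sqrt (1 - y\<^sup>2)) * indicator {-1..1} y) * iexp (- (a * y)))
     = complex_of_real (2 * shc (\<beta>\<^sup>2 - a\<^sup>2))"
proof -
  define h where "h y = bessel_I0 (\<beta> * sqrt (1 - y\<^sup>2)) * indicator {-1..1} y" for y :: real
  have cont: "continuous_on {-1..1} (\<lambda>y. bessel_I0 (\<beta> * sqrt (1 - y\<^sup>2)))" by (intro continuous_intros)
  have int: "integrable lborel (\<lambda>y. h y * cos (a * y))" "integrable lborel (\<lambda>y. h y * sin (a * y))"
  proof -
    have "integrable lborel (\<lambda>y. bessel_I0 (\<beta> * sqrt (1 - y\<^sup>2)) * cos (a * y) * indicator {-1..1} y)"
      "integrable lborel (\<lambda>y. bessel_I0 (\<beta> * sqrt (1 - y\<^sup>2)) * sin (a * y) * indicator {-1..1} y)"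
      by (intro integrable_on_interval' continuous_intros)+
    then show "integrable lborel (\<lambda>y. h y * cos (a * y))" "integrable lborel (\<lambda>y. h y * sin (a * y))"
      by (simp_all add: h_def mult_ac)
  qed
  have "of_real (h y) * iexp (- (a * y)) = of_real (h y * cos (a * y)) - \<i> * of_real (h y * sin (a * y))" for y
    unfolding cis_conv_exp[symmetric] by (simp add: complex_eq_iff)
  then have "(LINT y|lborel. of_real (h y) * iexp (- (a * y)))
     = (LINT y|lborel. of_real (h y * cos (a * y)) - \<i> * of_real (h y * sin (a * y)))" by simp
  also have "\<dots> = of_real (LINT y|lborel. h y * cos (a * y)) - \<i> * of_real (LINT y|lborel. h y * sin (a * y))"
    using int
    by (subst Bochner_Integration.integral_diff)
       (auto intro!: integrable_mult_right integrable_of_real simp del: of_real_mult)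
  also have "(LINT y|lborel. h y * sin (a * y)) = 0"
    by (rule integral_odd_zero) (auto simp: h_def indicator_def)
  also have "(LINT y|lborel. h y * cos (a * y)) = 2 * shc (\<beta>\<^sup>2 - a\<^sup>2)"
    using kaiser_bessel_cosine_transform[of \<beta> a] by (simp add: h_def mult_ac)
  finally show ?thesis by (simp add: h_def)
qed

section \<open>The transform of the Kaiser--Bessel window\<close>

text \<open>
  The Fourier transform of the window divided by \<open>sqrt (2 * pi)\<close>, so that the window is the
  integral of this function against \<open>exp (\<i> x \<tau>)\<close> without a further factor. The second term comes
  from the constant subtracted in the window: it is the same transform with \<open>\<beta> = 0\<close>.
\<close>
definition kaiser_bessel_hat :: "nat \<Rightarrow> real \<Rightarrow> real \<Rightarrow> real" where
  "kaiser_bessel_hat m \<beta> \<tau> = real m / (pi * (bessel_I0 \<beta> - 1))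
     * (shc (\<beta>\<^sup>2 - (real m * \<tau>)\<^sup>2) - shc (- (real m * \<tau>)\<^sup>2))"

lemma cKB_window_outside: "real m \<le> \<bar>x\<bar> \<Longrightarrow> 0 < m \<Longrightarrow> cKB_window m \<beta> x = 0"
proof -
  assume *: "real m \<le> \<bar>x\<bar>" "0 < m"
  show ?thesis
  proof (cases "x \<in> {- real m..real m}")
    case True
    then have "\<bar>x\<bar> = real m" using * by auto
    then have "x\<^sup>2 = (real m)\<^sup>2" by (metis power2_abs)
    then show ?thesis using * by (simp add: cKB_window_def)
  qed (auto simp: cKB_window_def)
qed

lemma cKB_window_zero:
  assumes "1 < bessel_I0 \<beta>"
  shows "cKB_window m \<beta> 0 = 1"
  using assms by (simp add: cKB_window_def)

text \<open>
  The truncation at the ends of the interval is absorbed into the square root because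
  \<open>bessel_I0 0 = 1\<close>. Continuity of the window on the whole line can be read off from this form.
\<close>
lemma cKB_window_max:
  assumes "0 < m"
  shows "cKB_window m \<beta> x = 1 / (bessel_I0 \<beta> - 1) * (bessel_I0 (\<beta> * sqrt (max 0 (1 - x\<^sup>2 / (real m)\<^sup>2))) - 1)"
proof (cases "x \<in> {- real m..real m}")
  case True
  then have "x\<^sup>2 \<le> (real m)\<^sup>2" by (intro abs_le_square_iff[THEN iffD1]) auto
  then have "x\<^sup>2 / (real m)\<^sup>2 \<le> 1" using assms by simp
  then show ?thesis using True by (simp add: cKB_window_def max_def)
next
  case False
  then have "(real m)\<^sup>2 \<le> x\<^sup>2" by (intro abs_le_square_iff[THEN iffD1]) auto
  then have "1 \<le> x\<^sup>2 / (real m)\<^sup>2" using assms by simp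
  then show ?thesis using False by (auto simp add: cKB_window_def max_def)
qed

lemma continuous_on_cKB_window:
  assumes "0 < m"
  shows "continuous_on S (cKB_window m \<beta>)"
  unfolding cKB_window_max[OF assms, abs_def] using assms by (intro continuous_intros) auto

lemma cKB_window_integrable_L2:
  assumes "0 < m"
  shows "(\<lambda>x. complex_of_real (cKB_window m \<beta> x)) \<in> L1_space \<inter> L2_space"
proof -
  have eq: "indicator {- real m..real m} x *\<^sub>R complex_of_real (cKB_window m \<beta> x) = complex_of_real (cKB_window m \<beta> x)" for x
    using cKB_window_outside[of m x \<beta>] assms by (cases "x \<in> {- real m..real m}") (auto simp: cKB_window_def)
  have "integrable lborel (\<lambda>x. indicator {- real m..real m} x *\<^sub>R complex_of_real (cKB_window m \<beta> x))"
    by (intro integrable_on_interval continuous_intros continuous_on_cKB_window assms)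
  then have int: "integrable lborel (\<lambda>x. complex_of_real (cKB_window m \<beta> x))" by (simp only: eq)
  have "compact (cKB_window m \<beta> ` {- real m..real m})"
    by (intro compact_continuous_image continuous_on_cKB_window assms) simp
  then have "bounded (cKB_window m \<beta> ` {- real m..real m})" by (rule compact_imp_bounded)
  then obtain C where C: "\<And>x. x \<in> {- real m..real m} \<Longrightarrow> \<bar>cKB_window m \<beta> x\<bar> \<le> C"
    unfolding bounded_iff by (auto simp del: atLeastAtMost_iff)
  have "cmod (complex_of_real (cKB_window m \<beta> x)) \<le> max 0 C" for x
    unfolding norm_of_real using C[of x] by (cases "x \<in> {- real m..real m}") (auto simp: cKB_window_def)
  from L2_bounded_integrable[OF int this] int show ?thesis by (simp add: L1_space_def)
qed

lemma cKB_window_fourier: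
  assumes m: "0 < m"
  shows "fourier_integral (\<lambda>x. complex_of_real (cKB_window m \<beta> x)) \<tau>
     = complex_of_real (sqrt (2 * pi) * kaiser_bessel_hat m \<beta> \<tau>)"
proof -
  let ?c = "1 / (bessel_I0 \<beta> - 1)"
  define H where "H b y = of_real (bessel_I0 (b * sqrt (1 - y\<^sup>2)) * indicator {-1..1} y) * iexp (- (real m * \<tau> * y))" for b y :: real
  have intH: "integrable lborel (H b)" for b
  proof -
    have "H b = (\<lambda>y. indicator {-1..1} y *\<^sub>R (of_real (bessel_I0 (b * sqrt (1 - y\<^sup>2))) * iexp (- (real m * \<tau> * y))))"
      by (auto simp: H_def fun_eq_iff indicator_def)
    then show ?thesis by (simp only:) (intro integrable_on_interval continuous_intros)
  qed
  have win: "complex_of_real (cKB_window m \<beta> (0 + real m * y)) * iexp (- ((0 + real m * y) * \<tau>))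
      = of_real ?c * (H \<beta> y - H 0 y)" for y
  proof (cases "y \<in> {-1..1}")
    case True
    then have "real m * y \<in> {- real m..real m}"
      using m mult_left_mono[of "-1" y "real m"] mult_left_mono[of y 1 "real m"] by auto
    then have "cKB_window m \<beta> (real m * y) = ?c * (bessel_I0 (\<beta> * sqrt (1 - y\<^sup>2)) - 1)"
      using m by (simp add: cKB_window_def power_mult_distrib)
    then have "complex_of_real (cKB_window m \<beta> (0 + real m * y)) = of_real ?c * of_real (bessel_I0 (\<beta> * sqrt (1 - y\<^sup>2)) - 1)"
      by (simp only: add_0 of_real_mult)
    moreover have "H \<beta> y - H 0 y = of_real (bessel_I0 (\<beta> * sqrt (1 - y\<^sup>2)) - 1) * iexp (- (real m * \<tau> * y))"
      using True by (simp add: H_def left_diff_distrib)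
    moreover have "(0 + real m * y) * \<tau> = real m * \<tau> * y" by simp
    ultimately show ?thesis by (simp only: mult.assoc)
  next
    case False
    then have "1 \<le> \<bar>y\<bar>" by auto
    then have "real m \<le> \<bar>real m * y\<bar>" using m by (simp add: abs_mult)
    then show ?thesis using False m by (simp add: H_def cKB_window_outside)
  qed
  have "(LINT x|lborel. complex_of_real (cKB_window m \<beta> x) * iexp (- (x * \<tau>)))
     = \<bar>real m\<bar> *\<^sub>R (LINT y|lborel. complex_of_real (cKB_window m \<beta> (0 + real m * y)) * iexp (- ((0 + real m * y) * \<tau>)))"
    by (rule lborel_integral_real_affine) (use m in simp)
  also have "(LINT y|lborel. complex_of_real (cKB_window m \<beta> (0 + real m * y)) * iexp (- ((0 + real m * y) * \<tau>)))
     = (LINT y|lborel. of_real ?c * (H \<beta> y - H 0 y))" by (simp only: win)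
  also have "\<dots> = of_real ?c * ((LINT y|lborel. H \<beta> y) - (LINT y|lborel. H 0 y))"
    unfolding integral_mult_right_zero Bochner_Integration.integral_diff[OF intH intH] ..
  also have "(LINT y|lborel. H \<beta> y) = of_real (2 * shc (\<beta>\<^sup>2 - (real m * \<tau>)\<^sup>2))"
    unfolding H_def by (rule kaiser_bessel_transform)
  also have "(LINT y|lborel. H 0 y) = of_real (2 * shc (0\<^sup>2 - (real m * \<tau>)\<^sup>2))"
    unfolding H_def by (rule kaiser_bessel_transform)
  finally have "fourier_integral (\<lambda>x. complex_of_real (cKB_window m \<beta> x)) \<tau>
      = complex_of_real (1 / sqrt (2 * pi) * (real m * (?c * (2 * shc (\<beta>\<^sup>2 - (real m * \<tau>)\<^sup>2) - 2 * shc (0\<^sup>2 - (real m * \<tau>)\<^sup>2)))))"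
    unfolding fourier_integral_iexp by (simp add: scaleR_conv_of_real)
  also have "1 / sqrt (2 * pi) * (real m * (?c * (2 * shc (\<beta>\<^sup>2 - (real m * \<tau>)\<^sup>2) - 2 * shc (0\<^sup>2 - (real m * \<tau>)\<^sup>2))))
      = (2 * pi / sqrt (2 * pi)) * kaiser_bessel_hat m \<beta> \<tau>"
  proof -
    have "1 / r * (real m * (1 / D * (2 * A - 2 * B))) = (2 * pi / r) * (real m / (pi * D) * (A - B))"
      for r D A B :: real
      by (cases "r = 0"; cases "D = 0") (simp_all add: field_simps)
    then show ?thesis by (simp only: kaiser_bessel_hat_def zero_power2 diff_0)
  qed
  also have "2 * pi / sqrt (2 * pi) = sqrt (2 * pi)" by (rule real_div_sqrt) simp
  finally show ?thesis .
qed

section \<open>Decay of the transformed window\<close>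

lemma sqrt_one_minus_ge:
  assumes "0 \<le> x" "x \<le> 1"
  shows "1 - x / 2 - x\<^sup>2 / 2 \<le> sqrt (1 - (x::real))"
proof (rule real_le_rsqrt)
  have "(1 - x / 2 - x\<^sup>2 / 2)\<^sup>2 = (1 - x) * ((1 - x) * (1 + x / 2)\<^sup>2)"
    by (simp add: power2_eq_square field_simps)
  also have "(1 - x) * (1 + x / 2)\<^sup>2 = 1 - x\<^sup>2 * (3 + x) / 4"
    by (simp add: power2_eq_square field_simps)
  also have "(1 - x) * (1 - x\<^sup>2 * (3 + x) / 4) \<le> (1 - x) * 1"
    using assms by (intro mult_left_mono) auto
  finally show "(1 - x / 2 - x\<^sup>2 / 2)\<^sup>2 \<le> 1 - x" by simp
qed

text \<open>
  Write \<open>sin s / s - sin w / w = sin s * (1 / s - 1 / w) + (sin s - sin w) / w\<close>. Each term is at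
  most \<open>(w - s) / w\<close>.
\<close>
lemma shc_difference_bound:
  assumes "0 \<le> s" "s \<le> w" "0 < w"
  shows "\<bar>shc (- s\<^sup>2) - shc (- w\<^sup>2)\<bar> \<le> 2 * (w - s) / w"
proof -
  have sw: "\<bar>sin s - sin w\<bar> \<le> w - s"
  proof -
    have "dist (sin s) (sin w) \<le> 1 * dist s w"
      by (rule differentiable_bound[of UNIV sin "\<lambda>x. (*) (cos x)" 1, folded dist_norm])
         (auto simp: has_field_derivative_def[symmetric] intro!: DERIV_sin onorm_le mult_left_le_one_le simp: abs_mult)
    then show ?thesis using assms by (simp add: dist_real_def)
  qed
  show ?thesis
  proof (cases "s = 0")
    case True
    have "\<bar>sin w / w\<bar> \<le> 1" using assms abs_sin_x_le_abs_x[of w] by simp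
    then have "\<bar>1 - sin w / w\<bar> \<le> 2" by linarith
    then show ?thesis using True assms by (simp add: shc_neg_square)
  next
    case False
    have "sin s / s - sin w / w = sin s * (w - s) / (s * w) + (sin s - sin w) / w"
      using False assms by (simp add: field_simps)
    also have "\<bar>\<dots>\<bar> \<le> \<bar>sin s * (w - s) / (s * w)\<bar> + \<bar>(sin s - sin w) / w\<bar>" by (rule abs_triangle_ineq)
    also have "\<dots> \<le> (w - s) / w + (w - s) / w"
    proof (rule add_mono)
      have "\<bar>sin s\<bar> * (w - s) \<le> s * (w - s)"
        using assms abs_sin_x_le_abs_x[of s] by (intro mult_right_mono) auto
      then show "\<bar>sin s * (w - s) / (s * w)\<bar> \<le> (w - s) / w"
        using assms False by (simp add: abs_mult divide_simps mult.commute)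
      show "\<bar>(sin s - sin w) / w\<bar> \<le> (w - s) / w"
        using sw assms by (simp add: divide_right_mono)
    qed
    finally show ?thesis using False assms by (simp add: shc_neg_square)
  qed
qed

text \<open>
  In this range both terms of the transform are values of \<open>sin x / x\<close>, at the nearby points
  \<open>w = m * \<bar>\<tau>\<bar>\<close> and \<open>s = sqrt (w\<^sup>2 - \<beta>\<^sup>2)\<close>. Their difference decays quadratically, and it has lost the
  exponential growth in \<open>\<beta>\<close> that the normalizing factor divides out.
\<close>
lemma kaiser_bessel_hat_decay:
  assumes \<beta>: "0 < \<beta>" and I0: "1 < bessel_I0 \<beta>" and \<tau>: "\<beta> \<le> real m * \<bar>\<tau>\<bar>"
  shows "\<bar>kaiser_bessel_hat m \<beta> \<tau>\<bar>
    \<le> real m / (pi * (bessel_I0 \<beta> - 1)) * (\<beta>\<^sup>2 / (real m * \<tau>)\<^sup>2 + \<beta> ^ 4 / (real m * \<tau>) ^ 4)"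
proof -
  define w where "w = real m * \<bar>\<tau>\<bar>"
  define s where "s = sqrt (w\<^sup>2 - \<beta>\<^sup>2)"
  have w: "0 < w" "\<beta> \<le> w" using \<beta> \<tau> by (auto simp: w_def)
  have w2: "(real m * \<tau>)\<^sup>2 = w\<^sup>2" by (simp add: w_def power_mult_distrib)
  then have w4: "(real m * \<tau>) ^ 4 = w ^ 4" by (metis power2_eq_square power4_eq_xxxx mult.assoc)
  have le: "\<beta>\<^sup>2 \<le> w\<^sup>2" using w \<beta> by (intro power_mono) auto
  then have s2: "s\<^sup>2 = w\<^sup>2 - \<beta>\<^sup>2" by (simp add: s_def)
  have s: "0 \<le> s" "s \<le> w" using le w \<beta> by (auto simp: s_def intro!: real_le_lsqrt)
  define x where "x = \<beta>\<^sup>2 / w\<^sup>2"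
  have x: "0 \<le> x" "x \<le> 1" using le w by (auto simp: x_def divide_simps)
  have "s = w * sqrt (1 - x)"
  proof -
    have "w\<^sup>2 - \<beta>\<^sup>2 = w\<^sup>2 * (1 - x)" using w by (simp add: x_def algebra_simps)
    then show ?thesis using w by (simp add: s_def real_sqrt_mult)
  qed
  then have "2 * (w - s) / w = 2 * (1 - sqrt (1 - x))" using w by (simp add: field_simps)
  also have "\<dots> \<le> x + x\<^sup>2" using sqrt_one_minus_ge[OF x] by simp
  also have "x\<^sup>2 = \<beta> ^ 4 / w ^ 4" by (simp add: x_def power_divide flip: power_mult)
  finally have "\<bar>shc (- s\<^sup>2) - shc (- w\<^sup>2)\<bar> \<le> \<beta>\<^sup>2 / w\<^sup>2 + \<beta> ^ 4 / w ^ 4"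
    using shc_difference_bound[OF s w(1)] by (simp add: x_def)
  then have "real m / (pi * (bessel_I0 \<beta> - 1)) * \<bar>shc (\<beta>\<^sup>2 - w\<^sup>2) - shc (- w\<^sup>2)\<bar>
     \<le> real m / (pi * (bessel_I0 \<beta> - 1)) * (\<beta>\<^sup>2 / w\<^sup>2 + \<beta> ^ 4 / w ^ 4)"
    using I0 by (intro mult_left_mono) (auto simp: s2)
  then show ?thesis
    using I0 unfolding kaiser_bessel_hat_def w2 w4 by (simp add: abs_mult)
qed

lemma inverse_power_tail:
  fixes a p q :: real
  assumes a: "0 < a" and "0 \<le> p" "0 \<le> q"
  shows "has_bochner_integral lborel (\<lambda>x. (p / x\<^sup>2 + q / x ^ 4) * indicator {a..} x) (p / a + q / (3 * a ^ 3))"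
proof (rule has_bochner_integral_nn_integral)
  have "(\<integral>\<^sup>+ x. ennreal (p / x\<^sup>2 + q / x ^ 4) * indicator {a..} x \<partial>lborel)
      = ennreal (0 - (- (p / a + q / (3 * a ^ 3))))"
  proof (rule nn_integral_FTC_atLeast[where F="\<lambda>x. - (p / x + q / (3 * x ^ 3))"])
    show "((\<lambda>x. - (p / x + q / (3 * x ^ 3))) \<longlongrightarrow> 0) at_top"
    proof -
      have "((\<lambda>x. - (p * (1 / x) + q / 3 * (1 / x ^ 3))) \<longlongrightarrow> - (p * 0 + q / 3 * 0)) at_top"
        by (intro tendsto_intros; real_asymp)
      then show ?thesis by simp
    qed
    fix x assume "a \<le> x"
    then have "0 < x" using a by simp
    then show "((\<lambda>x. - (p / x + q / (3 * x ^ 3))) has_real_derivative p / x\<^sup>2 + q / x ^ 4) (at x)"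
      by (auto intro!: derivative_eq_intros simp: field_simps power2_eq_square power3_eq_cube power4_eq_xxxx)
    show "0 \<le> p / x\<^sup>2 + q / x ^ 4" using assms by simp
  qed simp
  then show "(\<integral>\<^sup>+ x. ennreal ((p / x\<^sup>2 + q / x ^ 4) * indicator {a..} x) \<partial>lborel)
      = ennreal (p / a + q / (3 * a ^ 3))"
    by (simp add: ennreal_mult'' ennreal_indicator add.commute)
qed (use assms in auto)

lemma kaiser_bessel_hat_even: "kaiser_bessel_hat m \<beta> (- \<tau>) = kaiser_bessel_hat m \<beta> \<tau>"
  by (simp add: kaiser_bessel_hat_def)

lemma continuous_on_kaiser_bessel_hat: "continuous_on S (kaiser_bessel_hat m \<beta>)"
  unfolding kaiser_bessel_hat_def[abs_def] by (intro continuous_intros)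

lemma measurable_kaiser_bessel_hat [measurable]: "kaiser_bessel_hat m \<beta> \<in> borel_measurable borel"
  by (intro borel_measurable_continuous_onI continuous_on_kaiser_bessel_hat)

text \<open>
  Integrating the decay bound gives \<open>p / a + q / (3 * a ^ 3)\<close>. Since \<open>\<beta> \<le> m * a\<close>, the second summand
  is at most a third of the first, hence the factor \<open>4 / 3\<close>.
\<close>
lemma kaiser_bessel_hat_tail:
  assumes m: "0 < m" and \<beta>: "0 < \<beta>" and I0: "1 < bessel_I0 \<beta>" and a: "\<beta> \<le> real m * a"
  shows "integrable lborel (\<lambda>\<tau>. kaiser_bessel_hat m \<beta> \<tau> * indicator {a..} \<tau>)"
    and "(LINT \<tau>|lborel. \<bar>kaiser_bessel_hat m \<beta> \<tau>\<bar> * indicator {a..} \<tau>)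
       \<le> 4 * \<beta>\<^sup>2 / (3 * pi * (bessel_I0 \<beta> - 1) * (real m * a))"
proof -
  define K where "K = real m / (pi * (bessel_I0 \<beta> - 1))"
  define p where "p = K * \<beta>\<^sup>2 / (real m)\<^sup>2"
  define q where "q = K * \<beta> ^ 4 / (real m) ^ 4"
  have K0: "0 \<le> K" using I0 by (simp add: K_def)
  have a0: "0 < a" using \<beta> a m by (smt (verit) of_nat_0_less_iff zero_less_mult_pos)
  have pq: "0 \<le> p" "0 \<le> q" using K0 by (simp_all add: p_def q_def)
  note G = inverse_power_tail[OF a0 pq]
  have le: "\<bar>kaiser_bessel_hat m \<beta> \<tau>\<bar> * indicator {a..} \<tau> \<le> (p / \<tau>\<^sup>2 + q / \<tau> ^ 4) * indicator {a..} \<tau>" for \<tau>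
  proof (cases "\<tau> \<in> {a..}")
    case True
    have "real m * a \<le> real m * \<bar>\<tau>\<bar>" using True a0 m by simp
    then have "\<beta> \<le> real m * \<bar>\<tau>\<bar>" using a by linarith
    then have "\<bar>kaiser_bessel_hat m \<beta> \<tau>\<bar> \<le> K * (\<beta>\<^sup>2 / (real m * \<tau>)\<^sup>2 + \<beta> ^ 4 / (real m * \<tau>) ^ 4)"
      unfolding K_def by (rule kaiser_bessel_hat_decay[OF \<beta> I0])
    also have "\<dots> = p / \<tau>\<^sup>2 + q / \<tau> ^ 4"
      by (simp add: p_def q_def power_mult_distrib algebra_simps)
    finally show ?thesis using True by simp
  qed simp
  have intG: "integrable lborel (\<lambda>x. (p / x\<^sup>2 + q / x ^ 4) * indicator {a..} x)"
    using G by (rule integrable.intros)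
  show int: "integrable lborel (\<lambda>\<tau>. kaiser_bessel_hat m \<beta> \<tau> * indicator {a..} \<tau>)"
  proof (rule Bochner_Integration.integrable_bound[OF intG])
    show "AE \<tau> in lborel. norm (kaiser_bessel_hat m \<beta> \<tau> * indicator {a..} \<tau>)
        \<le> norm ((p / \<tau>\<^sup>2 + q / \<tau> ^ 4) * indicator {a..} \<tau>)"
    proof (rule AE_I2)
      fix \<tau>
      show "norm (kaiser_bessel_hat m \<beta> \<tau> * indicator {a..} \<tau>) \<le> norm ((p / \<tau>\<^sup>2 + q / \<tau> ^ 4) * indicator {a..} \<tau>)"
        using order_trans[OF le[of \<tau>] abs_ge_self] by (simp only: real_norm_def abs_mult abs_indicator)
    qed
  qed measurable
  have "(LINT \<tau>|lborel. \<bar>kaiser_bessel_hat m \<beta> \<tau>\<bar> * indicator {a..} \<tau>)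
      \<le> (LINT \<tau>|lborel. (p / \<tau>\<^sup>2 + q / \<tau> ^ 4) * indicator {a..} \<tau>)"
    using integrable_abs[OF int] by (intro integral_mono intG le) (simp add: abs_mult)
  also have "\<dots> = p / a + q / (3 * a ^ 3)" using G by (rule has_bochner_integral_integral_eq)
  also have "q / (3 * a ^ 3) = p / (3 * a) * (\<beta> / (real m * a))\<^sup>2"
    using a0 m by (simp add: p_def q_def power_divide power_mult_distrib power2_eq_square power3_eq_cube power4_eq_xxxx mult_ac)
  also have "\<dots> \<le> p / (3 * a) * 1"
  proof (intro mult_left_mono power_le_one)
    show "\<beta> / (real m * a) \<le> 1" using a a0 m by simp
  qed (use \<beta> a0 pq in auto)
  also have "p / a + p / (3 * a) * 1 = 4 * \<beta>\<^sup>2 / (3 * pi * (bessel_I0 \<beta> - 1) * (real m * a))"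
  proof -
    have A: "p / a + p / (3 * a) * 1 = 4 * p / (3 * a)" using a0 by (simp add: field_simps)
    have P: "p = \<beta>\<^sup>2 / (pi * (bessel_I0 \<beta> - 1) * real m)"
      using m by (simp add: p_def K_def power2_eq_square)
    show ?thesis
      unfolding A unfolding P by (simp only: times_divide_eq_right divide_divide_eq_left mult_ac)
  qed
  finally show "(LINT \<tau>|lborel. \<bar>kaiser_bessel_hat m \<beta> \<tau>\<bar> * indicator {a..} \<tau>)
       \<le> 4 * \<beta>\<^sup>2 / (3 * pi * (bessel_I0 \<beta> - 1) * (real m * a))" by simp
qed

lemma kaiser_bessel_hat_tail_reflected:
  assumes m: "0 < m" and \<beta>: "0 < \<beta>" and I0: "1 < bessel_I0 \<beta>" and a: "\<beta> \<le> real m * a"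
  shows "integrable lborel (\<lambda>\<tau>. kaiser_bessel_hat m \<beta> \<tau> * indicator {..- a} \<tau>)"
    and "(LINT \<tau>|lborel. \<bar>kaiser_bessel_hat m \<beta> \<tau>\<bar> * indicator {..- a} \<tau>)
       \<le> 4 * \<beta>\<^sup>2 / (3 * pi * (bessel_I0 \<beta> - 1) * (real m * a))"
proof -
  have ind: "indicator {a..} (0 + - 1 * \<tau>) = (indicator {..- a} \<tau> :: real)" for \<tau>
    by (auto simp: indicator_def)
  have neg: "kaiser_bessel_hat m \<beta> (0 + - 1 * \<tau>) = kaiser_bessel_hat m \<beta> \<tau>" for \<tau>
    using kaiser_bessel_hat_even by simp
  show "integrable lborel (\<lambda>\<tau>. kaiser_bessel_hat m \<beta> \<tau> * indicator {..- a} \<tau>)"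
    using lborel_integrable_real_affine[OF kaiser_bessel_hat_tail(1)[OF assms], of "- 1" 0]
    unfolding ind neg by simp
  have "(LINT \<tau>|lborel. \<bar>kaiser_bessel_hat m \<beta> \<tau>\<bar> * indicator {a..} \<tau>)
      = \<bar>- 1\<bar> *\<^sub>R (LINT \<tau>|lborel. \<bar>kaiser_bessel_hat m \<beta> (0 + - 1 * \<tau>)\<bar> * indicator {a..} (0 + - 1 * \<tau>))"
    by (rule lborel_integral_real_affine) simp
  then show "(LINT \<tau>|lborel. \<bar>kaiser_bessel_hat m \<beta> \<tau>\<bar> * indicator {..- a} \<tau>)
       \<le> 4 * \<beta>\<^sup>2 / (3 * pi * (bessel_I0 \<beta> - 1) * (real m * a))"
    unfolding ind neg using kaiser_bessel_hat_tail(2)[OF assms] by simp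
qed

lemma integrable_kaiser_bessel_hat:
  assumes m: "0 < m" and \<beta>: "0 < \<beta>" and I0: "1 < bessel_I0 \<beta>"
  shows "integrable lborel (kaiser_bessel_hat m \<beta>)"
proof -
  define a where "a = \<beta> / real m"
  have a: "\<beta> \<le> real m * a" using m by (simp add: a_def)
  have int: "integrable lborel (\<lambda>\<tau>. \<bar>kaiser_bessel_hat m \<beta> \<tau> * indicator {- a..a} \<tau>\<bar>
      + \<bar>kaiser_bessel_hat m \<beta> \<tau> * indicator {a..} \<tau>\<bar> + \<bar>kaiser_bessel_hat m \<beta> \<tau> * indicator {..- a} \<tau>\<bar>)"
    by (intro Bochner_Integration.integrable_add integrable_abs integrable_on_interval' continuous_on_kaiser_bessel_hat
        kaiser_bessel_hat_tail(1)[OF assms a] kaiser_bessel_hat_tail_reflected(1)[OF assms a])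
  show ?thesis
  proof (rule Bochner_Integration.integrable_bound[OF int])
    show "AE \<tau> in lborel. norm (kaiser_bessel_hat m \<beta> \<tau>) \<le> norm (\<bar>kaiser_bessel_hat m \<beta> \<tau> * indicator {- a..a} \<tau>\<bar>
      + \<bar>kaiser_bessel_hat m \<beta> \<tau> * indicator {a..} \<tau>\<bar> + \<bar>kaiser_bessel_hat m \<beta> \<tau> * indicator {..- a} \<tau>\<bar>)"
    proof (rule AE_I2)
      fix \<tau>
      consider "\<tau> \<in> {- a..a}" | "\<tau> \<in> {a..}" | "\<tau> \<in> {..- a}" by fastforce
      then show "norm (kaiser_bessel_hat m \<beta> \<tau>) \<le> norm (\<bar>kaiser_bessel_hat m \<beta> \<tau> * indicator {- a..a} \<tau>\<bar>
          + \<bar>kaiser_bessel_hat m \<beta> \<tau> * indicator {a..} \<tau>\<bar> + \<bar>kaiser_bessel_hat m \<beta> \<tau> * indicator {..- a} \<tau>\<bar>)"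
        by cases (simp_all add: abs_mult)
    qed
  qed measurable
qed

text \<open>
  The window is continuous, and its transform is integrable by the quadratic decay.
\<close>
lemma cKB_window_inversion:
  assumes m: "0 < m" and \<beta>: "0 < \<beta>" and I0: "1 < bessel_I0 \<beta>"
  shows "complex_of_real (cKB_window m \<beta> x) = (LINT \<tau>|lborel. of_real (kaiser_bessel_hat m \<beta> \<tau>) * iexp (x * \<tau>))"
proof -
  let ?f = "\<lambda>x. complex_of_real (cKB_window m \<beta> x)"
  let ?g = "\<lambda>\<tau>. complex_of_real (sqrt (2 * pi) * kaiser_bessel_hat m \<beta> \<tau>)"
  have g: "fourier_integral ?f = ?g" using cKB_window_fourier[OF m] by (simp add: fun_eq_iff)
  have f: "?f \<in> L1_space" "?f \<in> L2_space" using cKB_window_integrable_L2[OF m] by auto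
  have int: "integrable lborel ?g"
    by (intro integrable_of_real integrable_mult_right integrable_kaiser_bessel_hat assms)
  have g2: "?g \<in> L2_space"
    by (rule L2_bounded_integrable[OF int, where C="LINT s|lborel. cmod (?f s)"])
       (subst cKB_window_fourier[OF m, symmetric], rule fourier_integral_bound, use f(1) in \<open>simp add: L1_space_def\<close>)
  have "has_L2_fourier ?f ?g"
    unfolding has_L2_fourier_def using f g g2
    by (intro conjI exI[of _ "\<lambda>n. ?f"]) (auto simp: L2_norm_def)
  moreover have "isCont ?f x"
    using continuous_on_cKB_window[OF m, of UNIV \<beta>]
    by (auto simp: continuous_on_eq_continuous_at intro!: isCont_o2[of x "cKB_window m \<beta>" of_real])
  ultimately have "?f x = complex_of_real (1 / sqrt (2 * pi)) * (LINT \<tau>|lborel. ?g \<tau> * iexp (x * \<tau>))"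
    using int by (intro L2_fourier_inversion)
  also have "(LINT \<tau>|lborel. ?g \<tau> * iexp (x * \<tau>))
     = of_real (sqrt (2 * pi)) * (LINT \<tau>|lborel. of_real (kaiser_bessel_hat m \<beta> \<tau>) * iexp (x * \<tau>))"
    unfolding of_real_mult mult.assoc by (rule integral_mult_right_zero)
  finally show ?thesis by (simp only: mult.assoc[symmetric] of_real_mult[symmetric]) simp
qed

lemma kaiser_bessel_hat_outside:
  assumes m: "0 < m" and \<beta>: "0 < \<beta>" and I0: "1 < bessel_I0 \<beta>"
    and up: "\<beta> \<le> real m * (pi + \<omega>)" and lo: "\<beta> \<le> real m * (pi - \<omega>)"
  shows "(LINT \<tau>|lborel. \<bar>kaiser_bessel_hat m \<beta> \<tau>\<bar> * indicator (- {\<omega> - pi<..<\<omega> + pi}) \<tau>)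
     \<le> 4 * \<beta>\<^sup>2 / (3 * pi * (bessel_I0 \<beta> - 1) * real m) * (1 / (pi + \<omega>) + 1 / (pi - \<omega>))"
proof -
  have ind: "\<bar>kaiser_bessel_hat m \<beta> \<tau>\<bar> * indicator (- {\<omega> - pi<..<\<omega> + pi}) \<tau>
     = \<bar>kaiser_bessel_hat m \<beta> \<tau>\<bar> * indicator {pi + \<omega>..} \<tau> + \<bar>kaiser_bessel_hat m \<beta> \<tau>\<bar> * indicator {..- (pi - \<omega>)} \<tau>" for \<tau>
  proof -
    consider "pi + \<omega> \<le> \<tau>" "\<not> \<tau> \<le> \<omega> - pi" | "\<tau> \<le> \<omega> - pi" "\<not> pi + \<omega> \<le> \<tau>"
      | "\<omega> - pi < \<tau>" "\<tau> < \<omega> + pi"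
      using pi_gt_zero by linarith
    then show ?thesis by cases (simp_all add: indicator_def)
  qed
  have int: "integrable lborel (\<lambda>\<tau>. \<bar>kaiser_bessel_hat m \<beta> \<tau>\<bar> * indicator {pi + \<omega>..} \<tau>)"
    "integrable lborel (\<lambda>\<tau>. \<bar>kaiser_bessel_hat m \<beta> \<tau>\<bar> * indicator {..- (pi - \<omega>)} \<tau>)"
    using integrable_abs[OF kaiser_bessel_hat_tail(1)[OF m \<beta> I0 up]]
      integrable_abs[OF kaiser_bessel_hat_tail_reflected(1)[OF m \<beta> I0 lo]]
    by (simp_all add: abs_mult)
  have "(LINT \<tau>|lborel. \<bar>kaiser_bessel_hat m \<beta> \<tau>\<bar> * indicator (- {\<omega> - pi<..<\<omega> + pi}) \<tau>)
    = (LINT \<tau>|lborel. \<bar>kaiser_bessel_hat m \<beta> \<tau>\<bar> * indicator {pi + \<omega>..} \<tau>)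
     + (LINT \<tau>|lborel. \<bar>kaiser_bessel_hat m \<beta> \<tau>\<bar> * indicator {..- (pi - \<omega>)} \<tau>)"
    unfolding ind using int by (rule Bochner_Integration.integral_add)
  also have "\<dots> \<le> 4 * \<beta>\<^sup>2 / (3 * pi * (bessel_I0 \<beta> - 1) * (real m * (pi + \<omega>)))
     + 4 * \<beta>\<^sup>2 / (3 * pi * (bessel_I0 \<beta> - 1) * (real m * (pi - \<omega>)))"
    by (intro add_mono kaiser_bessel_hat_tail(2) kaiser_bessel_hat_tail_reflected(2) assms)
  also have "\<dots> = 4 * \<beta>\<^sup>2 / (3 * pi * (bessel_I0 \<beta> - 1) * real m) * (1 / (pi + \<omega>) + 1 / (pi - \<omega>))"
    by (simp only: distrib_left times_divide_eq_right mult_1_right divide_divide_eq_left mult.assoc)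
  finally show ?thesis .
qed

section \<open>A lower bound for the Bessel function\<close>

text \<open>
  With \<open>exp 3 \<ge> 20\<close> the exponential is at least \<open>20 * (x - 2)\<close> for \<open>x \<ge> 3\<close>. Replacing \<open>pi\<close> by 3 in the
  fraction then leaves a quadratic inequality that holds from \<open>x = 3\<close> on.
\<close>
lemma exp_growth_bound:
  assumes "pi \<le> (x::real)"
  shows "16 / 21 * exp x * x / (x + pi / 8) \<le> exp x - exp (- x) - 2 * x"
proof -
  have x3: "3 \<le> x" using assms pi_gt3 by simp
  have "exp x = exp 3 * exp (x - 3)" by (simp flip: exp_add)
  also have "\<dots> \<ge> 20 * (1 + (x - 3))"
  proof (rule mult_mono)
    have "(\<Sum>k<9. (3::real) ^ k / fact k) \<le> exp 3"
      using sum_le_suminf[OF summable_exp_generic[of "3::real"], of "{..<9}"] 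
      by (simp add: exp_def scaleR_conv_of_real divide_inverse mult.commute)
    then show "20 \<le> exp (3::real)" by (simp add: lessThan_nat_numeral fact_numeral)
  qed (use x3 exp_ge_add_one_self[of "x - 3"] in auto)
  finally have big: "20 * (x - 2) \<le> exp x" by simp
  have small: "exp (- x) \<le> 1 / 20"
    using big x3 by (simp add: exp_minus field_simps)
  have pi8: "3 / 8 \<le> pi / 8" using pi_gt3 by simp
  have frac: "x / (x + pi / 8) \<le> x / (x + 3 / 8)"
    using pi8 x3 by (intro divide_left_mono) auto
  have "(2 * x + 1 / 20) * (168 * x + 63) \<le> 20 * (x - 2) * (40 * x + 63)"
  proof -
    have "0 \<le> (x - 3) * (x - 3)" "0 \<le> x - 3" using x3 by auto
    then show ?thesis by (simp add: algebra_simps)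
  qed
  also have "\<dots> \<le> exp x * (40 * x + 63)" using big x3 by (intro mult_right_mono) auto
  finally have "2 * x + 1 / 20 \<le> exp x * ((40 * x + 63) / (168 * x + 63))"
    using x3 by (simp add: field_simps)
  also have "(40 * x + 63) / (168 * x + 63) = 1 - 16 / 21 * (x / (x + 3 / 8))"
    using x3 by (simp add: field_simps)
  finally have "2 * x + 1 / 20 \<le> exp x * (1 - 16 / 21 * (x / (x + 3 / 8)))" by simp
  also have "\<dots> \<le> exp x * (1 - 16 / 21 * (x / (x + pi / 8)))"
    by (rule mult_left_mono[OF diff_left_mono[OF mult_left_mono[OF frac]]]) auto
  finally show ?thesis using small by (simp add: algebra_simps)
qed

text \<open>
  The left-hand side is the constant for which the error bound \<open>8 * \<beta> / (3 * pi * (bessel_I0 \<beta> - 1))\<close>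
  becomes exactly \<open>(7 / 8 * \<beta> + 7 / pi * \<beta>\<^sup>2) * exp (- \<beta>)\<close>.
\<close>
lemma bessel_I0_lower_bound:
  assumes "pi \<le> \<beta>"
  shows "8 / 21 * exp \<beta> / (\<beta> + pi / 8) \<le> bessel_I0 \<beta> - 1"
proof -
  have b: "0 < \<beta>" using assms pi_gt_zero by linarith
  have "8 / 21 * exp \<beta> / (\<beta> + pi / 8) = (16 / 21 * exp \<beta> * \<beta> / (\<beta> + pi / 8)) / (2 * \<beta>)"
  proof -
    have "8 / 21 * e / c = (16 / 21 * e * \<beta> / c) / (2 * \<beta>)" for e c :: real
      using b by (simp add: field_simps)
    then show ?thesis .
  qed
  also have "\<dots> \<le> (exp \<beta> - exp (- \<beta>) - 2 * \<beta>) / (2 * \<beta>)"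
    using b exp_growth_bound[OF assms] by (intro divide_right_mono) auto
  also have "\<dots> = sinh \<beta> / \<beta> - 1"
    using b by (simp add: sinh_field_def field_simps)
  also have "\<dots> \<le> bessel_I0 \<beta> - 1"
    using bessel_I0_ge_shc[of \<beta>] b by (simp add: shc_square)
  finally show ?thesis .
qed

section \<open>Fejer means of the cardinal series\<close>

lemma iexp_integral_period:
  "(LINT \<eta>|lborel. indicator {\<nu> - pi..\<nu> + pi} \<eta> *\<^sub>R iexp (\<eta> * x))
     = of_real (2 * pi) * (iexp (\<nu> * x) * of_real (cardinal_sine x))"
proof (cases "x = 0")
  case True
  then show ?thesis by (simp add: cardinal_sine_def scaleR_conv_of_real)
next
  case False
  have "(LINT \<eta>|lborel. indicator {\<nu> - pi..\<nu> + pi} \<eta> *\<^sub>R iexp (\<eta> * x))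
     = iexp ((\<nu> + pi) * x) / (\<i> * of_real x) - iexp ((\<nu> - pi) * x) / (\<i> * of_real x)"
  proof (rule integral_FTC_atLeastAtMost)
    show "\<nu> - pi \<le> \<nu> + pi" by simp
    fix \<eta> :: real
    have "((\<lambda>z. exp (\<i> * (z * of_real x)) / (\<i> * of_real x)) has_field_derivative exp (\<i> * (of_real \<eta> * of_real x)))
        (at (complex_of_real \<eta>))"
      using False by (auto intro!: derivative_eq_intros) (simp add: complex_eq_iff)
    from has_vector_derivative_real_field[OF this]
    show "((\<lambda>\<eta>. iexp (\<eta> * x) / (\<i> * of_real x)) has_vector_derivative iexp (\<eta> * x)) (at \<eta> within {\<nu> - pi..\<nu> + pi})"
      by simp
  qed (intro continuous_intros)
  also have "\<dots> = iexp (\<nu> * x) * ((iexp (pi * x) - iexp (- (pi * x))) / (\<i> * of_real x))"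
  proof -
    have "iexp ((\<nu> + pi) * x) = iexp (\<nu> * x) * iexp (pi * x)"
      "iexp ((\<nu> - pi) * x) = iexp (\<nu> * x) * iexp (- (pi * x))"
      by (simp_all add: algebra_simps flip: exp_add)
    then show ?thesis by (simp only: right_diff_distrib diff_divide_distrib times_divide_eq_right)
  qed
  also have "iexp (pi * x) - iexp (- (pi * x)) = 2 * \<i> * of_real (sin (pi * x))"
    unfolding cis_conv_exp[symmetric] by (simp add: complex_eq_iff)
  also have "2 * \<i> * of_real (sin (pi * x)) / (\<i> * of_real x) = of_real (2 * pi) * of_real (cardinal_sine x)"
    using False by (simp add: cardinal_sine_def)
  finally show ?thesis by (simp add: mult_ac)
qed

lemma cardinal_sine_int:
  "cardinal_sine (real_of_int k) = (if k = 0 then 1 else 0)"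
  using sin_integer_2pi[of "of_int k / 2"] sin_zero_iff_int2[of "pi * real_of_int k"]
  by (auto simp: cardinal_sine_def mult.commute)

definition fejer :: "nat \<Rightarrow> real \<Rightarrow> real" where
  "fejer N \<eta> = (cmod (\<Sum>j<N. iexp (real j * \<eta>)))\<^sup>2 / real N"

text \<open>
  The Cesaro means of the series of \<open>iexp (\<nu> * (t + k)) * cardinal_sine (t + k)\<close> over the integers \<open>k\<close>.
  Summing over pairs of indices with difference \<open>k\<close> produces the Fejer weights and exhibits
  the mean as an average against the square of a Dirichlet sum.
\<close>
definition fejer_cardinal :: "nat \<Rightarrow> real \<Rightarrow> real \<Rightarrow> complex" where
  "fejer_cardinal N t \<nu> = (\<Sum>j<N. \<Sum>l<N. iexp (\<nu> * (t + of_int (int j - int l))) *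
      of_real (cardinal_sine (t + of_int (int j - int l)))) / of_nat N"

lemma fejer_nonneg: "0 \<le> fejer N \<eta>"
  by (simp add: fejer_def)

lemma continuous_on_fejer: "continuous_on S (fejer N)"
  unfolding fejer_def[abs_def] divide_inverse by (intro continuous_intros)

lemma fejer_expand:
  "complex_of_real (fejer N \<eta>) = (\<Sum>j<N. \<Sum>l<N. iexp (\<eta> * of_int (int j - int l))) / of_nat N"
proof -
  have "complex_of_real ((cmod (\<Sum>j<N. iexp (real j * \<eta>)))\<^sup>2)
      = (\<Sum>j<N. iexp (real j * \<eta>)) * cnj (\<Sum>l<N. iexp (real l * \<eta>))"
    by (rule complex_norm_square)
  also have "\<dots> = (\<Sum>j<N. \<Sum>l<N. iexp (real j * \<eta>) * cnj (iexp (real l * \<eta>)))"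
    by (simp add: sum_product)
  also have "\<dots> = (\<Sum>j<N. \<Sum>l<N. iexp (\<eta> * of_int (int j - int l)))"
    by (intro sum.cong refl) (simp add: exp_cnj algebra_simps flip: exp_add)
  finally show ?thesis by (simp add: fejer_def)
qed

text \<open>
  Multiplication by \<open>1 - iexp \<eta>\<close> telescopes the geometric sum, so away from the multiples of
  \<open>2 * pi\<close> the kernel is of order \<open>1 / N\<close>.
\<close>
lemma fejer_weighted_bound:
  assumes "0 < N"
  shows "fejer N \<eta> * (cmod (1 - iexp \<eta>))\<^sup>2 \<le> 4 / real N"
proof -
  have "(\<Sum>j<N. iexp (real j * \<eta>)) = (\<Sum>j<N. iexp \<eta> ^ j)"
    by (intro sum.cong refl) (simp add: exp_of_nat_mult[symmetric] mult_ac)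
  then have "(1 - iexp \<eta>) * (\<Sum>j<N. iexp (real j * \<eta>)) = 1 - iexp \<eta> ^ N"
    by (simp only: one_diff_power_eq)
  then have "cmod (1 - iexp \<eta>) * cmod (\<Sum>j<N. iexp (real j * \<eta>)) = cmod (1 - iexp \<eta> ^ N)"
    by (metis norm_mult)
  also have "\<dots> \<le> 2"
    using norm_triangle_ineq4[of 1 "iexp \<eta> ^ N"] by (simp add: norm_power)
  finally have "(cmod (1 - iexp \<eta>) * cmod (\<Sum>j<N. iexp (real j * \<eta>)))\<^sup>2 \<le> 2\<^sup>2"
    by (intro power_mono) auto
  then show ?thesis
    using assms by (simp add: fejer_def power_mult_distrib divide_right_mono mult.commute)
qed

text \<open>
  The cardinal sine is the average of exponentials over one period; interchanging this average
  with the finite sums leaves the Fejer kernel.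
\<close>
lemma fejer_cardinal_integral:
  "fejer_cardinal N t \<nu> = (LINT \<eta>|lborel. indicator {\<nu> - pi..\<nu> + pi} \<eta> *\<^sub>R
      (iexp (\<eta> * t) * of_real (fejer N \<eta>))) / of_real (2 * pi)"
proof -
  have int: "integrable lborel (\<lambda>\<eta>. indicator {\<nu> - pi..\<nu> + pi} \<eta> *\<^sub>R iexp (\<eta> * x))" for x
    by (intro integrable_on_interval continuous_intros)
  have "indicator {\<nu> - pi..\<nu> + pi} \<eta> *\<^sub>R (iexp (\<eta> * t) * of_real (fejer N \<eta>))
     = (\<Sum>j<N. \<Sum>l<N. indicator {\<nu> - pi..\<nu> + pi} \<eta> *\<^sub>R iexp (\<eta> * (t + of_int (int j - int l)))) / of_nat N" for \<eta>
    unfolding fejer_expand times_divide_eq_right sum_distrib_left scaleR_conv_of_real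
    by (simp only: distrib_left of_real_add exp_add)
  then have "(LINT \<eta>|lborel. indicator {\<nu> - pi..\<nu> + pi} \<eta> *\<^sub>R (iexp (\<eta> * t) * of_real (fejer N \<eta>)))
     = (\<Sum>j<N. \<Sum>l<N. (LINT \<eta>|lborel. indicator {\<nu> - pi..\<nu> + pi} \<eta> *\<^sub>R iexp (\<eta> * (t + of_int (int j - int l))))) / of_nat N"
    using int by (simp only: integral_divide_zero Bochner_Integration.integral_sum Bochner_Integration.integrable_sum)
  also have "\<dots> = of_real (2 * pi) * fejer_cardinal N t \<nu>"
    unfolding iexp_integral_period fejer_cardinal_def by (simp only: sum_distrib_left times_divide_eq_right)
  finally show ?thesis by simp
qed

text \<open>
  At \<open>t = 0\<close> the cardinal sine is sampled at integers, so only the diagonal contributes. Together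
  with \<open>fejer_cardinal_integral\<close> this yields the total mass of the Fejer kernel without computing it.
\<close>
lemma fejer_cardinal_zero:
  assumes "0 < N"
  shows "fejer_cardinal N 0 \<nu> = 1"
proof -
  have "(\<Sum>l<N. iexp (\<nu> * (0 + of_int (int j - int l))) * of_real (cardinal_sine (0 + of_int (int j - int l)))) = 1"
    if "j < N" for j
  proof -
    have "(\<Sum>l<N. iexp (\<nu> * (0 + of_int (int j - int l))) * of_real (cardinal_sine (0 + of_int (int j - int l))))
       = (\<Sum>l<N. if j = l then 1 else 0)"
      by (intro sum.cong refl) (auto simp only: add_0 cardinal_sine_int, auto)
    then show ?thesis using that by simp
  qed
  then show ?thesis using assms by (simp add: fejer_cardinal_def)
qed

lemma fejer_integral:
  assumes "0 < N"
  shows "(LINT \<eta>|lborel. indicator {\<nu> - pi..\<nu> + pi} \<eta> * fejer N \<eta>) = 2 * pi"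
proof -
  have "complex_of_real ((LINT \<eta>|lborel. indicator {\<nu> - pi..\<nu> + pi} \<eta> * fejer N \<eta>)) =
     (LINT \<eta>|lborel. indicator {\<nu> - pi..\<nu> + pi} \<eta> *\<^sub>R (iexp (\<eta> * 0) * of_real (fejer N \<eta>)))"
    unfolding integral_complex_of_real[symmetric] by (simp add: scaleR_conv_of_real)
  also have "\<dots> = of_real (2 * pi)"
    using fejer_cardinal_zero[OF assms, of \<nu>] fejer_cardinal_integral[of N 0 \<nu>] by simp
  finally show ?thesis by (simp only: of_real_eq_iff)
qed

lemma fejer_weighted_integral_norm_le:
  "cmod (LINT \<eta>|lborel. indicator {\<nu> - pi..\<nu> + pi} \<eta> *\<^sub>R (h \<eta> * of_real (fejer N \<eta>)))
     \<le> (LINT \<eta>|lborel. cmod (h \<eta>) * (indicator {\<nu> - pi..\<nu> + pi} \<eta> * fejer N \<eta>))"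
  by (rule order_trans[OF integral_norm_bound]) (simp add: norm_mult fejer_nonneg mult_ac)

text \<open>
  The Fejer kernel is nonnegative with mean one over a period.
\<close>
lemma fejer_cardinal_norm_le:
  assumes "0 < N"
  shows "cmod (fejer_cardinal N t \<nu>) \<le> 1"
proof -
  have "cmod (LINT \<eta>|lborel. indicator {\<nu> - pi..\<nu> + pi} \<eta> *\<^sub>R (iexp (\<eta> * t) * of_real (fejer N \<eta>))) \<le> 2 * pi"
    using fejer_weighted_integral_norm_le[of \<nu> "\<lambda>\<eta>. iexp (\<eta> * t)" N] fejer_integral[OF assms, of \<nu>]
    by (simp only: norm_exp_i_times mult_1_left)
  then show ?thesis
    unfolding fejer_cardinal_integral norm_divide by simp
qed

lemma norm_iexp_minus_one_sin: "cmod (1 - iexp \<eta>) = 2 * \<bar>sin (\<eta> / 2)\<bar>"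
proof -
  have "(cmod (1 - iexp \<eta>))\<^sup>2 = (1 - cos \<eta>)\<^sup>2 + (sin \<eta>)\<^sup>2"
    unfolding cis_conv_exp[symmetric] by (simp add: cmod_power2)
  also have "\<dots> = 2 * (1 - cos \<eta>)"
    using sin_cos_squared_add[of \<eta>] by (simp add: power2_diff algebra_simps)
  also have "\<dots> = (2 * \<bar>sin (\<eta> / 2)\<bar>)\<^sup>2"
    using cos_double_sin[of "\<eta> / 2"] by (simp add: power_mult_distrib)
  finally show ?thesis by (rule power2_eq_imp_eq) auto
qed

lemma norm_iexp_minus_one_le: "cmod (iexp x - 1) \<le> \<bar>x\<bar>"
  using norm_iexp_minus_one_sin[of x] abs_sin_x_le_abs_x[of "x / 2"] by (simp add: norm_minus_commute)

text \<open>
  For \<open>\<bar>\<nu>\<bar> < pi\<close> the only zero of \<open>1 - iexp \<eta>\<close> in the closed interval is \<open>\<eta> = 0\<close>, where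
  \<open>iexp (\<eta> * t) - 1\<close> vanishes as well; a lower bound for \<open>sin x / x\<close> with \<open>x = \<eta> / 2\<close> makes this quantitative.
\<close>
lemma iexp_comparison_on_period:
  assumes "\<bar>\<nu>\<bar> < pi"
  obtains C where "0 \<le> C"
    "\<And>\<eta>. \<eta> \<in> {\<nu> - pi..\<nu> + pi} \<Longrightarrow> cmod (iexp (\<eta> * t) - 1) \<le> C * cmod (1 - iexp \<eta>)"
proof -
  define b where "b = (pi + \<bar>\<nu>\<bar>) / 2"
  have b: "0 < b" "b < pi" using assms pi_gt_zero by (auto simp: b_def)
  have "\<exists>x\<in>{-b..b}. \<forall>y\<in>{-b..b}. shc (- x\<^sup>2) \<le> shc (- y\<^sup>2)"
    by (rule continuous_attains_inf) (use b in \<open>auto intro!: continuous_intros\<close>)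
  then obtain x where x: "x \<in> {-b..b}" "\<And>y. y \<in> {-b..b} \<Longrightarrow> shc (- x\<^sup>2) \<le> shc (- y\<^sup>2)" by blast
  define c where "c = shc (- x\<^sup>2)"
  have c: "0 < c"
  proof (cases "x = 0")
    case True
    then show ?thesis by (simp add: c_def)
  next
    case False
    have "0 < sin \<bar>x\<bar> / \<bar>x\<bar>" using False x(1) b by (intro divide_pos_pos sin_gt_zero) auto
    then show ?thesis using shc_neg_square[of "\<bar>x\<bar>"] False by (simp add: c_def)
  qed
  have "cmod (iexp (\<eta> * t) - 1) \<le> \<bar>t\<bar> / c * cmod (1 - iexp \<eta>)" if "\<eta> \<in> {\<nu> - pi..\<nu> + pi}" for \<eta>
  proof -
    have "2 * b = pi + \<bar>\<nu>\<bar>" by (simp add: b_def)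
    then have "- (2 * b) \<le> \<eta>" "\<eta> \<le> 2 * b" using that by auto
    then have "\<eta> / 2 \<in> {-b..b}" by auto
    then have "c \<le> shc (- (\<eta> / 2)\<^sup>2)" unfolding c_def by (rule x(2))
    then have "c * \<bar>\<eta> / 2\<bar> \<le> shc (- (\<eta> / 2)\<^sup>2) * \<bar>\<eta> / 2\<bar>" by (rule mult_right_mono) simp
    also have "\<dots> \<le> \<bar>sin (\<eta> / 2)\<bar>"
      by (cases "\<eta> = 0") (use shc_neg_square[of "\<eta> / 2"] abs_ge_self[of "shc (- (\<eta> / 2)\<^sup>2) * \<bar>\<eta> / 2\<bar>"] in \<open>auto simp: abs_mult\<close>)
    finally have "\<bar>\<eta>\<bar> \<le> cmod (1 - iexp \<eta>) / c"
      using c unfolding norm_iexp_minus_one_sin by (simp add: field_simps)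
    then have "\<bar>\<eta>\<bar> * \<bar>t\<bar> \<le> cmod (1 - iexp \<eta>) / c * \<bar>t\<bar>" by (rule mult_right_mono) simp
    moreover have "cmod (iexp (\<eta> * t) - 1) \<le> \<bar>\<eta>\<bar> * \<bar>t\<bar>"
      using norm_iexp_minus_one_le[of "\<eta> * t"] by (simp only: abs_mult)
    moreover have "cmod (1 - iexp \<eta>) / c * \<bar>t\<bar> = \<bar>t\<bar> / c * cmod (1 - iexp \<eta>)" by simp
    ultimately show ?thesis by (metis order_trans)
  qed
  then show thesis using that[of "\<bar>t\<bar> / c"] c by auto
qed

text \<open>
  The shifted cardinal series of an exponential of frequency below \<open>pi\<close> has sum one. The deviation
  \<open>d = cmod (iexp (\<eta> * t) - 1)\<close> satisfies \<open>d \<le> r + d\<^sup>2 / (4 * r)\<close>, and the kernel times \<open>d\<^sup>2\<close>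
  is of order \<open>1 / N\<close>, so no splitting of the interval is needed.
\<close>
lemma fejer_cardinal_tendsto:
  assumes "\<bar>\<nu>\<bar> < pi"
  shows "(\<lambda>N. fejer_cardinal N t \<nu>) \<longlonglongrightarrow> 1"
proof (rule LIMSEQ_I)
  fix e :: real assume e: "0 < e"
  obtain C where C: "0 \<le> C"
    "\<And>\<eta>. \<eta> \<in> {\<nu> - pi..\<nu> + pi} \<Longrightarrow> cmod (iexp (\<eta> * t) - 1) \<le> C * cmod (1 - iexp \<eta>)"
    using iexp_comparison_on_period[OF assms] by blast
  define r where "r = e / 2"
  have r: "0 < r" using e by (simp add: r_def)
  obtain M :: nat where M: "C\<^sup>2 / (r * r) < real M" using reals_Archimedean2 by blast
  show "\<exists>no. \<forall>N\<ge>no. norm (fejer_cardinal N t \<nu> - 1) < e"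
  proof (intro exI allI impI)
    fix N assume N: "Suc M \<le> N"
    then have N0: "0 < N" by simp
    have int: "integrable lborel (\<lambda>\<eta>. indicator {\<nu> - pi..\<nu> + pi} \<eta> *\<^sub>R (iexp (\<eta> * x) * of_real (fejer N \<eta>)))" for x
      by (intro integrable_on_interval continuous_intros continuous_on_fejer)
    have intf: "integrable lborel (\<lambda>\<eta>. indicator {\<nu> - pi..\<nu> + pi} \<eta> * fejer N \<eta>)"
      using integrable_on_interval[OF continuous_on_fejer] by simp
    have "fejer_cardinal N t \<nu> - 1 = fejer_cardinal N t \<nu> - fejer_cardinal N 0 \<nu>"
      using fejer_cardinal_zero[OF N0] by simp
    also have "\<dots> = (LINT \<eta>|lborel. indicator {\<nu> - pi..\<nu> + pi} \<eta> *\<^sub>R ((iexp (\<eta> * t) - 1) * of_real (fejer N \<eta>))) / of_real (2 * pi)"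
    proof -
      have "indicator {\<nu> - pi..\<nu> + pi} \<eta> *\<^sub>R ((iexp (\<eta> * t) - 1) * of_real (fejer N \<eta>))
        = indicator {\<nu> - pi..\<nu> + pi} \<eta> *\<^sub>R (iexp (\<eta> * t) * of_real (fejer N \<eta>))
         - indicator {\<nu> - pi..\<nu> + pi} \<eta> *\<^sub>R (iexp (\<eta> * 0) * of_real (fejer N \<eta>))" for \<eta>
        by (simp add: algebra_simps)
      then show ?thesis
        unfolding fejer_cardinal_integral diff_divide_distrib[symmetric]
        by (simp only: Bochner_Integration.integral_diff[OF int int])
    qed
    finally have "cmod (fejer_cardinal N t \<nu> - 1)
       = cmod (LINT \<eta>|lborel. indicator {\<nu> - pi..\<nu> + pi} \<eta> *\<^sub>R ((iexp (\<eta> * t) - 1) * of_real (fejer N \<eta>))) / (2 * pi)"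
      by (simp add: norm_divide)
    also have "\<dots> \<le> (LINT \<eta>|lborel. cmod (iexp (\<eta> * t) - 1) * (indicator {\<nu> - pi..\<nu> + pi} \<eta> * fejer N \<eta>)) / (2 * pi)"
      by (intro divide_right_mono fejer_weighted_integral_norm_le) simp
    also have "\<dots> \<le> (LINT \<eta>|lborel. r * (indicator {\<nu> - pi..\<nu> + pi} \<eta> * fejer N \<eta>)
         + C\<^sup>2 / (r * real N) * indicator {\<nu> - pi..\<nu> + pi} \<eta>) / (2 * pi)"
    proof (intro divide_right_mono integral_mono)
      show "integrable lborel (\<lambda>\<eta>. cmod (iexp (\<eta> * t) - 1) * (indicator {\<nu> - pi..\<nu> + pi} \<eta> * fejer N \<eta>))"
      proof -
        have "integrable lborel (\<lambda>\<eta>. indicator {\<nu> - pi..\<nu> + pi} \<eta> *\<^sub>R (cmod (iexp (\<eta> * t) - 1) * fejer N \<eta>))"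
          by (intro integrable_on_interval continuous_intros continuous_on_fejer)
        then show ?thesis by (simp add: mult_ac)
      qed
      show "integrable lborel (\<lambda>\<eta>. r * (indicator {\<nu> - pi..\<nu> + pi} \<eta> * fejer N \<eta>)
         + C\<^sup>2 / (r * real N) * indicator {\<nu> - pi..\<nu> + pi} \<eta>)"
        using intf by (intro Bochner_Integration.integrable_add integrable_mult_right) auto
      fix \<eta>
      show "cmod (iexp (\<eta> * t) - 1) * (indicator {\<nu> - pi..\<nu> + pi} \<eta> * fejer N \<eta>)
        \<le> r * (indicator {\<nu> - pi..\<nu> + pi} \<eta> * fejer N \<eta>) + C\<^sup>2 / (r * real N) * indicator {\<nu> - pi..\<nu> + pi} \<eta>"
      proof (cases "\<eta> \<in> {\<nu> - pi..\<nu> + pi}")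
        case True
        define d where "d = cmod (iexp (\<eta> * t) - 1)"
        \<comment> \<open>Young's inequality for \<open>d\<close> and \<open>2 * r\<close>.\<close>
        have "0 \<le> (d - 2 * r)\<^sup>2" by simp
        then have "d * (4 * r) \<le> 4 * r * r + d\<^sup>2" by (simp add: power2_eq_square algebra_simps)
        then have "d \<le> r + d\<^sup>2 / (4 * r)" using r by (simp add: field_simps)
        then have "d * fejer N \<eta> \<le> (r + d\<^sup>2 / (4 * r)) * fejer N \<eta>"
          by (rule mult_right_mono) (rule fejer_nonneg)
        also have "\<dots> = r * fejer N \<eta> + (d\<^sup>2 * fejer N \<eta>) / (4 * r)" by (simp add: algebra_simps)
        also have "d\<^sup>2 * fejer N \<eta> \<le> (C * cmod (1 - iexp \<eta>))\<^sup>2 * fejer N \<eta>"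
          unfolding d_def by (intro mult_right_mono power_mono C(2)[OF True] fejer_nonneg) simp
        also have "\<dots> = C\<^sup>2 * (fejer N \<eta> * (cmod (1 - iexp \<eta>))\<^sup>2)" by (simp add: power_mult_distrib mult_ac)
        also have "\<dots> \<le> C\<^sup>2 * (4 / real N)"
          by (intro mult_left_mono fejer_weighted_bound N0) simp
        finally have "d * fejer N \<eta> \<le> r * fejer N \<eta> + C\<^sup>2 * (4 / real N) / (4 * r)"
          using r by (simp add: divide_right_mono)
        also have "C\<^sup>2 * (4 / real N) / (4 * r) = C\<^sup>2 / (r * real N)" by simp
        finally show ?thesis using True by (simp add: d_def)
      qed simp
    qed simp
    also have "(LINT \<eta>|lborel. r * (indicator {\<nu> - pi..\<nu> + pi} \<eta> * fejer N \<eta>)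
         + C\<^sup>2 / (r * real N) * indicator {\<nu> - pi..\<nu> + pi} \<eta>) = (r + C\<^sup>2 / (r * real N)) * (2 * pi)"
      using intf fejer_integral[OF N0, of \<nu>]
      by (subst Bochner_Integration.integral_add) (auto simp: algebra_simps)
    also have "(r + C\<^sup>2 / (r * real N)) * (2 * pi) / (2 * pi) = r + C\<^sup>2 / (r * real N)" by simp
    also have "\<dots> < r + r"
    proof -
      have "C\<^sup>2 / (r * r) < real N" using M N by linarith
      then have "C\<^sup>2 / (r * real N) < r" using r N0 by (simp add: field_simps)
      then show ?thesis by simp
    qed
    finally show "norm (fejer_cardinal N t \<nu> - 1) < e" by (simp add: r_def)
  qed
qed

section \<open>The regularized series of an exponential\<close>

lemma card_difference_pairs:
  "card {(j, l). j < N \<and> l < N \<and> int j - int l = k} = N - nat \<bar>k\<bar>"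
proof (cases "0 \<le> k")
  case True
  have "{(j, l). j < N \<and> l < N \<and> int j - int l = k} = (\<lambda>l. (l + nat k, l)) ` {..<N - nat k}"
    using True by (auto simp: image_iff)
  then show ?thesis using True by (simp add: card_image inj_on_def)
next
  case False
  have "{(j, l). j < N \<and> l < N \<and> int j - int l = k} = (\<lambda>j. (j, j + nat (- k))) ` {..<N - nat (- k)}"
    using False by (auto simp: image_iff)
  then show ?thesis using False by (simp add: card_image inj_on_def)
qed

text \<open>
  The difference \<open>\<kappa>\<close> occurs \<open>N - \<bar>\<kappa>\<bar>\<close> times among the pairs of indices below \<open>N\<close>.
\<close>
lemma difference_average_tendsto:
  fixes a :: "int \<Rightarrow> complex"
  assumes S: "finite S" and a: "\<And>\<kappa>. \<kappa> \<notin> S \<Longrightarrow> a \<kappa> = 0"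
  shows "(\<lambda>N. (\<Sum>j<N. \<Sum>l<N. a (int j - int l)) / of_nat N) \<longlonglongrightarrow> (\<Sum>\<kappa>\<in>S. a \<kappa>)"
proof -
  have eq: "(\<Sum>j<N. \<Sum>l<N. a (int j - int l)) / of_nat N = (\<Sum>\<kappa>\<in>S. of_real (real (N - nat \<bar>\<kappa>\<bar>) / real N) * a \<kappa>)" for N
  proof -
    have "(\<Sum>j<N. \<Sum>l<N. a (int j - int l)) = (\<Sum>p\<in>{..<N} \<times> {..<N}. a (int (fst p) - int (snd p)))"
      by (simp add: sum.cartesian_product case_prod_unfold)
    also have "\<dots> = (\<Sum>p\<in>{..<N} \<times> {..<N}. \<Sum>\<kappa>\<in>S. if int (fst p) - int (snd p) = \<kappa> then a \<kappa> else 0)"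
      using S a by (intro sum.cong refl) auto
    also have "\<dots> = (\<Sum>\<kappa>\<in>S. \<Sum>p\<in>{..<N} \<times> {..<N}. if int (fst p) - int (snd p) = \<kappa> then a \<kappa> else 0)"
      by (rule sum.swap)
    also have "\<dots> = (\<Sum>\<kappa>\<in>S. of_nat (N - nat \<bar>\<kappa>\<bar>) * a \<kappa>)"
    proof (rule sum.cong[OF refl])
      fix \<kappa>
      have "{p \<in> {..<N} \<times> {..<N}. int (fst p) - int (snd p) = \<kappa>} = {(j, l). j < N \<and> l < N \<and> int j - int l = \<kappa>}"
        by auto
      then show "(\<Sum>p\<in>{..<N} \<times> {..<N}. if int (fst p) - int (snd p) = \<kappa> then a \<kappa> else 0) = of_nat (N - nat \<bar>\<kappa>\<bar>) * a \<kappa>"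
        by (subst sum.inter_filter[symmetric]) (simp_all add: card_difference_pairs)
    qed
    finally show ?thesis by (simp add: sum_divide_distrib)
  qed
  have "(\<lambda>N. real (N - nat \<bar>\<kappa>\<bar>) / real N) \<longlonglongrightarrow> 1" for \<kappa> :: int
  proof (rule Lim_transform_eventually)
    show "(\<lambda>N. 1 - real (nat \<bar>\<kappa>\<bar>) / real N) \<longlonglongrightarrow> 1" by real_asymp
    show "\<forall>\<^sub>F N in sequentially. 1 - real (nat \<bar>\<kappa>\<bar>) / real N = real (N - nat \<bar>\<kappa>\<bar>) / real N"
      using eventually_gt_at_top[of "nat \<bar>\<kappa>\<bar>"] by eventually_elim (simp add: of_nat_diff field_simps)
  qed
  then have "(\<lambda>N. \<Sum>\<kappa>\<in>S. of_real (real (N - nat \<bar>\<kappa>\<bar>) / real N) * a \<kappa>) \<longlonglongrightarrow> (\<Sum>\<kappa>\<in>S. of_real 1 * a \<kappa>)"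
    by (intro tendsto_intros tendsto_of_real)
  then show ?thesis by (simp only: eq of_real_1 mult_1_left)
qed

text \<open>
  Insert the inversion formula for the window into the sum:
  its Cesaro mean becomes the integral of \<open>\<Phi> \<tau>\<close> against \<open>fejer_cardinal N t (\<tau> - \<omega>)\<close>, while
  \<open>\<phi> 0\<close> is the integral of \<open>\<Phi>\<close>. The two kernels agree in the limit for \<open>\<bar>\<tau> - \<omega>\<bar> < pi\<close>, and they never
  differ by more than 2. The sum has only finitely many nonzero terms, so the Cesaro means
  converge to the sum itself.
\<close>
lemma regularized_sampling_defect:
  fixes \<Phi> \<phi> :: "real \<Rightarrow> real"
  assumes \<Phi>: "integrable lborel \<Phi>"
    and \<phi>: "\<And>x. complex_of_real (\<phi> x) = (LINT \<tau>|lborel. of_real (\<Phi> \<tau>) * iexp (x * \<tau>))"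
    and S: "finite S" "\<And>\<kappa>. \<kappa> \<notin> S \<Longrightarrow> \<phi> (t + of_int \<kappa>) = 0"
  shows "cmod (of_real (\<phi> 0) - (\<Sum>\<kappa>\<in>S. iexp (- (\<omega> * (t + of_int \<kappa>))) *
      of_real (cardinal_sine (t + of_int \<kappa>) * \<phi> (t + of_int \<kappa>))))
    \<le> 2 * (LINT \<tau>|lborel. \<bar>\<Phi> \<tau>\<bar> * indicator (- {\<omega> - pi<..<\<omega> + pi}) \<tau>)"
proof -
  define a where "a \<kappa> = iexp (- (\<omega> * (t + of_int \<kappa>))) *
      of_real (cardinal_sine (t + of_int \<kappa>) * \<phi> (t + of_int \<kappa>))" for \<kappa>
  define A where "A N = (\<Sum>j<N. \<Sum>l<N. a (int j - int l)) / of_nat N" for N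
  have A: "A \<longlonglongrightarrow> (\<Sum>\<kappa>\<in>S. a \<kappa>)"
    unfolding A_def[abs_def] by (rule difference_average_tendsto[OF S(1)]) (simp add: a_def S(2))
  have [measurable]: "\<Phi> \<in> borel_measurable borel" using \<Phi> by auto
  have [measurable]: "fejer_cardinal N t \<in> borel_measurable borel" for N
    unfolding fejer_cardinal_def[abs_def] by measurable
  have int: "integrable lborel (\<lambda>\<tau>. of_real (\<Phi> \<tau>) * iexp (x * \<tau>))" for x
    by (rule Bochner_Integration.integrable_bound[OF \<Phi>]) (auto simp: norm_mult)
  have a_int: "a \<kappa> = (LINT \<tau>|lborel. of_real (\<Phi> \<tau>) * (iexp ((\<tau> - \<omega>) * (t + of_int \<kappa>)) * of_real (cardinal_sine (t + of_int \<kappa>))))"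
    and a_integrable: "integrable lborel (\<lambda>\<tau>. of_real (\<Phi> \<tau>) * (iexp ((\<tau> - \<omega>) * (t + of_int \<kappa>)) * of_real (cardinal_sine (t + of_int \<kappa>))))"
    for \<kappa>
  proof -
    define x where "x = t + of_int \<kappa>"
    have eq: "of_real (\<Phi> \<tau>) * (iexp ((\<tau> - \<omega>) * x) * of_real (cardinal_sine x))
      = (iexp (- (\<omega> * x)) * of_real (cardinal_sine x)) * (of_real (\<Phi> \<tau>) * iexp (x * \<tau>))" for \<tau>
    proof -
      have "iexp ((\<tau> - \<omega>) * x) = iexp (- (\<omega> * x)) * iexp (x * \<tau>)"
        by (simp add: algebra_simps flip: exp_add)
      then show ?thesis by (simp only: mult_ac)
    qed
    show "integrable lborel (\<lambda>\<tau>. of_real (\<Phi> \<tau>) * (iexp ((\<tau> - \<omega>) * (t + of_int \<kappa>)) * of_real (cardinal_sine (t + of_int \<kappa>))))"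
      unfolding x_def[symmetric] eq by (intro integrable_mult_right int)
    show "a \<kappa> = (LINT \<tau>|lborel. of_real (\<Phi> \<tau>) * (iexp ((\<tau> - \<omega>) * (t + of_int \<kappa>)) * of_real (cardinal_sine (t + of_int \<kappa>))))"
      unfolding x_def[symmetric] eq integral_mult_right_zero \<phi>[symmetric]
      by (simp only: a_def x_def of_real_mult mult.assoc)
  qed
  have A_int: "A N = (LINT \<tau>|lborel. of_real (\<Phi> \<tau>) * fejer_cardinal N t (\<tau> - \<omega>))" for N
  proof -
    have "of_real (\<Phi> \<tau>) * fejer_cardinal N t (\<tau> - \<omega>)
      = (\<Sum>j<N. \<Sum>l<N. of_real (\<Phi> \<tau>) * (iexp ((\<tau> - \<omega>) * (t + of_int (int j - int l))) *
          of_real (cardinal_sine (t + of_int (int j - int l))))) / of_nat N" for \<tau>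
      unfolding fejer_cardinal_def by (simp only: sum_distrib_left times_divide_eq_right)
    then show ?thesis
      unfolding A_def a_int using a_integrable
      by (simp only: integral_divide_zero Bochner_Integration.integral_sum Bochner_Integration.integrable_sum)
  qed
  define T where "T = (LINT \<tau>|lborel. \<bar>\<Phi> \<tau>\<bar> * indicator (- {\<omega> - pi<..<\<omega> + pi}) \<tau>)"
  define E where "E N = (LINT \<tau>|lborel. \<bar>\<Phi> \<tau>\<bar> * indicator {\<omega> - pi<..<\<omega> + pi} \<tau> * cmod (1 - fejer_cardinal N t (\<tau> - \<omega>)))" for N
  have K2: "cmod (1 - fejer_cardinal N t \<nu>) \<le> 2" for N \<nu>
  proof (cases "N = 0")
    case True
    then show ?thesis by (simp add: fejer_cardinal_def)
  next
    case False
    then show ?thesis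
      using norm_triangle_ineq4[of 1 "fejer_cardinal N t \<nu>"] fejer_cardinal_norm_le[of N t \<nu>] by simp
  qed
  have \<Phi>2: "integrable lborel (\<lambda>\<tau>. 2 * \<bar>\<Phi> \<tau>\<bar>)" using \<Phi> by (intro integrable_mult_right integrable_abs)
  have E0: "E \<longlonglongrightarrow> 0"
  proof -
    have "E \<longlonglongrightarrow> (LINT \<tau>|(lborel :: real measure). (0::real))"
      unfolding E_def
    proof (rule integral_dominated_convergence[OF _ _ \<Phi>2])
      show "AE \<tau> in lborel. (\<lambda>N. \<bar>\<Phi> \<tau>\<bar> * indicator {\<omega> - pi<..<\<omega> + pi} \<tau> * cmod (1 - fejer_cardinal N t (\<tau> - \<omega>))) \<longlonglongrightarrow> 0"
      proof (rule AE_I2)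
        fix \<tau>
        show "(\<lambda>N. \<bar>\<Phi> \<tau>\<bar> * indicator {\<omega> - pi<..<\<omega> + pi} \<tau> * cmod (1 - fejer_cardinal N t (\<tau> - \<omega>))) \<longlonglongrightarrow> 0"
        proof (cases "\<tau> \<in> {\<omega> - pi<..<\<omega> + pi}")
          case True
          then have "\<bar>\<tau> - \<omega>\<bar> < pi" by auto
          then have "(\<lambda>N. \<bar>\<Phi> \<tau>\<bar> * indicator {\<omega> - pi<..<\<omega> + pi} \<tau> * cmod (1 - fejer_cardinal N t (\<tau> - \<omega>)))
            \<longlonglongrightarrow> \<bar>\<Phi> \<tau>\<bar> * indicator {\<omega> - pi<..<\<omega> + pi} \<tau> * cmod (1 - 1)"
            by (intro tendsto_intros fejer_cardinal_tendsto)
          then show ?thesis by simp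
        qed simp
      qed
      show "AE \<tau> in lborel. norm (\<bar>\<Phi> \<tau>\<bar> * indicator {\<omega> - pi<..<\<omega> + pi} \<tau> * cmod (1 - fejer_cardinal N t (\<tau> - \<omega>)))
          \<le> 2 * \<bar>\<Phi> \<tau>\<bar>" for N
      proof (rule AE_I2)
        fix \<tau>
        show "norm (\<bar>\<Phi> \<tau>\<bar> * indicator {\<omega> - pi<..<\<omega> + pi} \<tau> * cmod (1 - fejer_cardinal N t (\<tau> - \<omega>))) \<le> 2 * \<bar>\<Phi> \<tau>\<bar>"
          using mult_left_mono[OF K2[of N "\<tau> - \<omega>"], of "\<bar>\<Phi> \<tau>\<bar>"]
          by (cases "\<tau> \<in> {\<omega> - pi<..<\<omega> + pi}") (auto simp: abs_mult mult.commute)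
      qed
    qed measurable
    then show ?thesis by simp
  qed
  have defect: "cmod (of_real (\<phi> 0) - A N) \<le> E N + 2 * T" for N
  proof -
    have intA: "integrable lborel (\<lambda>\<tau>. of_real (\<Phi> \<tau>) * fejer_cardinal N t (\<tau> - \<omega>))"
    proof (rule Bochner_Integration.integrable_bound[OF \<Phi>2])
      show "AE \<tau> in lborel. norm (of_real (\<Phi> \<tau>) * fejer_cardinal N t (\<tau> - \<omega>)) \<le> norm (2 * \<bar>\<Phi> \<tau>\<bar>)"
      proof (rule AE_I2)
        fix \<tau>
        have "cmod (fejer_cardinal N t (\<tau> - \<omega>)) \<le> 2"
          using fejer_cardinal_norm_le[of N t "\<tau> - \<omega>"] by (cases "N = 0") (auto simp: fejer_cardinal_def)
        then show "norm (of_real (\<Phi> \<tau>) * fejer_cardinal N t (\<tau> - \<omega>)) \<le> norm (2 * \<bar>\<Phi> \<tau>\<bar>)"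
          using mult_left_mono[of "cmod (fejer_cardinal N t (\<tau> - \<omega>))" 2 "\<bar>\<Phi> \<tau>\<bar>"] by (simp add: norm_mult mult.commute)
      qed
    qed measurable
    have int0: "integrable lborel (\<lambda>\<tau>. complex_of_real (\<Phi> \<tau>))" using \<Phi> by simp
    have intD: "integrable lborel (\<lambda>\<tau>. of_real (\<Phi> \<tau>) * (1 - fejer_cardinal N t (\<tau> - \<omega>)))"
      using int0 intA by (simp add: right_diff_distrib)
    have "integrable lborel (\<lambda>\<tau>. cmod (of_real (\<Phi> \<tau>) * (1 - fejer_cardinal N t (\<tau> - \<omega>))) * indicator {\<omega> - pi<..<\<omega> + pi} \<tau>)"
      using intD by (intro integrable_real_mult_indicator integrable_norm) auto
    then have int_in: "integrable lborel (\<lambda>\<tau>. \<bar>\<Phi> \<tau>\<bar> * indicator {\<omega> - pi<..<\<omega> + pi} \<tau> * cmod (1 - fejer_cardinal N t (\<tau> - \<omega>)))"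
      by (simp add: norm_mult mult_ac)
    have int_out: "integrable lborel (\<lambda>\<tau>. \<bar>\<Phi> \<tau>\<bar> * indicator (- {\<omega> - pi<..<\<omega> + pi}) \<tau>)"
      using \<Phi> by (intro integrable_real_mult_indicator integrable_abs) auto
    have "complex_of_real (\<phi> 0) = (LINT \<tau>|lborel. of_real (\<Phi> \<tau>))" using \<phi>[of 0] by simp
    then have "complex_of_real (\<phi> 0) - A N = (LINT \<tau>|lborel. of_real (\<Phi> \<tau>) * (1 - fejer_cardinal N t (\<tau> - \<omega>)))"
      using int0 intA by (simp add: A_int right_diff_distrib)
    also have "cmod \<dots> \<le> (LINT \<tau>|lborel. cmod (of_real (\<Phi> \<tau>) * (1 - fejer_cardinal N t (\<tau> - \<omega>))))"
      by (rule integral_norm_bound)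
    also have "\<dots> \<le> (LINT \<tau>|lborel. \<bar>\<Phi> \<tau>\<bar> * indicator {\<omega> - pi<..<\<omega> + pi} \<tau> * cmod (1 - fejer_cardinal N t (\<tau> - \<omega>))
        + 2 * (\<bar>\<Phi> \<tau>\<bar> * indicator (- {\<omega> - pi<..<\<omega> + pi}) \<tau>))"
    proof (rule integral_mono)
      show "integrable lborel (\<lambda>\<tau>. cmod (of_real (\<Phi> \<tau>) * (1 - fejer_cardinal N t (\<tau> - \<omega>))))"
        by (rule integrable_norm[OF intD])
      show "integrable lborel (\<lambda>\<tau>. \<bar>\<Phi> \<tau>\<bar> * indicator {\<omega> - pi<..<\<omega> + pi} \<tau> * cmod (1 - fejer_cardinal N t (\<tau> - \<omega>))
        + 2 * (\<bar>\<Phi> \<tau>\<bar> * indicator (- {\<omega> - pi<..<\<omega> + pi}) \<tau>))"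
        by (intro Bochner_Integration.integrable_add int_in integrable_mult_right int_out)
      fix \<tau>
      show "cmod (of_real (\<Phi> \<tau>) * (1 - fejer_cardinal N t (\<tau> - \<omega>)))
         \<le> \<bar>\<Phi> \<tau>\<bar> * indicator {\<omega> - pi<..<\<omega> + pi} \<tau> * cmod (1 - fejer_cardinal N t (\<tau> - \<omega>))
        + 2 * (\<bar>\<Phi> \<tau>\<bar> * indicator (- {\<omega> - pi<..<\<omega> + pi}) \<tau>)"
        using mult_left_mono[OF K2[of N "\<tau> - \<omega>"], of "\<bar>\<Phi> \<tau>\<bar>"]
        by (cases "\<tau> \<in> {\<omega> - pi<..<\<omega> + pi}") (simp_all add: norm_mult mult.commute)
    qed
    also have "\<dots> = E N + 2 * T"
      using Bochner_Integration.integral_add[OF int_in integrable_mult_right[OF int_out, of 2]]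
      unfolding E_def T_def by (simp only: integral_mult_right_zero)
    finally show ?thesis .
  qed
  have "cmod (of_real (\<phi> 0) - (\<Sum>\<kappa>\<in>S. a \<kappa>)) \<le> 0 + 2 * T"
  proof (rule LIMSEQ_le)
    show "(\<lambda>N. cmod (of_real (\<phi> 0) - A N)) \<longlonglongrightarrow> cmod (of_real (\<phi> 0) - (\<Sum>\<kappa>\<in>S. a \<kappa>))"
      by (intro tendsto_intros A)
    show "(\<lambda>N. E N + 2 * T) \<longlonglongrightarrow> 0 + 2 * T" by (intro tendsto_intros E0)
  qed (use defect in auto)
  then show ?thesis by (simp add: a_def T_def)
qed

section \<open>Continuity and decay of the regularized series\<close>

lemma cardinal_sine_shc: "cardinal_sine t = shc (- (pi * t)\<^sup>2)"
  by (cases "t = 0") (simp_all add: cardinal_sine_def shc_neg_square)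

lemma continuous_on_cardinal_sine: "continuous_on S cardinal_sine"
  unfolding cardinal_sine_shc[abs_def] by (intro continuous_intros)

lemma abs_cardinal_sine_le_one: "\<bar>cardinal_sine t\<bar> \<le> 1"
  using abs_sin_x_le_abs_x[of "pi * t"] by (simp add: cardinal_sine_def divide_le_eq)

definition sampling_kernel :: "nat \<Rightarrow> real \<Rightarrow> real \<Rightarrow> real" where
  "sampling_kernel m \<beta> x = cardinal_sine x * cKB_window m \<beta> x"

lemma continuous_on_sampling_kernel:
  "0 < m \<Longrightarrow> continuous_on S (sampling_kernel m \<beta>)"
  unfolding sampling_kernel_def[abs_def]
  by (intro continuous_intros continuous_on_cardinal_sine continuous_on_cKB_window)

text \<open>
  The finite set may be larger than the support: with one set for all points near \<open>t\<close>, the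
  series is locally a fixed finite sum of continuous functions.
\<close>
lemma regularized_shannon_finite:
  assumes "finite S" "\<And>k. k \<notin> S \<Longrightarrow> real m < \<bar>t - of_int k\<bar>"
  shows "regularized_shannon (cKB_window m \<beta>) m f t
    = (\<Sum>k\<in>S. f (of_int k) * complex_of_real (sampling_kernel m \<beta> (t - of_int k)))"
proof -
  have "regularized_shannon (cKB_window m \<beta>) m f t = (\<Sum>\<^sub>\<infinity>k\<in>S. f (of_int k) *
        complex_of_real (cardinal_sine (t - of_int k) * cKB_window m \<beta> (t - of_int k) *
                         indicator {- real m..real m} (t - of_int k)))"
    unfolding regularized_shannon_def
    by (rule infsum_cong_neutral) (use assms(2) in \<open>fastforce simp: indicator_def\<close>)+
  also have "\<dots> = (\<Sum>k\<in>S. f (of_int k) * complex_of_real (sampling_kernel m \<beta> (t - of_int k)))"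
    using assms(1) by (auto simp: sampling_kernel_def cKB_window_def intro!: sum.cong)
  finally show ?thesis .
qed

definition window_indices :: "nat \<Rightarrow> real \<Rightarrow> int set" where
  "window_indices m t = {\<lceil>t - real m\<rceil>..\<lfloor>t + real m\<rfloor>}"

lemma window_indices_iff: "k \<in> window_indices m t \<longleftrightarrow> \<bar>t - of_int k\<bar> \<le> real m"
  by (simp only: window_indices_def atLeastAtMost_iff ceiling_le_iff le_floor_iff abs_le_iff) auto

lemma finite_window_indices: "finite (window_indices m t)"
  by (simp add: window_indices_def)

lemma card_window_indices: "real (card (window_indices m t)) \<le> 2 * real m + 1"
proof -
  have "real_of_int (\<lfloor>t + real m\<rfloor> - \<lceil>t - real m\<rceil>) \<le> 2 * real m"
    using of_int_floor_le[of "t + real m"] le_of_int_ceiling[of "t - real m"] unfolding of_int_diff by linarith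
  then show ?thesis by (simp add: window_indices_def)
qed

lemma isCont_regularized_shannon:
  assumes "0 < m"
  shows "isCont (regularized_shannon (cKB_window m \<beta>) m f) t"
proof -
  \<comment> \<open>Radius \<open>m + 1\<close> covers the support for every point at distance less than one from \<open>t\<close>.\<close>
  define S where "S = window_indices (m + 1) t"
  have "\<forall>\<^sub>F s in nhds t. regularized_shannon (cKB_window m \<beta>) m f s
      = (\<Sum>k\<in>S. f (of_int k) * complex_of_real (sampling_kernel m \<beta> (s - of_int k)))"
    unfolding eventually_nhds_metric
  proof (intro exI[of _ 1] conjI allI impI)
    fix s assume "dist s t < 1"
    then have "\<bar>s - t\<bar> < 1" by (simp add: dist_real_def)
    then have "real m < \<bar>s - of_int k\<bar>" if "k \<notin> S" for k
    proof -
      have "real m + 1 < \<bar>t - of_int k\<bar>" using that unfolding S_def window_indices_iff by simp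
      then show ?thesis using \<open>\<bar>s - t\<bar> < 1\<close> by linarith
    qed
    then show "regularized_shannon (cKB_window m \<beta>) m f s
      = (\<Sum>k\<in>S. f (of_int k) * complex_of_real (sampling_kernel m \<beta> (s - of_int k)))"
      by (intro regularized_shannon_finite) (simp_all add: S_def finite_window_indices)
  qed simp
  moreover have "isCont (\<lambda>s. \<Sum>k\<in>S. f (of_int k) * complex_of_real (sampling_kernel m \<beta> (s - of_int k))) t"
  proof -
    have "continuous_on UNIV (\<lambda>s. sampling_kernel m \<beta> (s - of_int k))" for k
      by (rule continuous_on_compose2[OF continuous_on_sampling_kernel[OF assms, of UNIV]]) (auto intro!: continuous_intros)
    then have "continuous_on UNIV (\<lambda>s. \<Sum>k\<in>S. f (of_int k) * complex_of_real (sampling_kernel m \<beta> (s - of_int k)))"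
      by (intro continuous_intros)
    then show ?thesis by (simp add: continuous_on_eq_continuous_at)
  qed
  ultimately show ?thesis by (simp add: isCont_cong)
qed

lemma regularized_shannon_vanishes:
  fixes f :: "real \<Rightarrow> complex"
  assumes C: "\<And>x. \<bar>cKB_window m \<beta> x\<bar> \<le> C" and f: "(f \<longlongrightarrow> 0) at_infinity"
  shows "(regularized_shannon (cKB_window m \<beta>) m f \<longlongrightarrow> 0) at_infinity"
proof (rule tendstoI)
  fix e :: real assume e: "0 < e"
  have C0: "0 \<le> C" using C[of 0] by linarith
  \<comment> \<open>\<open>C + 1\<close> instead of \<open>C\<close> keeps the denominator positive and the final inequality strict.\<close>
  define d where "d = e / ((2 * real m + 1) * (C + 1))"
  have d: "0 < d" using e C0 by (simp add: d_def)
  obtain b where b: "\<And>x. b \<le> norm x \<Longrightarrow> cmod (f x) < d"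
    using tendstoD[OF f d] unfolding eventually_at_infinity by auto
  show "\<forall>\<^sub>F t in at_infinity. dist (regularized_shannon (cKB_window m \<beta>) m f t) 0 < e"
    unfolding eventually_at_infinity
  proof (intro exI[of _ "b + real m"] allI impI)
    fix t :: real assume t: "b + real m \<le> norm t"
    have "cmod (regularized_shannon (cKB_window m \<beta>) m f t)
       = cmod (\<Sum>k\<in>window_indices m t. f (of_int k) * complex_of_real (sampling_kernel m \<beta> (t - of_int k)))"
      by (subst regularized_shannon_finite[OF finite_window_indices[of m t]]) (auto simp: window_indices_iff)
    also have "\<dots> \<le> (\<Sum>k\<in>window_indices m t. d * C)"
    proof (rule sum_norm_le)
      fix k assume "k \<in> window_indices m t"
      then have "b \<le> \<bar>real_of_int k\<bar>" using t unfolding window_indices_iff by simp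
      then have "cmod (f (of_int k)) \<le> d" using b[of "of_int k"] by simp
      moreover have "\<bar>sampling_kernel m \<beta> (t - of_int k)\<bar> \<le> 1 * C"
        unfolding sampling_kernel_def abs_mult by (intro mult_mono abs_cardinal_sine_le_one C) auto
      ultimately show "norm (f (of_int k) * complex_of_real (sampling_kernel m \<beta> (t - of_int k))) \<le> d * C"
        unfolding norm_mult norm_of_real using d by (intro mult_mono) auto
    qed
    also have "\<dots> = real (card (window_indices m t)) * (d * C)" by simp
    also have "\<dots> \<le> (2 * real m + 1) * (d * C)"
      using d C0 by (intro mult_right_mono card_window_indices) auto
    also have "\<dots> < (2 * real m + 1) * (d * (C + 1))" using d by (intro mult_strict_left_mono) auto
    also have "\<dots> = e" using C0 by (simp add: d_def)
    finally show "dist (regularized_shannon (cKB_window m \<beta>) m f t) 0 < e" by simp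
  qed
qed

section \<open>Bandlimited functions\<close>

text \<open>
  A value of size \<open>e\<close> far out would, by the Lipschitz condition, force a fixed amount of mass of
  \<open>(cmod (f s))\<^sup>2\<close> in a neighbourhood of fixed length.
\<close>
lemma L2_Lipschitz_vanishes:
  fixes f :: "real \<Rightarrow> complex"
  assumes f: "f \<in> L2_space" and L: "0 < L" "\<And>s t. cmod (f s - f t) \<le> L * \<bar>s - t\<bar>"
  shows "(f \<longlongrightarrow> 0) at_infinity"
proof (rule tendstoI)
  fix e :: real assume e: "0 < e"
  have [measurable]: "f \<in> borel_measurable borel" and int: "integrable lborel (\<lambda>t. (cmod (f t))\<^sup>2)"
    using f by (auto simp: L2_space_def)
  define r where "r = e / (2 * L)"
  have r: "0 < r" using e L by (simp add: r_def)
  have "(\<lambda>n. LINT s|lborel. (cmod (f s))\<^sup>2 * indicator {s. real n \<le> \<bar>s\<bar>} s) \<longlonglongrightarrow> (LINT s|(lborel :: real measure). (0::real))"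
  proof (rule integral_dominated_convergence[OF _ _ int])
    show "AE s in lborel. (\<lambda>n. (cmod (f s))\<^sup>2 * indicator {s. real n \<le> \<bar>s\<bar>} s) \<longlonglongrightarrow> 0"
    proof (rule AE_I2)
      fix s :: real
      obtain M :: nat where "\<bar>s\<bar> < real M" using reals_Archimedean2 by blast
      then have "(cmod (f s))\<^sup>2 * indicator {s. real n \<le> \<bar>s\<bar>} s = 0" if "M \<le> n" for n
        using that by (auto simp: indicator_def)
      then have "\<forall>\<^sub>F n in sequentially. (cmod (f s))\<^sup>2 * indicator {s. real n \<le> \<bar>s\<bar>} s = 0"
        unfolding eventually_sequentially by blast
      then show "(\<lambda>n. (cmod (f s))\<^sup>2 * indicator {s. real n \<le> \<bar>s\<bar>} s) \<longlonglongrightarrow> 0" by (rule tendsto_eventually)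
    qed
  qed (auto simp: indicator_def)
  then have "(\<lambda>n. LINT s|lborel. (cmod (f s))\<^sup>2 * indicator {s. real n \<le> \<bar>s\<bar>} s) \<longlonglongrightarrow> 0" by simp
  moreover have "0 < (e / 2)\<^sup>2 * (2 * r)" using e r by simp
  ultimately obtain n where n: "(LINT s|lborel. (cmod (f s))\<^sup>2 * indicator {s. real n \<le> \<bar>s\<bar>} s) < (e / 2)\<^sup>2 * (2 * r)"
    by (metis (no_types, lifting) order_tendstoD(2) eventually_happens' sequentially_bot)
  show "\<forall>\<^sub>F t in at_infinity. dist (f t) 0 < e"
    unfolding eventually_at_infinity
  proof (intro exI[of _ "real n + r"] allI impI, rule ccontr)
    fix t :: real assume t: "real n + r \<le> norm t" and "\<not> dist (f t) 0 < e"
    then have ft: "e \<le> cmod (f t)" by simp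
    have "(e / 2)\<^sup>2 * (2 * r) = (LINT s|lborel. (e / 2)\<^sup>2 * indicator {t - r..t + r} s)" using r by simp
    also have "\<dots> \<le> (LINT s|lborel. (cmod (f s))\<^sup>2 * indicator {s. real n \<le> \<bar>s\<bar>} s)"
    proof (rule integral_mono)
      show "integrable lborel (\<lambda>s. (cmod (f s))\<^sup>2 * indicator {s. real n \<le> \<bar>s\<bar>} s)"
        using int by (intro integrable_real_mult_indicator) auto
      show "integrable lborel (\<lambda>s. (e / 2)\<^sup>2 * indicator {t - r..t + r} s)"
        by (intro integrable_on_interval' continuous_intros)
      fix s
      show "(e / 2)\<^sup>2 * indicator {t - r..t + r} s \<le> (cmod (f s))\<^sup>2 * indicator {s. real n \<le> \<bar>s\<bar>} s"
      proof (cases "s \<in> {t - r..t + r}")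
        case True
        then have st: "\<bar>t - s\<bar> \<le> r" by auto
        then have "real n \<le> \<bar>s\<bar>" using t by simp
        moreover have "cmod (f t - f s) \<le> e / 2"
        proof -
          have "L * \<bar>t - s\<bar> \<le> L * r" using st L by simp
          also have "L * r = e / 2" using L by (simp add: r_def)
          finally show ?thesis using L(2)[of t s] by linarith
        qed
        then have "e / 2 \<le> cmod (f s)"
          using ft norm_triangle_ineq2[of "f t" "f s"] by linarith
        then have "(e / 2)\<^sup>2 \<le> (cmod (f s))\<^sup>2" using e by (intro power_mono) auto
        ultimately show ?thesis using True by simp
      qed simp
    qed
    finally show False using n by simp
  qed
qed

text \<open>
  The transform is integrable since it is square integrable and supported in a bounded interval.
  The last bound is the Cauchy--Schwarz inequality on an interval of length \<open>2 * \<delta>\<close>, combined with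
  \<open>L2_fourier_norm_le\<close>.
\<close>
lemma bandlimited_representation:
  assumes "bandlimited \<delta> f"
  obtains g where "integrable lborel g" "AE \<omega> in lborel. \<delta> \<le> \<bar>\<omega>\<bar> \<longrightarrow> g \<omega> = 0"
    "\<And>t. f t = complex_of_real (1 / sqrt (2 * pi)) * (LINT \<omega>|lborel. g \<omega> * iexp (t * \<omega>))"
    "(LINT \<omega>|lborel. cmod (g \<omega>)) \<le> sqrt (2 * \<delta>) * L2_norm f"
proof -
  obtain g where fg: "has_L2_fourier f g" and supp: "AE \<omega> in lborel. \<delta> \<le> \<bar>\<omega>\<bar> \<longrightarrow> g \<omega> = 0"
    and \<delta>: "0 < \<delta>" and cont: "continuous_on UNIV f"
    using assms unfolding bandlimited_def by blast
  have g2: "g \<in> L2_space" using fg by (simp add: has_L2_fourier_def)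
  then have [measurable]: "g \<in> borel_measurable borel" by (auto simp: L2_space_def)
  define c where "c \<omega> = complex_of_real (indicator {-\<delta>..\<delta>} \<omega>)" for \<omega> :: real
  have cint: "integrable lborel c" 
    unfolding c_def using integrable_on_interval[of "-\<delta>" \<delta> "\<lambda>_. 1 :: real"] by (intro integrable_of_real) simp
  have c2: "c \<in> L2_space" by (rule L2_bounded_integrable[OF cint, where C=1]) (simp add: c_def)
  have c_norm: "L2_norm c = sqrt (2 * \<delta>)"
  proof -
    have "(cmod (c \<omega>))\<^sup>2 = indicator {-\<delta>..\<delta>} \<omega>" for \<omega> by (simp add: c_def indicator_def)
    then show ?thesis using \<delta> by (simp add: L2_norm_def)
  qed
  have AE1: "AE \<omega> in lborel. g \<omega> * c \<omega> = g \<omega>"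
    using supp by eventually_elim (auto simp: c_def indicator_def)
  have gc: "integrable lborel (\<lambda>\<omega>. g \<omega> * c \<omega>)" by (rule L2_product_integrable[OF g2 c2])
  have [measurable]: "c \<in> borel_measurable borel" using cint by auto
  have g: "integrable lborel g"
    using integrable_cong_AE[of "\<lambda>\<omega>. g \<omega> * c \<omega>" lborel g] AE1 gc by simp
  have "(LINT \<omega>|lborel. cmod (g \<omega>)) = (LINT \<omega>|lborel. cmod (g \<omega>) * cmod (c \<omega>))"
  proof (rule integral_cong_AE)
    show "AE \<omega> in lborel. cmod (g \<omega>) = cmod (g \<omega>) * cmod (c \<omega>)"
      using AE1 by eventually_elim (metis norm_mult)
  qed measurable
  also have "\<dots> \<le> L2_norm g * L2_norm c" by (rule L2_Cauchy_Schwarz[OF g2 c2])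
  also have "\<dots> \<le> L2_norm f * sqrt (2 * \<delta>)"
    unfolding c_norm using \<delta> by (intro mult_right_mono L2_fourier_norm_le[OF fg]) simp
  finally have "(LINT \<omega>|lborel. cmod (g \<omega>)) \<le> sqrt (2 * \<delta>) * L2_norm f" by (simp add: mult.commute)
  moreover have "f t = complex_of_real (1 / sqrt (2 * pi)) * (LINT \<omega>|lborel. g \<omega> * iexp (t * \<omega>))" for t
    using cont by (intro L2_fourier_inversion[OF fg g]) (simp add: continuous_on_eq_continuous_at)
  ultimately show thesis using that[OF g supp] by blast
qed

lemma one_div_sqrt_two_pi_le: "1 / sqrt (2 * pi) \<le> 1"
  using pi_ge_two by (auto intro!: real_le_rsqrt simp: divide_le_eq_1)

text \<open>
  Differentiating the representation shows that \<open>f\<close> is Lipschitz, with a constant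
  governed by the largest frequency.
\<close>
lemma bandlimited_vanishes:
  assumes "bandlimited \<delta> f"
  shows "(f \<longlongrightarrow> 0) at_infinity"
proof -
  obtain g where g: "integrable lborel g" and supp: "AE \<omega> in lborel. \<delta> \<le> \<bar>\<omega>\<bar> \<longrightarrow> g \<omega> = 0"
    and f: "\<And>t. f t = complex_of_real (1 / sqrt (2 * pi)) * (LINT \<omega>|lborel. g \<omega> * iexp (t * \<omega>))"
    using bandlimited_representation[OF assms] by blast
  have f2: "f \<in> L2_space" and \<delta>: "0 < \<delta>" using assms by (auto simp: bandlimited_def)
  have [measurable]: "g \<in> borel_measurable borel" using g by auto
  define G where "G = (LINT \<omega>|lborel. cmod (g \<omega>))"
  have G: "0 \<le> G" by (simp add: G_def)
  have int: "integrable lborel (\<lambda>\<omega>. g \<omega> * iexp (t * \<omega>))" for t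
    by (rule Bochner_Integration.integrable_bound[OF g]) (auto simp: norm_mult simp del: of_real_mult)
  have "cmod (f s - f t) \<le> (\<delta> * (G + 1)) * \<bar>s - t\<bar>" for s t
  proof -
    have "cmod (f s - f t) = 1 / sqrt (2 * pi) * cmod (LINT \<omega>|lborel. g \<omega> * (iexp (s * \<omega>) - iexp (t * \<omega>)))"
      unfolding f right_diff_distrib[symmetric] norm_mult
      unfolding right_diff_distrib Bochner_Integration.integral_diff[OF int int] norm_of_real by simp
    also have "\<dots> \<le> 1 * cmod (LINT \<omega>|lborel. g \<omega> * (iexp (s * \<omega>) - iexp (t * \<omega>)))"
      by (intro mult_right_mono one_div_sqrt_two_pi_le) simp
    also have "\<dots> \<le> (LINT \<omega>|lborel. cmod (g \<omega> * (iexp (s * \<omega>) - iexp (t * \<omega>))))"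
      unfolding mult_1_left by (rule integral_norm_bound)
    also have "\<dots> \<le> (LINT \<omega>|lborel. \<delta> * \<bar>s - t\<bar> * cmod (g \<omega>))"
    proof (rule integral_mono_AE)
      show "integrable lborel (\<lambda>\<omega>. cmod (g \<omega> * (iexp (s * \<omega>) - iexp (t * \<omega>))))"
        using int unfolding right_diff_distrib by (intro integrable_norm Bochner_Integration.integrable_diff)
      show "integrable lborel (\<lambda>\<omega>. \<delta> * \<bar>s - t\<bar> * cmod (g \<omega>))" using g by (intro integrable_mult_right integrable_norm)
      show "AE \<omega> in lborel. cmod (g \<omega> * (iexp (s * \<omega>) - iexp (t * \<omega>))) \<le> \<delta> * \<bar>s - t\<bar> * cmod (g \<omega>)"
        using supp
      proof eventually_elim
        case (elim \<omega>)
        show ?case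
        proof (cases "\<delta> \<le> \<bar>\<omega>\<bar>")
          case True
          then show ?thesis using elim by simp
        next
          case False
          have "iexp (s * \<omega>) - iexp (t * \<omega>) = iexp (t * \<omega>) * (iexp ((s - t) * \<omega>) - 1)"
            by (simp add: algebra_simps flip: exp_add)
          then have "cmod (iexp (s * \<omega>) - iexp (t * \<omega>)) = cmod (iexp ((s - t) * \<omega>) - 1)"
            by (simp only: norm_mult norm_exp_i_times mult_1_left)
          also have "\<dots> \<le> \<bar>(s - t) * \<omega>\<bar>" by (rule norm_iexp_minus_one_le)
          also have "\<dots> \<le> \<bar>s - t\<bar> * \<delta>" unfolding abs_mult using False by (intro mult_left_mono) auto
          finally have "cmod (g \<omega>) * cmod (iexp (s * \<omega>) - iexp (t * \<omega>)) \<le> cmod (g \<omega>) * (\<bar>s - t\<bar> * \<delta>)"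
            by (rule mult_left_mono) simp
          then show ?thesis unfolding norm_mult by (simp only: mult_ac)
        qed
      qed
    qed
    also have "\<dots> = \<delta> * G * \<bar>s - t\<bar>" by (simp add: G_def)
    also have "\<dots> \<le> (\<delta> * (G + 1)) * \<bar>s - t\<bar>" using \<delta> G by (intro mult_right_mono mult_left_mono) auto
    finally show ?thesis .
  qed
  moreover have "0 < \<delta> * (G + 1)" using \<delta> G by simp
  ultimately show ?thesis by (intro L2_Lipschitz_vanishes[OF f2]) auto
qed

section \<open>The error estimate\<close>

text \<open>
  The error of the formula for the single exponential of frequency \<open>\<omega>\<close>. The transformed window is
  integrated over the frequencies at distance at least \<open>pi\<close> from \<open>\<omega>\<close>. The choice
  \<open>\<beta> = m * (pi - \<delta>)\<close> puts all of them into the range of decay, since their distance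
  from zero is more than \<open>pi - \<delta>\<close>.
\<close>
lemma shannon_defect_pointwise:
  assumes m: "0 < m" and \<delta>: "0 < \<delta>" "\<delta> < pi" and \<beta>: "\<beta> = real m * (pi - \<delta>)"
    and I0: "1 < bessel_I0 \<beta>" and \<omega>: "\<bar>\<omega>\<bar> < \<delta>"
  shows "cmod (iexp (t * \<omega>) - (\<Sum>k\<in>window_indices m t. iexp (of_int k * \<omega>) * of_real (sampling_kernel m \<beta> (t - of_int k))))
    \<le> 16 * \<beta> / (3 * (bessel_I0 \<beta> - 1) * (pi + \<delta>))"
proof -
  have \<beta>0: "0 < \<beta>" using m \<delta> by (simp add: \<beta>)
  define D where "D = bessel_I0 \<beta> - 1"
  have D: "0 < D" using I0 by (simp add: D_def)
  \<comment> \<open>The series runs over \<open>t - k\<close>, the defect lemma over \<open>t + \<kappa>\<close>.\<close>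
  let ?S = "uminus ` window_indices m t"
  let ?a = "\<lambda>\<kappa>. iexp (- (\<omega> * (t + of_int \<kappa>))) *
      of_real (cardinal_sine (t + of_int \<kappa>) * cKB_window m \<beta> (t + of_int \<kappa>))"
  have "cmod (of_real (cKB_window m \<beta> 0) - (\<Sum>\<kappa>\<in>?S. ?a \<kappa>))
    \<le> 2 * (LINT \<tau>|lborel. \<bar>kaiser_bessel_hat m \<beta> \<tau>\<bar> * indicator (- {\<omega> - pi<..<\<omega> + pi}) \<tau>)"
  proof (rule regularized_sampling_defect)
    show "integrable lborel (kaiser_bessel_hat m \<beta>)" by (rule integrable_kaiser_bessel_hat[OF m \<beta>0 I0])
    show "complex_of_real (cKB_window m \<beta> x) = (LINT \<tau>|lborel. of_real (kaiser_bessel_hat m \<beta> \<tau>) * iexp (x * \<tau>))" for x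
      by (rule cKB_window_inversion[OF m \<beta>0 I0])
    show "finite ?S" by (simp add: finite_window_indices)
    fix \<kappa> assume "\<kappa> \<notin> ?S"
    then have "- \<kappa> \<notin> window_indices m t" by (metis image_eqI minus_minus)
    then show "cKB_window m \<beta> (t + of_int \<kappa>) = 0"
      using m by (intro cKB_window_outside) (simp_all add: window_indices_iff)
  qed
  also have "\<dots> \<le> 2 * (4 * \<beta>\<^sup>2 / (3 * pi * D * real m) * (1 / (pi + \<omega>) + 1 / (pi - \<omega>)))"
    unfolding D_def using m \<omega>
    by (intro mult_left_mono kaiser_bessel_hat_outside[OF m \<beta>0 I0]) (auto simp: \<beta> intro!: mult_left_mono)
  also have "\<dots> \<le> 2 * (4 * \<beta>\<^sup>2 / (3 * pi * D * real m) * (2 * pi / ((pi - \<delta>) * (pi + \<delta>))))"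
  proof (intro mult_left_mono)
    \<comment> \<open>The sum of the reciprocals is largest at the band edge \<open>\<bar>\<omega>\<bar> = \<delta>\<close>.\<close>
    have "\<omega>\<^sup>2 \<le> \<delta>\<^sup>2" using \<omega> by (intro abs_le_square_iff[THEN iffD1]) auto
    then have le: "(pi - \<delta>) * (pi + \<delta>) \<le> (pi - \<omega>) * (pi + \<omega>)"
      by (simp add: power2_eq_square algebra_simps)
    have pos: "0 < pi - \<omega>" "0 < pi + \<omega>" using \<omega> \<delta> by auto
    have "1 / (pi + \<omega>) + 1 / (pi - \<omega>) = 2 * pi / ((pi - \<omega>) * (pi + \<omega>))"
      using pos by (simp add: add_frac_eq mult.commute)
    also have "\<dots> \<le> 2 * pi / ((pi - \<delta>) * (pi + \<delta>))"
      using le pos \<delta> by (intro divide_left_mono mult_pos_pos) auto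
    finally show "1 / (pi + \<omega>) + 1 / (pi - \<omega>) \<le> 2 * pi / ((pi - \<delta>) * (pi + \<delta>))" .
  qed (use D in auto)
  also have "\<dots> = 16 * \<beta> / (3 * D * (pi + \<delta>))"
  proof -
    have "2 * (4 * (M * p)\<^sup>2 / (3 * q * D * M) * (2 * q / (p * s))) = 16 * (M * p) / (3 * D * s)"
      if "0 < M" "0 < p" "0 < q" "0 < s" for M p q s :: real
      using that D by (simp add: field_simps power2_eq_square)
    from this[of "real m" "pi - \<delta>" pi "pi + \<delta>"] show ?thesis
      using m \<delta> by (simp add: \<beta>)
  qed
  finally have "cmod (of_real (cKB_window m \<beta> 0) - (\<Sum>\<kappa>\<in>?S. ?a \<kappa>)) \<le> 16 * \<beta> / (3 * D * (pi + \<delta>))" .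
  moreover have "iexp (t * \<omega>) - (\<Sum>k\<in>window_indices m t. iexp (of_int k * \<omega>) * of_real (sampling_kernel m \<beta> (t - of_int k)))
     = iexp (t * \<omega>) * (of_real (cKB_window m \<beta> 0) - (\<Sum>\<kappa>\<in>?S. ?a \<kappa>))"
  proof -
    have "iexp (t * \<omega>) * ?a (- k) = iexp (of_int k * \<omega>) * of_real (sampling_kernel m \<beta> (t - of_int k))" for k
    proof -
      have "iexp (t * \<omega>) * iexp (- (\<omega> * (t + of_int (- k)))) = iexp (of_int k * \<omega>)"
        by (simp add: algebra_simps flip: exp_add)
      then show ?thesis unfolding sampling_kernel_def mult.assoc[symmetric] by simp
    qed
    then have "iexp (t * \<omega>) * (\<Sum>\<kappa>\<in>?S. ?a \<kappa>)
        = (\<Sum>k\<in>window_indices m t. iexp (of_int k * \<omega>) * of_real (sampling_kernel m \<beta> (t - of_int k)))"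
      by (subst sum.reindex) (simp_all only: inj_on_def sum_distrib_left o_def neg_equal_iff_equal, auto)
    then show ?thesis using I0 by (simp only: right_diff_distrib cKB_window_zero of_real_1 mult_1_right)
  qed
  ultimately show ?thesis by (simp only: norm_mult norm_exp_i_times mult_1_left D_def)
qed

text \<open>
  Superpose the errors for single exponentials. The factor \<open>sqrt (\<delta> / pi)\<close> from the
  Cauchy--Schwarz inequality and the factor \<open>1 / (pi + \<delta>)\<close> from the defect combine to at most
  \<open>1 / (2 * pi)\<close>, so \<open>\<delta>\<close> enters the result only through \<open>\<beta>\<close>.
\<close>
lemma shannon_error_pointwise:
  assumes m: "0 < m" and bl: "bandlimited \<delta> f" and \<delta>: "\<delta> < pi" and \<beta>: "\<beta> = real m * (pi - \<delta>)"
    and I0: "1 < bessel_I0 \<beta>"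
  shows "cmod (f t - regularized_shannon (cKB_window m \<beta>) m f t)
    \<le> 8 * \<beta> / (3 * pi * (bessel_I0 \<beta> - 1)) * L2_norm f"
proof -
  have \<delta>0: "0 < \<delta>" using bl by (simp add: bandlimited_def)
  have \<beta>0: "0 < \<beta>" using m \<delta> by (simp add: \<beta>)
  obtain g where g: "integrable lborel g" and supp: "AE \<omega> in lborel. \<delta> \<le> \<bar>\<omega>\<bar> \<longrightarrow> g \<omega> = 0"
    and f: "\<And>t. f t = complex_of_real (1 / sqrt (2 * pi)) * (LINT \<omega>|lborel. g \<omega> * iexp (t * \<omega>))"
    and G: "(LINT \<omega>|lborel. cmod (g \<omega>)) \<le> sqrt (2 * \<delta>) * L2_norm f"
    using bandlimited_representation[OF bl] by blast
  have [measurable]: "g \<in> borel_measurable borel" using g by auto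
  define S where "S = window_indices m t"
  define \<psi> where "\<psi> k = complex_of_real (sampling_kernel m \<beta> (t - of_int k))" for k :: int
  define B where "B = 16 * \<beta> / (3 * (bessel_I0 \<beta> - 1) * (pi + \<delta>))"
  have B: "0 \<le> B" using \<beta>0 I0 \<delta>0 by (simp add: B_def)
  have int: "integrable lborel (\<lambda>\<omega>. g \<omega> * iexp (s * \<omega>))" for s
    by (rule Bochner_Integration.integrable_bound[OF g]) (auto simp: norm_mult simp del: of_real_mult)
  have int2: "integrable lborel (\<lambda>\<omega>. g \<omega> * iexp (of_int k * \<omega>) * \<psi> k)" for k
    by (rule integrable_mult_left[OF int])
  have eqsum: "g \<omega> * (iexp (t * \<omega>) - (\<Sum>k\<in>S. iexp (of_int k * \<omega>) * \<psi> k))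
      = g \<omega> * iexp (t * \<omega>) - (\<Sum>k\<in>S. g \<omega> * iexp (of_int k * \<omega>) * \<psi> k)" for \<omega>
    by (simp only: right_diff_distrib sum_distrib_left mult.assoc)
  have "regularized_shannon (cKB_window m \<beta>) m f t = (\<Sum>k\<in>S. f (of_int k) * \<psi> k)"
    unfolding S_def \<psi>_def
    by (rule regularized_shannon_finite[OF finite_window_indices]) (simp add: window_indices_iff)
  also have "\<dots> = complex_of_real (1 / sqrt (2 * pi)) * (\<Sum>k\<in>S. (LINT \<omega>|lborel. g \<omega> * iexp (of_int k * \<omega>) * \<psi> k))"
    unfolding f[of "of_int _"] sum_distrib_left integral_mult_left_zero by (simp only: mult.assoc)
  also have "(\<Sum>k\<in>S. (LINT \<omega>|lborel. g \<omega> * iexp (of_int k * \<omega>) * \<psi> k))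
      = (LINT \<omega>|lborel. (\<Sum>k\<in>S. g \<omega> * iexp (of_int k * \<omega>) * \<psi> k))"
    by (rule Bochner_Integration.integral_sum[symmetric]) (rule int2)
  finally have "f t - regularized_shannon (cKB_window m \<beta>) m f t
     = complex_of_real (1 / sqrt (2 * pi)) * ((LINT \<omega>|lborel. g \<omega> * iexp (t * \<omega>))
        - (LINT \<omega>|lborel. (\<Sum>k\<in>S. g \<omega> * iexp (of_int k * \<omega>) * \<psi> k)))"
    unfolding f[of t] right_diff_distrib by simp
  also have "(LINT \<omega>|lborel. g \<omega> * iexp (t * \<omega>)) - (LINT \<omega>|lborel. (\<Sum>k\<in>S. g \<omega> * iexp (of_int k * \<omega>) * \<psi> k))
     = (LINT \<omega>|lborel. g \<omega> * (iexp (t * \<omega>) - (\<Sum>k\<in>S. iexp (of_int k * \<omega>) * \<psi> k)))"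
    unfolding eqsum
    by (rule Bochner_Integration.integral_diff[symmetric]) (intro int Bochner_Integration.integrable_sum int2)+
  finally have "cmod (f t - regularized_shannon (cKB_window m \<beta>) m f t)
     = 1 / sqrt (2 * pi) * cmod (LINT \<omega>|lborel. g \<omega> * (iexp (t * \<omega>) - (\<Sum>k\<in>S. iexp (of_int k * \<omega>) * \<psi> k)))"
    by (simp only: norm_mult norm_of_real) simp
  also have "\<dots> \<le> 1 / sqrt (2 * pi) * (B * (sqrt (2 * \<delta>) * L2_norm f))"
  proof (intro mult_left_mono)
    have "cmod (LINT \<omega>|lborel. g \<omega> * (iexp (t * \<omega>) - (\<Sum>k\<in>S. iexp (of_int k * \<omega>) * \<psi> k)))
      \<le> (LINT \<omega>|lborel. cmod (g \<omega> * (iexp (t * \<omega>) - (\<Sum>k\<in>S. iexp (of_int k * \<omega>) * \<psi> k))))"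
      by (rule integral_norm_bound)
    also have "\<dots> \<le> (LINT \<omega>|lborel. B * cmod (g \<omega>))"
    proof (rule integral_mono_AE)
      show "integrable lborel (\<lambda>\<omega>. cmod (g \<omega> * (iexp (t * \<omega>) - (\<Sum>k\<in>S. iexp (of_int k * \<omega>) * \<psi> k))))"
        unfolding eqsum
        by (intro integrable_norm Bochner_Integration.integrable_diff int Bochner_Integration.integrable_sum int2)
      show "integrable lborel (\<lambda>\<omega>. B * cmod (g \<omega>))" using g by (intro integrable_mult_right integrable_norm)
      show "AE \<omega> in lborel. cmod (g \<omega> * (iexp (t * \<omega>) - (\<Sum>k\<in>S. iexp (of_int k * \<omega>) * \<psi> k))) \<le> B * cmod (g \<omega>)"
        using supp
      proof eventually_elim
        case (elim \<omega>)
        show ?case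
        proof (cases "\<delta> \<le> \<bar>\<omega>\<bar>")
          case True
          then show ?thesis using elim by simp
        next
          case False
          then have "cmod (iexp (t * \<omega>) - (\<Sum>k\<in>S. iexp (of_int k * \<omega>) * \<psi> k)) \<le> B"
            unfolding S_def \<psi>_def B_def
            by (intro shannon_defect_pointwise[OF m \<delta>0 \<delta> \<beta> I0]) simp
          then show ?thesis unfolding norm_mult by (subst mult.commute) (rule mult_right_mono, simp_all)
        qed
      qed
    qed
    also have "\<dots> \<le> B * (sqrt (2 * \<delta>) * L2_norm f)"
      using mult_left_mono[OF G B] by simp
    finally show "cmod (LINT \<omega>|lborel. g \<omega> * (iexp (t * \<omega>) - (\<Sum>k\<in>S. iexp (of_int k * \<omega>) * \<psi> k)))
      \<le> B * (sqrt (2 * \<delta>) * L2_norm f)" .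
  qed simp
  also have "\<dots> = 16 * \<beta> / (3 * (bessel_I0 \<beta> - 1)) * L2_norm f * (sqrt (\<delta> / pi) / (pi + \<delta>))"
    by (simp add: B_def real_sqrt_mult real_sqrt_divide mult_ac)
  also have "\<dots> \<le> 16 * \<beta> / (3 * (bessel_I0 \<beta> - 1)) * L2_norm f * (1 / (2 * pi))"
  proof (rule mult_left_mono)
    \<comment> \<open>The arithmetic--geometric mean inequality for \<open>pi\<close> and \<open>\<delta>\<close>.\<close>
    have "2 * pi * sqrt (\<delta> / pi) \<le> pi + \<delta>"
    proof -
      have "0 \<le> (1 - sqrt (\<delta> / pi))\<^sup>2" by simp
      also have "\<dots> = 1 - 2 * sqrt (\<delta> / pi) + \<delta> / pi" using \<delta>0 by (simp add: power2_diff)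
      finally have "pi * 0 \<le> pi * (1 - 2 * sqrt (\<delta> / pi) + \<delta> / pi)" by (intro mult_left_mono) auto
      then show ?thesis by (simp add: algebra_simps)
    qed
    then show "sqrt (\<delta> / pi) / (pi + \<delta>) \<le> 1 / (2 * pi)"
      using \<delta>0 pi_gt_zero by (simp add: divide_simps mult_ac del: pi_gt_zero)
    show "0 \<le> 16 * \<beta> / (3 * (bessel_I0 \<beta> - 1)) * L2_norm f" using \<beta>0 I0 by simp
  qed
  also have "\<dots> = 8 * \<beta> / (3 * pi * (bessel_I0 \<beta> - 1)) * L2_norm f"
  proof -
    have "16 * b / (3 * d) * l * (1 / (2 * p)) = 8 * b / (3 * p * d) * l" for b d l p :: real
      by (simp add: mult_ac)
    then show ?thesis .
  qed
  finally show ?thesis .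
qed

theorem theorem5p3:
  fixes m :: nat and \<delta> \<beta> :: real and f :: "real \<Rightarrow> complex"
  assumes "m \<ge> 2"
    and "f \<in> L2_space" and "continuous_on UNIV f"
    and "0 < \<delta>" and "\<delta> \<le> (real m - 1) / real m * pi"
    and "bandlimited \<delta> f"
    and "\<beta> = real m * (pi - \<delta>)"
  shows "(\<lambda>t. f t - regularized_shannon (cKB_window m \<beta>) m f t) \<in> C0_space \<and>
    C0_norm (\<lambda>t. f t - regularized_shannon (cKB_window m \<beta>) m f t)
      \<le> (7 / 8 * real m * (pi - \<delta>) + 7 / pi * (real m)\<^sup>2 * (pi - \<delta>)\<^sup>2)
         * exp (- (real m * (pi - \<delta>))) * L2_norm f"
proof -
  have m: "0 < m" using assms(1) by simp
  \<comment> \<open>The upper bound on \<open>\<delta>\<close> says exactly that \<open>\<beta> \<ge> pi\<close>.\<close>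
  have "\<delta> * real m \<le> (real m - 1) * pi"
    using assms(5) m by (simp add: field_simps)
  then have \<beta>pi: "pi \<le> \<beta>" unfolding assms(7) by (simp add: algebra_simps)
  have \<beta>0: "0 < \<beta>" using \<beta>pi pi_gt_zero by linarith
  then have \<delta>: "\<delta> < pi" using m unfolding assms(7) by (simp add: zero_less_mult_iff)
  have D: "8 / 21 * exp \<beta> / (\<beta> + pi / 8) \<le> bessel_I0 \<beta> - 1" by (rule bessel_I0_lower_bound[OF \<beta>pi])
  moreover have Dpos: "0 < 8 / 21 * exp \<beta> / (\<beta> + pi / 8)"
    using \<beta>0 by (intro divide_pos_pos add_pos_pos) auto
  ultimately have I0: "1 < bessel_I0 \<beta>" by linarith
  let ?E = "\<lambda>t. f t - regularized_shannon (cKB_window m \<beta>) m f t"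
  have bound: "8 * \<beta> / (3 * pi * (bessel_I0 \<beta> - 1))
      \<le> (7 / 8 * real m * (pi - \<delta>) + 7 / pi * (real m)\<^sup>2 * (pi - \<delta>)\<^sup>2) * exp (- (real m * (pi - \<delta>)))"
  proof -
    have "8 * \<beta> / (3 * pi * (bessel_I0 \<beta> - 1)) \<le> 8 * \<beta> / (3 * pi * (8 / 21 * exp \<beta> / (\<beta> + pi / 8)))"
      using D Dpos \<beta>0 I0 by (intro divide_left_mono mult_left_mono mult_pos_pos) auto
    also have "\<dots> = 7 * \<beta> * (\<beta> + pi / 8) / pi * exp (- \<beta>)"
      using \<beta>0 by (simp add: exp_minus field_simps)
    also have "\<dots> = (7 / 8 * \<beta> + 7 / pi * \<beta>\<^sup>2) * exp (- \<beta>)"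
      by (simp add: field_simps power2_eq_square)
    finally show ?thesis by (simp add: assms(7) power_mult_distrib mult_ac)
  qed
  have "isCont ?E t" for t
    using assms(3) isCont_regularized_shannon[OF m]
    by (intro continuous_diff) (simp_all add: continuous_on_eq_continuous_at)
  then have "continuous_on UNIV ?E" by (simp add: continuous_on_eq_continuous_at)
  moreover have "(?E \<longlongrightarrow> 0 - 0) at_infinity"
  proof (intro tendsto_diff bandlimited_vanishes[OF assms(6)] regularized_shannon_vanishes)
    fix x
    have "\<bar>cKB_window m \<beta> x\<bar> = cmod (LINT \<tau>|lborel. of_real (kaiser_bessel_hat m \<beta> \<tau>) * iexp (x * \<tau>))"
      unfolding cKB_window_inversion[OF m \<beta>0 I0, symmetric] by simp
    also have "\<dots> \<le> (LINT \<tau>|lborel. cmod (of_real (kaiser_bessel_hat m \<beta> \<tau>) * iexp (x * \<tau>)))"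
      by (rule integral_norm_bound)
    finally show "\<bar>cKB_window m \<beta> x\<bar> \<le> (LINT \<tau>|lborel. \<bar>kaiser_bessel_hat m \<beta> \<tau>\<bar>)"
      by (simp only: norm_mult norm_exp_i_times mult_1_right norm_of_real)
  qed
  ultimately have "?E \<in> C0_space" by (simp add: C0_space_def)
  moreover have "C0_norm ?E \<le> (7 / 8 * real m * (pi - \<delta>) + 7 / pi * (real m)\<^sup>2 * (pi - \<delta>)\<^sup>2)
         * exp (- (real m * (pi - \<delta>))) * L2_norm f"
    unfolding C0_norm_def
  proof (rule cSUP_least)
    fix t
    show "cmod (?E t) \<le> (7 / 8 * real m * (pi - \<delta>) + 7 / pi * (real m)\<^sup>2 * (pi - \<delta>)\<^sup>2)
         * exp (- (real m * (pi - \<delta>))) * L2_norm f"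
      using shannon_error_pointwise[OF m assms(6) \<delta> assms(7) I0, of t] mult_right_mono[OF bound L2_norm_nonneg[of f]]
      by linarith
  qed simp
  ultimately show ?thesis ..
qed

end
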